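(* Let $q\ge 1$ be squarefree, let $f\in S_2(\Gamma_0(q))$ with Fourier expansion $f(z)=\sum_{n\ge1}a(n)e(nz)$ at $\infty$, let $\alpha=\Re(f(z)\,dz)$, and for $r\in\mathbb{Q}$ put $\langle r\rangle=2\pi i\int_{i\infty}^{r}\alpha$. For $c\in\mathbb{N}$ and $x\in[0,1]$ let $$G_c(x)=\frac1c\sum_{0\le a\le cx}\langle a/c\rangle,\qquad g(x)=\frac{1}{2\pi i}\sum_{n\ge1}\frac{\Re\big(a(n)(e(nx)-1)\big)}{n^2}.$$ Then for every $x\in[0,1]$, $$\frac1M\sum_{1\le c\le M}G_c(x)\longrightarrow g(x)\qquad (M\to\infty).$$
   Context: $e(x)=e^{2\pi i x}$. $S_2(\Gamma_0(q))$ is the space of holomorphic weight-2 cusp forms for $\Gamma_0(q)=\{\begin{pmatrix}a&b\\c&d\end{pmatrix}\in SL_2(\mathbb Z): q\mid c\}$. The integral defining $\langle r\rangle$ is taken along the vertical line from $i\infty$ to $r$ (it converges since $f$ is cuspidal). The sum in $G_c(x)$ runs over all integers $a$ with $0\le a\le cx$ (not only those coprime to $c$). *)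

theory Defs
  imports "HOL-Analysis.Analysis" "HOL-Computational_Algebra.Squarefree"
begin

definition e :: "complex \<Rightarrow> complex" where
  "e x = exp (2 * of_real pi * \<i> * x)"

definition upper_half_plane :: "complex set" where
  "upper_half_plane = {z. Im z > 0}"

definition moebius_int :: "int \<Rightarrow> int \<Rightarrow> int \<Rightarrow> int \<Rightarrow> complex \<Rightarrow> complex" where
  "moebius_int a b c d z = (of_int a * z + of_int b) / (of_int c * z + of_int d)"

definition slash2 :: "(complex \<Rightarrow> complex) \<Rightarrow> int \<Rightarrow> int \<Rightarrow> int \<Rightarrow> int \<Rightarrow> complex \<Rightarrow> complex" where
  "slash2 f a b c d z = inverse ((of_int c * z + of_int d)^2) * f (moebius_int a b c d z)"

definition S2 :: "nat \<Rightarrow> (complex \<Rightarrow> complex) set" where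
  "S2 q = {f. f holomorphic_on upper_half_plane
     \<and> (\<forall>a b c d z. a * d - b * c = 1 \<and> int q dvd c \<and> z \<in> upper_half_plane
            \<longrightarrow> slash2 f a b c d z = f z)
     \<and> (\<forall>a b c d. a * d - b * c = 1 \<longrightarrow>
            (\<forall>\<epsilon>>0. \<exists>Y. \<forall>z. Im z > Y \<longrightarrow> norm (slash2 f a b c d z) < \<epsilon>))}"

text \<open>Modular symbol <r> = 2 pi i int_{i infinity}^{r} Re(f(z) dz), integrated along the vertical
  line z = r + i t, t from infinity down to 0 (so dz = i dt, orientation reversed).\<close>
definition modsym :: "(complex \<Rightarrow> complex) \<Rightarrow> real \<Rightarrow> complex" where
  "modsym f r = 2 * of_real pi * \<i> *
      of_real (- integral {0<..} (\<lambda>t::real. Re (f (of_real r + \<i> * of_real t) * \<i>)))"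

definition G :: "(complex \<Rightarrow> complex) \<Rightarrow> nat \<Rightarrow> real \<Rightarrow> complex" where
  "G f c x = (1 / of_nat c) * (\<Sum>a\<in>{a::nat. real a \<le> real c * x}. modsym f (real a / real c))"

definition gfun :: "(nat \<Rightarrow> complex) \<Rightarrow> real \<Rightarrow> complex" where
  "gfun an x = (1 / (2 * of_real pi * \<i>)) *
     (\<Sum>n. of_real (Re (an (Suc n) * (e (of_nat (Suc n) * of_real x) - 1)) / (real (Suc n))^2))"

end

theory Submission
  imports Defs "HOL-Complex_Analysis.Complex_Analysis" "HOL-Number_Theory.Number_Theory"
    "HOL-Real_Asymp.Real_Asymp"
begin

text \<open>Let \<open>F\<close> be the primitive of \<open>f\<close> vanishing at \<open>i \<infinity>\<close>; the modular symbol of \<open>a/c\<close> is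
  \<open>2 \<pi> i\<close> times the real part of the boundary value of \<open>F\<close> at \<open>a/c\<close>. For a matrix \<open>\<gamma>\<close> in \<open>SL\<^sub>2(Z)\<close> with
  first column \<open>(a, c)\<close>, modularity gives the exact formula
  \<open>F(a/c) = F(a/c + i y) - F\<^sub>\<gamma>(-d/c + i/(c\<^sup>2 y))\<close> for every \<open>y > 0\<close>, where \<open>F\<^sub>\<gamma>\<close> is the primitive of
  \<open>f|\<gamma>\<close> that vanishes at \<open>i \<infinity>\<close>. Take \<open>y\<close> slightly larger than \<open>M\<^sup>-\<^sup>2\<close>, the same for all \<open>c \<le> M\<close>.

  In the first term insert the Fourier expansion of \<open>F\<close>. The quadrature error of \<open>e(n u)\<close> on the points
  \<open>a/c\<close> is governed by the distance of \<open>n\<close> to the multiples of \<open>c\<close>, so its sum over \<open>c \<le> M\<close> is a sum of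
  divisor functions near \<open>n\<close>; with the mean square bound for the coefficients this is \<open>o(M)\<close>.

  In the second term \<open>d\<close> is the inverse of \<open>a\<close> modulo \<open>c\<close>, up to a fixed unit, and \<open>F\<^sub>\<gamma>\<close> is a mean zero
  periodic function with Lipschitz constant \<open>O(c\<^sup>2 y)\<close>. Kloosterman's elementary fourth moment bound makes
  these inverses equidistributed with a power saving, hence this term is negligible as well.\<close>

section \<open>Additive characters modulo c\<close>

text \<open>Height \<open>M^-2\<close> is the exact borderline. There the Fourier side, even after
  averaging, costs about \<open>y^(-1/2) / M = 1\<close>, and the trivial bound for the dual term is
  about \<open>M^2 y = 1\<close>. Size estimates alone therefore fail by a hair, and any power
  saving on the dual side opens a gap. The bound \<open>O(c^(3/4 + \<epsilon>))\<close> for a single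
  Kloosterman sum turns the dual error into about \<open>M^(7/4) y\<close>, so the admissible window
  for \<open>y\<close> lies strictly between \<open>M^-2\<close> and \<open>M^(-7/4)\<close>; the
  choice \<open>M^(-15/8)\<close> is its middle. The average over \<open>c\<close> serves the
  Fourier side. For one fixed \<open>c\<close> the frequencies \<open>n\<close> close to multiples
  of \<open>c\<close> are integrated with no gain at all; but a given \<open>n\<close> is close to
  multiples of few moduli only, since each such modulus divides a number near \<open>n\<close>. All
  estimates concern complex boundary values of \<open>F\<close>; the real part is taken only in the
  limit.\<close>

definition ec :: "int \<Rightarrow> int \<Rightarrow> complex" where
  "ec c k = e (of_int k / of_int c)"

lemma e_add: "e (x + y) = e x * e y"
  by (simp add: e_def exp_add distrib_left)

lemma e_0 [simp]: "e 0 = 1"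
  by (simp add: e_def)

lemma e_of_int [simp]: "e (of_int n) = 1"
proof -
  have "e (of_int n) = exp (of_int n * (of_real (2 * pi) * \<i>))"
    by (simp add: e_def mult_ac)
  also have "\<dots> = 1"
    by (subst exp_eq_1) auto
  finally show ?thesis .
qed

lemma norm_e: "norm (e z) = exp (- 2 * pi * Im z)"
  by (simp add: e_def)

lemma norm_ec [simp]: "norm (ec c k) = 1"
proof -
  have "Im (of_int k / of_int c :: complex) = 0"
    by (metis Im_complex_of_real of_real_divide of_real_of_int_eq)
  then show ?thesis
    by (simp add: ec_def norm_e)
qed

lemma ec_add: "ec c (k + l) = ec c k * ec c l"
  by (simp add: ec_def e_add add_divide_distrib)

lemma ec_0 [simp]: "ec c 0 = 1"
  by (simp add: ec_def)

lemma ec_multiple [simp]: "c \<noteq> 0 \<Longrightarrow> ec c (c * k) = 1"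
  by (simp add: ec_def)

lemma ec_minus: "ec c (- k) = cnj (ec c k)"
proof -
  have "ec c (-k) * ec c k = 1"
    by (subst ec_add [symmetric]) simp
  moreover have "cnj (ec c k) * ec c k = 1"
    using complex_norm_square[of "ec c k"] by (simp add: mult_ac)
  ultimately show ?thesis
    by (metis mult_cancel_right zero_neq_one mult_zero_right)
qed

lemma ec_diff: "ec c (k - l) = ec c k * cnj (ec c l)"
  using ec_add[of c k "-l"] by (simp add: ec_minus)

lemma ec_cong:
  assumes "[k = l] (mod c)" "c \<noteq> 0"
  shows "ec c k = ec c l"
proof -
  obtain j where "k = l + c * j"
    using assms(1) by (metis cong_iff_lin cong_sym mult.commute)
  with assms(2) show ?thesis
    by (simp add: ec_add)
qed

lemma ec_power: "ec c k ^ n = ec c (int n * k)"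
  by (induction n) (auto simp: ec_add distrib_right)

lemma ec_eq_1_iff:
  assumes "c \<noteq> 0"
  shows "ec c k = 1 \<longleftrightarrow> c dvd k"
proof
  assume "ec c k = 1"
  then obtain n :: int where n: "Im (2 * complex_of_real pi * \<i> * (of_int k / of_int c)) = of_int (2 * n) * pi"
    by (auto simp: ec_def e_def exp_eq_1)
  have "complex_of_int k / of_int c = of_real (of_int k / of_int c)"
    by simp
  with n have "2 * pi * (of_int k / of_int c) = of_int (2 * n) * pi"
    by (metis Im_complex_of_real Re_complex_of_real mult.commute mult.left_commute of_real_mult Im_i_times of_real_numeral)
  then have "of_int k = (of_int (n * c) :: real)"
    using assms by (simp add: field_simps)
  then have "k = n * c"
    by (simp only: of_int_eq_iff)
  then show "c dvd k" by simp
next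
  assume "c dvd k"
  then show "ec c k = 1" using assms by (auto elim!: dvdE)
qed

lemma sum_int_interval_eq_nat:
  fixes g :: "int \<Rightarrow> 'a::comm_monoid_add"
  assumes "c \<ge> 0"
  shows "(\<Sum>m\<in>{0..<c}. g m) = (\<Sum>i<nat c. g (int i))"
  by (rule sum.reindex_bij_witness[of _ int nat]) (use assms in auto)

lemma ec_orthogonality:
  assumes "c > 0"
  shows "(\<Sum>m\<in>{0..<c}. ec c (m * k)) = (if c dvd k then of_int c else 0)"
proof (cases "c dvd k")
  case True
  then have "ec c (m * k) = 1" for m
    using assms by (subst ec_eq_1_iff) auto
  with True assms show ?thesis by simp
next
  case False
  have "(\<Sum>m\<in>{0..<c}. ec c (m * k)) = (\<Sum>i<nat c. ec c k ^ i)"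
    using assms by (subst sum_int_interval_eq_nat) (auto simp: ec_power)
  also have "\<dots> = 0"
    using assms False by (subst sum_gp_strict) (auto simp: ec_eq_1_iff ec_power)
  finally show ?thesis using False by simp
qed

text \<open>Expanding the square leaves a product of two geometric sums, over \<open>m\<close> and
  over \<open>n\<close>, and orthogonality keeps just the pairs with both coordinates congruent. A
  moment of exponential sums thereby becomes a count of solutions.\<close>

lemma ec_fourier_plancherel:
  assumes "c > 0" "finite P"
  shows "(\<Sum>m\<in>{0..<c}. \<Sum>n\<in>{0..<c}. norm (\<Sum>p\<in>P. ec c (m * s p + n * t p)) ^ 2)
       = of_int c ^ 2 * real (card {(p, p'). p \<in> P \<and> p' \<in> P \<and> c dvd s p - s p' \<and> c dvd t p - t p'})"
    (is "?L = ?R")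
proof -
  let ?S = "\<lambda>m n. \<Sum>p\<in>P. ec c (m * s p + n * t p)"
  have "complex_of_real (norm (?S m n) ^ 2)
      = (\<Sum>p\<in>P. \<Sum>p'\<in>P. ec c (m * (s p - s p')) * ec c (n * (t p - t p')))" for m n
  proof -
    have "complex_of_real (norm (?S m n) ^ 2) = ?S m n * cnj (?S m n)"
      by (rule complex_norm_square)
    also have "\<dots> = (\<Sum>p\<in>P. \<Sum>p'\<in>P. ec c (m * s p + n * t p) * cnj (ec c (m * s p' + n * t p')))"
      by (simp add: sum_product)
    also have "\<dots> = (\<Sum>p\<in>P. \<Sum>p'\<in>P. ec c (m * (s p - s p')) * ec c (n * (t p - t p')))"
      by (intro sum.cong refl, subst ec_diff [symmetric], subst ec_add [symmetric]) (simp add: algebra_simps)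
    finally show ?thesis .
  qed
  then have "complex_of_real ?L = (\<Sum>m\<in>{0..<c}. \<Sum>n\<in>{0..<c}. \<Sum>p\<in>P. \<Sum>p'\<in>P.
      ec c (m * (s p - s p')) * ec c (n * (t p - t p')))"
    by simp
  also have "\<dots> = (\<Sum>m\<in>{0..<c}. \<Sum>p\<in>P. \<Sum>n\<in>{0..<c}. \<Sum>p'\<in>P.
      ec c (m * (s p - s p')) * ec c (n * (t p - t p')))"
    by (intro sum.cong refl sum.swap)
  also have "\<dots> = (\<Sum>p\<in>P. \<Sum>m\<in>{0..<c}. \<Sum>n\<in>{0..<c}. \<Sum>p'\<in>P.
      ec c (m * (s p - s p')) * ec c (n * (t p - t p')))"
    by (rule sum.swap)
  also have "\<dots> = (\<Sum>p\<in>P. \<Sum>m\<in>{0..<c}. \<Sum>p'\<in>P. \<Sum>n\<in>{0..<c}.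
      ec c (m * (s p - s p')) * ec c (n * (t p - t p')))"
    by (intro sum.cong refl sum.swap)
  also have "\<dots> = (\<Sum>p\<in>P. \<Sum>p'\<in>P. \<Sum>m\<in>{0..<c}. \<Sum>n\<in>{0..<c}.
      ec c (m * (s p - s p')) * ec c (n * (t p - t p')))"
    by (intro sum.cong refl sum.swap)
  also have "\<dots> = (\<Sum>p\<in>P. \<Sum>p'\<in>P. (\<Sum>m\<in>{0..<c}. ec c (m * (s p - s p'))) * (\<Sum>n\<in>{0..<c}. ec c (n * (t p - t p'))))"
    by (simp add: sum_product)
  also have "\<dots> = (\<Sum>p\<in>P. \<Sum>p'\<in>P. if c dvd s p - s p' \<and> c dvd t p - t p' then of_int c ^ 2 else 0)"
    by (intro sum.cong refl) (use assms in \<open>simp add: ec_orthogonality power2_eq_square\<close>)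
  also have "\<dots> = (\<Sum>z\<in>P \<times> P. if z \<in> {(p, p'). p \<in> P \<and> p' \<in> P \<and> c dvd s p - s p' \<and> c dvd t p - t p'} then of_int c ^ 2 else 0)"
    by (subst sum.cartesian_product) (intro sum.cong, auto split: if_splits)
  also have "\<dots> = of_int c ^ 2 * of_nat (card ((P \<times> P) \<inter> {(p, p'). p \<in> P \<and> p' \<in> P \<and> c dvd s p - s p' \<and> c dvd t p - t p'}))"
    by (subst sum.inter_restrict [symmetric]) (use assms in \<open>simp_all add: mult_ac\<close>)
  also have "(P \<times> P) \<inter> {(p, p'). p \<in> P \<and> p' \<in> P \<and> c dvd s p - s p' \<and> c dvd t p - t p'}
       = {(p, p'). p \<in> P \<and> p' \<in> P \<and> c dvd s p - s p' \<and> c dvd t p - t p'}"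
    by auto
  also have "of_int c ^ 2 * of_nat (card {(p, p'). p \<in> P \<and> p' \<in> P \<and> c dvd s p - s p' \<and> c dvd t p - t p'}) = complex_of_real ?R"
    by simp
  finally show ?thesis
    by (simp only: of_real_eq_iff)
qed

section \<open>Linear congruences and gcd sums\<close>

text \<open>With \<open>k = c div gcd A c\<close>, two solutions differ by a multiple of
  \<open>k\<close>. A solution in \<open>{0..<c}\<close> is then determined by its quotient
  \<open>u div k\<close>, which takes at most \<open>gcd A c\<close> values.\<close>

lemma card_linear_congruence_le:
  fixes A B c :: int
  assumes "c > 0"
  shows "card {u\<in>{0..<c}. [A * u = B] (mod c)} \<le> nat (gcd A c)"
proof -
  define g where "g = gcd A c"
  define k where "k = c div g"
  have g: "g > 0" "c = g * k" "k > 0"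
    using assms by (auto simp: g_def k_def pos_imp_zdiv_pos_iff zdvd_imp_le)
  let ?X = "{u\<in>{0..<c}. [A * u = B] (mod c)}"
  have "inj_on (\<lambda>u. u div k) ?X"
  proof (rule inj_onI)
    fix u v assume u: "u \<in> ?X" and v: "v \<in> ?X" and eq: "u div k = v div k"
    have "[A * u = A * v] (mod c)"
      using u v by (auto intro: cong_trans cong_sym)
    then have "c dvd A * (u - v)"
      by (simp add: cong_iff_dvd_diff algebra_simps)
    moreover have "coprime (A div g) k"
      unfolding k_def g_def using assms by (intro div_gcd_coprime) auto
    moreover have "A = g * (A div g)" by (simp add: g_def)
    ultimately have "g * k dvd g * ((A div g) * (u - v))"
      using g by (metis mult.assoc)
    then have "k dvd (A div g) * (u - v)" using g by simp
    then have "k dvd u - v"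
      using \<open>coprime (A div g) k\<close> by (simp add: coprime_commute coprime_dvd_mult_right_iff)
    then have "u mod k = v mod k"
      by (simp add: mod_eq_dvd_iff)
    with eq show "u = v"
      by (metis div_mult_mod_eq)
  qed
  moreover have "(\<lambda>u. u div k) ` ?X \<subseteq> {0..<g}"
  proof clarify
    fix u assume u: "u \<in> {0..<c}"
    have "u div k < g"
    proof (rule ccontr)
      assume "\<not> u div k < g"
      then have "g * k \<le> (u div k) * k"
        using g by (intro mult_right_mono) auto
      also have "\<dots> \<le> u"
        using g by (metis div_mult_mod_eq le_add_same_cancel1 pos_mod_sign)
      finally show False using u g by simp
    qed
    then show "u div k \<in> {0..<g}"
      using u g by (auto simp: pos_imp_zdiv_nonneg_iff)
  qed
  ultimately have "card ?X \<le> card {0..<g}"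
    by (meson card_inj_on_le finite_atLeastLessThan_int)
  then show ?thesis by (simp add: g_def)
qed

abbreviation ndiv :: "int \<Rightarrow> nat" where
  "ndiv c \<equiv> card {d. d dvd c \<and> d > 0}"

lemma finite_pos_divisors_int: "c \<noteq> 0 \<Longrightarrow> finite {d::int. d dvd c \<and> d > 0}"
  by (rule finite_subset[OF _ finite_divisors_int[of c]]) auto

lemma card_multiples_int:
  fixes c d :: int
  assumes "c > 0" "d > 0" "d dvd c"
  shows "card {X\<in>{0..<c}. d dvd X} = nat (c div d)"
proof -
  have "bij_betw (\<lambda>k. d * k) {0..<c div d} {X\<in>{0..<c}. d dvd X}"
    using assms by (intro bij_betwI[of _ _ _ "\<lambda>X. X div d"])
      (auto elim!: dvdE simp: zero_le_mult_iff)
  then show ?thesis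
    by (metis bij_betw_same_card card_atLeastLessThan_int diff_zero)
qed

text \<open>The gcd is one of the divisors \<open>d\<close> of \<open>c\<close> that divide
  \<open>X\<close>, so it is at most their sum. After the sums are swapped, each \<open>d\<close>
  contributes \<open>d * (c div d) = c\<close>.\<close>

lemma sum_gcd_le:
  assumes "c > (0::int)"
  shows "(\<Sum>X\<in>{0..<c}. gcd X c) \<le> c * int (ndiv c)"
proof -
  let ?D = "{d. d dvd c \<and> d > 0}"
  have fin: "finite ?D" using assms by (simp add: finite_pos_divisors_int)
  have "(\<Sum>X\<in>{0..<c}. gcd X c) \<le> (\<Sum>X\<in>{0..<c}. \<Sum>d\<in>?D. if d dvd X then d else 0)"
  proof (intro sum_mono)
    fix X
    have "gcd X c = (\<Sum>d\<in>{gcd X c}. if d dvd X then d else 0)" by simp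
    also have "\<dots> \<le> (\<Sum>d\<in>?D. if d dvd X then d else 0)"
      using assms fin by (intro sum_mono2) auto
    finally show "gcd X c \<le> (\<Sum>d\<in>?D. if d dvd X then d else 0)" .
  qed
  also have "\<dots> = (\<Sum>d\<in>?D. \<Sum>X\<in>{0..<c}. if d dvd X then d else 0)"
    by (rule sum.swap)
  also have "\<dots> = (\<Sum>d\<in>?D. c)"
  proof (intro sum.cong refl)
    fix d assume d: "d \<in> ?D"
    have "(\<Sum>X\<in>{0..<c}. if d dvd X then d else 0) = (\<Sum>X\<in>{X\<in>{0..<c}. d dvd X}. d)"
      by (rule sum.inter_filter [symmetric]) simp
    also have "\<dots> = int (card {X\<in>{0..<c}. d dvd X}) * d" by simp
    also have "\<dots> = c"
      using card_multiples_int[of c d] d assms by (simp add: pos_imp_zdiv_nonneg_iff)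
    finally show "(\<Sum>X\<in>{0..<c}. if d dvd X then d else 0) = c" .
  qed
  finally show ?thesis by (simp add: mult.commute)
qed

section \<open>Kloosterman sums\<close>

definition units_mod :: "int \<Rightarrow> int set" where
  "units_mod c = {u\<in>{0..<c}. coprime u c}"

definition kloosterman :: "int \<Rightarrow> int \<Rightarrow> int \<Rightarrow> complex" where
  "kloosterman c m n = (\<Sum>u\<in>units_mod c. ec c (m * u + n * modular_inverse c u))"

lemma finite_units_mod [simp]: "finite (units_mod c)"
  unfolding units_mod_def by (rule finite_subset[of _ "{0..<c}"]) auto

lemma units_modD:
  "u \<in> units_mod c \<Longrightarrow> 0 \<le> u" "u \<in> units_mod c \<Longrightarrow> u < c" "u \<in> units_mod c \<Longrightarrow> coprime u c"
  by (auto simp: units_mod_def)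

lemma kloosterman_cong:
  assumes "[m = m'] (mod c)" "[n = n'] (mod c)" "c \<noteq> 0"
  shows "kloosterman c m n = kloosterman c m' n'"
  unfolding kloosterman_def
  by (intro sum.cong refl ec_cong cong_add cong_mult cong_refl assms)

text \<open>The substitution of \<open>v * u\<close> for \<open>u\<close> permutes the units. One
  value of the sum thus occurs at many pairs of frequencies, which is how a moment will bound a
  single sum.\<close>

lemma kloosterman_twist:
  assumes "coprime v c" "c > 0"
  shows "kloosterman c (m * v) (n * modular_inverse c v) = kloosterman c m n"
proof -
  let ?i = "modular_inverse c"
  have inv: "[v * ?i v = 1] (mod c)"
    using assms by (intro cong_modular_inverse1) auto
  have cancel: "(?i v * (v * u mod c)) mod c = u" "(v * (?i v * u mod c)) mod c = u"
    if "u \<in> units_mod c" for u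
  proof -
    have "[?i v * (v * u) = u] (mod c)"
      using cong_mult[OF inv cong_refl[of u]] by (simp add: mult_ac)
    moreover have "[v * (?i v * u) = u] (mod c)"
      using cong_mult[OF inv cong_refl[of u]] by (simp add: mult_ac)
    ultimately show "(?i v * (v * u mod c)) mod c = u" "(v * (?i v * u mod c)) mod c = u"
      using units_modD[OF that] by (auto simp: cong_def mod_mult_right_eq)
  qed
  have "kloosterman c m n = (\<Sum>u\<in>units_mod c. ec c (m * (v * u mod c) + n * ?i (v * u mod c)))"
    unfolding kloosterman_def
    by (rule sum.reindex_bij_witness[of _ "\<lambda>u. v * u mod c" "\<lambda>u. ?i v * u mod c"])
       (use assms cancel in \<open>auto simp: units_mod_def\<close>)
  also have "\<dots> = (\<Sum>u\<in>units_mod c. ec c (m * v * u + n * ?i v * ?i u))"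
  proof (intro sum.cong refl ec_cong)
    fix u assume u: "u \<in> units_mod c"
    have "?i (v * u mod c) = ?i u * ?i v mod c"
    proof (rule modular_inverse_int_eqI)
      have "[v * u * (?i u * ?i v) = 1 * 1] (mod c)"
        using cong_mult[OF inv cong_modular_inverse1[OF units_modD(3)[OF u]]]
        by (simp add: mult_ac)
      then show "[v * u mod c * (?i u * ?i v mod c) = 1] (mod c)"
        by (simp add: cong_def mod_mult_eq)
    qed (use assms in auto)
    then show "[m * (v * u mod c) + n * ?i (v * u mod c) = m * v * u + n * ?i v * ?i u] (mod c)"
      by (simp only: mult.assoc) (intro cong_add cong_mult cong_refl, auto simp: cong_def mult_ac)
  qed (use assms in auto)
  finally show ?thesis by (simp add: kloosterman_def)
qed

text \<open>Written as a sum over pairs, the square reduces a fourth moment to a second moment, to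
  which \<open>ec_fourier_plancherel\<close> applies.\<close>

lemma kloosterman_square:
  "kloosterman c m n ^ 2 = (\<Sum>(u, v)\<in>units_mod c \<times> units_mod c.
      ec c (m * (u + v) + n * (modular_inverse c u + modular_inverse c v)))"
  unfolding kloosterman_def power2_eq_square sum_product sum.cartesian_product
  by (intro sum.cong refl) (simp add: case_prod_unfold algebra_simps flip: ec_add)

text \<open>Clearing denominators and eliminating \<open>u4\<close> factors the two equations completely, which is
  why the fourth moment is elementary for every modulus.\<close>
lemma unit_quadruple_dvd:
  fixes c :: int
  assumes "u1 \<in> units_mod c" "u2 \<in> units_mod c" "u3 \<in> units_mod c" "u4 \<in> units_mod c"
    and s: "c dvd (u1 + u2) - (u3 + u4)"
    and t: "c dvd (modular_inverse c u1 + modular_inverse c u2)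
                  - (modular_inverse c u3 + modular_inverse c u4)"
  shows "c dvd (u1 + u2) * (u1 - u3) * (u2 - u3)"
proof -
  let ?i = "modular_inverse c"
  have inv: "[u1 * ?i u1 = 1] (mod c)" "[u2 * ?i u2 = 1] (mod c)"
            "[u3 * ?i u3 = 1] (mod c)" "[u4 * ?i u4 = 1] (mod c)"
    using assms by (auto intro!: cong_modular_inverse1 dest: units_modD)
  have "c dvd ((?i u1 + ?i u2) - (?i u3 + ?i u4)) * (u1 * u2 * u3 * u4)"
    using t by simp
  moreover have "c dvd (u1 * ?i u1 - 1) * (u2 * u3 * u4)" "c dvd (u2 * ?i u2 - 1) * (u1 * u3 * u4)"
     "c dvd (u3 * ?i u3 - 1) * (u1 * u2 * u4)" "c dvd (u4 * ?i u4 - 1) * (u1 * u2 * u3)"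
    using inv by (auto simp: cong_iff_dvd_diff)
  ultimately have "c dvd ((?i u1 + ?i u2) - (?i u3 + ?i u4)) * (u1 * u2 * u3 * u4)
     - (u1 * ?i u1 - 1) * (u2 * u3 * u4) - (u2 * ?i u2 - 1) * (u1 * u3 * u4)
     + (u3 * ?i u3 - 1) * (u1 * u2 * u4) + (u4 * ?i u4 - 1) * (u1 * u2 * u3)"
    by (intro dvd_add dvd_diff)
  also have "\<dots> = (u1 + u2) * u3 * u4 - u1 * u2 * (u3 + u4)"
    by (simp add: algebra_simps)
  finally have "c dvd \<dots>" .
  moreover have "c dvd ((u1 + u2) - (u3 + u4)) * ((u1 + u2) * u3 - u1 * u2)"
    using s by simp
  ultimately have "c dvd ((u1 + u2) - (u3 + u4)) * ((u1 + u2) * u3 - u1 * u2)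
      + ((u1 + u2) * u3 * u4 - u1 * u2 * (u3 + u4))"
    by (rule dvd_add[rotated])
  also have "\<dots> = - ((u1 + u2) * (u1 - u3) * (u2 - u3))"
    by (simp add: algebra_simps)
  finally show ?thesis by (simp only: dvd_minus_iff)
qed

text \<open>In the differences \<open>Y = u1 - u3\<close> and \<open>Z = u2 - u3\<close> modulo
  \<open>c\<close> the factored condition reads \<open>Y Z (2 u3 + Y + Z) = 0\<close>. This is
  linear in \<open>u3\<close> and has at most \<open>gcd (2 Y Z) c\<close> solutions. The sum
  equation recovers \<open>u4\<close>, so the quadruples inject into \<open>T\<close>.\<close>

lemma card_unit_quadruples_le:
  fixes c :: int
  assumes c: "c > 0"
  defines "P \<equiv> units_mod c \<times> units_mod c"
  defines "s \<equiv> (\<lambda>(u, v). u + v)"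
  defines "t \<equiv> (\<lambda>(u, v). modular_inverse c u + modular_inverse c v)"
  shows "card {(p, p'). p \<in> P \<and> p' \<in> P \<and> c dvd s p - s p' \<and> c dvd t p - t p'} \<le> 2 * (nat c * ndiv c) ^ 2"
    (is "card ?R \<le> _")
proof -
  let ?I = "{0..<c}"
  define T where "T = (SIGMA (Y, Z) : ?I \<times> ?I. {u\<in>?I. [(2 * (Y * Z)) * u = - (Y * Z * (Y + Z))] (mod c)})"
  define \<phi> :: "(int \<times> int) \<times> (int \<times> int) \<Rightarrow> (int \<times> int) \<times> int"
    where "\<phi> = (\<lambda>((u1, u2), (u3, u4)). (((u1 - u3) mod c, (u2 - u3) mod c), u3))"
  have finT: "finite T"
    by (rule finite_subset[of _ "(?I \<times> ?I) \<times> ?I"]) (auto simp: T_def)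
  have "inj_on \<phi> ?R"
  proof (rule inj_onI)
    fix z w assume z: "z \<in> ?R" and w: "w \<in> ?R" and "\<phi> z = \<phi> w"
    obtain u1 u2 u3 u4 where zu: "z = ((u1, u2), (u3, u4))" by (metis surj_pair)
    obtain v1 v2 v3 v4 where wv: "w = ((v1, v2), (v3, v4))" by (metis surj_pair)
    have *: "(u1, u2) \<in> P" "(u3, u4) \<in> P" "(v1, v2) \<in> P" "(v3, v4) \<in> P"
      and s: "c dvd s (u1, u2) - s (u3, u4)" "c dvd s (v1, v2) - s (v3, v4)"
      and eq: "\<phi> ((u1, u2), (u3, u4)) = \<phi> ((v1, v2), (v3, v4))"
      using z w \<open>\<phi> z = \<phi> w\<close> unfolding zu wv by blast+
    from eq have 3: "u3 = v3" and "(u1 - u3) mod c = (v1 - v3) mod c" "(u2 - u3) mod c = (v2 - v3) mod c"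
      by (auto simp: \<phi>_def)
    then have "c dvd u1 - v1" "c dvd u2 - v2"
      by (auto simp: mod_eq_dvd_iff)
    moreover have "c dvd ((v1 + v2) - (v3 + v4)) - ((u1 + u2) - (u3 + u4)) + (u1 - v1) + (u2 - v2)"
      using s calculation by (intro dvd_add[where b = "_ + _"] dvd_add[OF dvd_diff]) (simp_all add: s_def)
    then have "c dvd u4 - v4" by (simp add: 3)
    ultimately have "u1 mod c = v1 mod c" "u2 mod c = v2 mod c" "u4 mod c = v4 mod c"
      by (auto simp: mod_eq_dvd_iff)
    then show "z = w"
      using * 3 by (auto simp: P_def units_mod_def zu wv)
  qed
  moreover have "\<phi> ` ?R \<subseteq> T"
  proof (rule image_subsetI)
    fix z assume z: "z \<in> ?R"
    obtain u1 u2 u3 u4 where zu: "z = ((u1, u2), (u3, u4))" by (metis surj_pair)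
    have *: "(u1, u2) \<in> P" "(u3, u4) \<in> P" "c dvd s (u1, u2) - s (u3, u4)" "c dvd t (u1, u2) - t (u3, u4)"
      using z unfolding zu by blast+
    let ?Y = "(u1 - u3) mod c" and ?Z = "(u2 - u3) mod c"
    have "c dvd (u1 + u2) * (u1 - u3) * (u2 - u3)"
      using * by (intro unit_quadruple_dvd[of _ _ _ _ u4]) (auto simp: P_def s_def t_def)
    then have 0: "[(u1 + u2) * (u1 - u3) * (u2 - u3) = 0] (mod c)"
      by (simp add: cong_0_iff)
    have "[2 * (?Y * ?Z) * u3 + ?Y * ?Z * (?Y + ?Z) = 2 * ((u1 - u3) * (u2 - u3)) * u3 + (u1 - u3) * (u2 - u3) * ((u1 - u3) + (u2 - u3))] (mod c)"
      by (intro cong_add cong_mult cong_refl) (auto simp: cong_def)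
    also have "2 * ((u1 - u3) * (u2 - u3)) * u3 + (u1 - u3) * (u2 - u3) * ((u1 - u3) + (u2 - u3))
        = (u1 + u2) * (u1 - u3) * (u2 - u3)"
      by (simp add: algebra_simps)
    also note 0
    finally have "[2 * (?Y * ?Z) * u3 = - (?Y * ?Z * (?Y + ?Z))] (mod c)"
      by (simp add: cong_iff_dvd_diff)
    then show "\<phi> z \<in> T"
      using * c by (auto simp: zu T_def \<phi>_def P_def units_mod_def)
  qed
  ultimately have "card ?R \<le> card T"
    using finT by (meson card_inj_on_le)
  also have "card T = (\<Sum>(Y, Z)\<in>?I \<times> ?I. card {u\<in>?I. [(2 * (Y * Z)) * u = - (Y * Z * (Y + Z))] (mod c)})"
    unfolding T_def by (subst card_SigmaI) (auto intro!: sum.cong intro: finite_subset[of _ ?I])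
  finally have "int (card ?R) \<le> (\<Sum>(Y, Z)\<in>?I \<times> ?I. int (card {u\<in>?I. [(2 * (Y * Z)) * u = - (Y * Z * (Y + Z))] (mod c)}))"
    by (simp add: case_prod_unfold flip: of_nat_sum)
  also have "\<dots> \<le> (\<Sum>(Y, Z)\<in>?I \<times> ?I. 2 * (gcd Y c * gcd Z c))"
  proof (intro sum_mono, clarify)
    fix Y Z :: int
    \<comment> \<open>The product of two Bezout identities exhibits the product of the gcds as a
      combination of \<open>a * b\<close> and \<open>c\<close>. The bound then factors, and the
      double sum over \<open>Y\<close> and \<open>Z\<close> becomes a square.\<close>
    have *: "gcd (a * b) c dvd gcd a c * gcd b c" for a b :: int
    proof -
      obtain k l where "gcd a c = k * a + l * c" by (metis bezout_int)
      moreover obtain k' l' where "gcd b c = k' * b + l' * c" by (metis bezout_int)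
      ultimately have "gcd a c * gcd b c = k * k' * (a * b) + (k * a * l' + l * k' * b + l * l' * c) * c"
        by (simp add: algebra_simps)
      also have "gcd (a * b) c dvd \<dots>"
        by (rule dvd_add; rule dvd_mult; simp)
      finally show ?thesis .
    qed
    have "gcd (2 * (Y * Z)) c dvd gcd 2 c * gcd (Y * Z) c"
      by (rule *)
    also have "\<dots> dvd gcd 2 c * (gcd Y c * gcd Z c)"
      by (intro mult_dvd_mono dvd_refl *)
    finally have "gcd (2 * (Y * Z)) c \<le> gcd 2 c * (gcd Y c * gcd Z c)"
      using c by (intro zdvd_imp_le) auto
    also have "\<dots> \<le> 2 * (gcd Y c * gcd Z c)"
      using c gcd_le1_int[of 2 c] by (intro mult_right_mono) auto
    finally show "int (card {u\<in>?I. [(2 * (Y * Z)) * u = - (Y * Z * (Y + Z))] (mod c)}) \<le> 2 * (gcd Y c * gcd Z c)"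
      using card_linear_congruence_le[OF c, of "2 * (Y * Z)" "- (Y * Z * (Y + Z))"] c
      by (metis (no_types, lifting) gcd_ge_0_int le_nat_iff order_trans)
  qed
  also have "(\<Sum>(Y, Z)\<in>?I \<times> ?I. 2 * (gcd Y c * gcd Z c)) = 2 * (\<Sum>Y\<in>?I. gcd Y c) ^ 2"
    unfolding power2_eq_square sum_product sum.cartesian_product
    by (simp only: sum_distrib_left case_prod_unfold)
  also have "\<dots> \<le> 2 * (c * int (ndiv c)) ^ 2"
    using sum_gcd_le[OF c] by (intro mult_left_mono power_mono sum_nonneg) auto
  also have "\<dots> = int (2 * (nat c * ndiv c) ^ 2)"
    using c by simp
  finally show ?thesis
    by (simp only: of_nat_le_iff)
qed

lemma kloosterman_fourth_moment:
  assumes c: "c > 0"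
  shows "(\<Sum>m\<in>{0..<c}. \<Sum>n\<in>{0..<c}. norm (kloosterman c m n) ^ 4) \<le> 2 * of_int c ^ 4 * real (ndiv c) ^ 2"
proof -
  have "(\<Sum>m\<in>{0..<c}. \<Sum>n\<in>{0..<c}. norm (kloosterman c m n) ^ 4)
      = (\<Sum>m\<in>{0..<c}. \<Sum>n\<in>{0..<c}. norm (\<Sum>p\<in>units_mod c \<times> units_mod c.
           ec c (m * (case p of (u, v) \<Rightarrow> u + v) + n * (case p of (u, v) \<Rightarrow> modular_inverse c u + modular_inverse c v))) ^ 2)"
  proof (intro sum.cong refl)
    fix m n
    have "norm (kloosterman c m n) ^ 4 = norm (kloosterman c m n ^ 2) ^ 2"
      by (simp add: norm_power flip: power_mult)
    then show "norm (kloosterman c m n) ^ 4 = norm (\<Sum>p\<in>units_mod c \<times> units_mod c.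
           ec c (m * (case p of (u, v) \<Rightarrow> u + v) + n * (case p of (u, v) \<Rightarrow> modular_inverse c u + modular_inverse c v))) ^ 2"
      by (simp only: kloosterman_square case_prod_unfold)
  qed
  also have "\<dots> \<le> of_int c ^ 2 * real (2 * (nat c * ndiv c) ^ 2)"
    by (subst ec_fourier_plancherel) (use c card_unit_quadruples_le[OF c] in \<open>auto intro!: mult_left_mono simp: of_nat_le_iff simp del: of_nat_mult of_nat_power\<close>)
  also have "\<dots> = 2 * of_int c ^ 4 * real (ndiv c) ^ 2"
    using c by (simp add: power_mult_distrib power4_eq_xxxx power2_eq_square)
  finally show ?thesis .
qed

section \<open>From the moment to individual Kloosterman sums\<close>

lemma card_units_mod: "c > 0 \<Longrightarrow> card (units_mod c) = totient (nat c)"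
proof (cases "c = 1")
  \<comment> \<open>Here \<open>units_mod 1 = {0}\<close>, whereas the only totative of 1 is 1
    itself, so the identification of the two sets used in the other case breaks down.\<close>
  case True
  then have "units_mod c = {0}" by (auto simp: units_mod_def)
  with True show ?thesis by simp
next
  case False
  assume c: "c > 0"
  have "int ` totatives (nat c) = units_mod c"
  proof (intro equalityI subsetI)
    fix u assume "u \<in> int ` totatives (nat c)"
    then obtain k where k: "u = int k" "k \<in> totatives (nat c)" by auto
    have "1 < nat c" using c False by linarith
    then have "k < nat c"
      using k(2) by (rule totatives_less[rotated])
    moreover have "coprime k (nat c)"
      using k(2) by (simp add: totatives_def)
    then have "coprime (int k) c"
      using c by (metis coprime_int_iff int_nat_eq less_imp_le)
    ultimately show "u \<in> units_mod c"
      using c k(1) by (simp add: units_mod_def)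
  next
    fix u assume u: "u \<in> units_mod c"
    then have "u \<noteq> 0" using False c by (auto simp: units_mod_def)
    moreover have "coprime (nat u) (nat c)"
      using units_modD[OF u] c by (metis coprime_int_iff int_nat_eq less_imp_le)
    ultimately have "nat u \<in> totatives (nat c)"
      using units_modD(1,2)[OF u] c by (simp add: totatives_def nat_mono)
    then show "u \<in> int ` totatives (nat c)"
      using units_modD[OF u] by (intro image_eqI[of _ _ "nat u"]) auto
  qed
  then show ?thesis
    by (metis card_image inj_on_of_nat totient_def)
qed

lemma ndiv_nat: "c > 0 \<Longrightarrow> ndiv (int c) = card {d. d dvd c}"
proof -
  assume c: "c > 0"
  have "int ` {d. d dvd c} = {d. d dvd int c \<and> d > 0}"
  proof (intro equalityI subsetI)
    fix d assume "d \<in> {d. d dvd int c \<and> d > 0}"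
    then have "nat d dvd c" "d = int (nat d)"
      by (auto simp: nat_dvd_iff)
    then show "d \<in> int ` {d. d dvd c}" by blast
  qed (use c in \<open>auto dest: dvd_pos_nat\<close>)
  then show ?thesis by (metis card_image inj_on_of_nat)
qed

text \<open>In Gauss's identity, \<open>c\<close> is the sum of \<open>totient d\<close> over its
  divisors, and each term is at most \<open>totient c\<close>. The number of units can thus be
  replaced by \<open>c\<close> at the cost of a divisor count.\<close>

lemma le_totient_mult_ndiv:
  assumes "c > 0"
  shows "nat c \<le> totient (nat c) * ndiv c"
proof -
  have "nat c = (\<Sum>d | d dvd nat c. totient d)"
    by (rule totient_divisor_sum [symmetric])
  also have "\<dots> \<le> (\<Sum>d | d dvd nat c. totient (nat c))"
    using assms by (intro sum_mono totient_dvd_mono) auto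
  also have "\<dots> = totient (nat c) * ndiv c"
    using ndiv_nat[of "nat c"] assms by simp
  finally show ?thesis .
qed

text \<open>By \<open>kloosterman_twist\<close> the value at \<open>(m, n)\<close> recurs at all
  pairs \<open>(m v, n v^-1)\<close>. A pair is hit at most \<open>gcd n c\<close> times, because
  its second entry is a linear congruence for \<open>v^-1\<close>. Hence \<open>totient c\<close>
  copies of the fourth power are at most \<open>gcd n c\<close> times the complete moment, which
  yields the exponent \<open>3/4\<close> in \<open>c\<close>.\<close>

lemma kloosterman_bound:
  assumes c: "c > 0"
  shows "norm (kloosterman c m n) ^ 4 \<le> 2 * of_int (gcd n c) * of_int c ^ 3 * real (ndiv c) ^ 3"
proof -
  let ?K = "\<lambda>p. norm (kloosterman c (fst p) (snd p)) ^ 4"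
  let ?i = "modular_inverse c"
  define \<pi> where "\<pi> = (\<lambda>v. (m * v mod c, n * ?i v mod c))"
  let ?B = "{0..<c} \<times> {0..<c}"
  have sub: "\<pi> ` units_mod c \<subseteq> ?B"
    using c by (auto simp: \<pi>_def)
  have "real (totient (nat c)) * norm (kloosterman c m n) ^ 4 = (\<Sum>v\<in>units_mod c. ?K (\<pi> v))"
  proof -
    have "?K (\<pi> v) = norm (kloosterman c m n) ^ 4" if "v \<in> units_mod c" for v
    proof -
      have "kloosterman c (m * v mod c) (n * ?i v mod c) = kloosterman c (m * v) (n * ?i v)"
        using c by (intro kloosterman_cong) (auto simp: cong_def)
      also have "\<dots> = kloosterman c m n"
        using that c by (intro kloosterman_twist) (auto dest: units_modD)
      finally show ?thesis by (simp add: \<pi>_def)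
    qed
    then show ?thesis by (simp add: card_units_mod c)
  qed
  also have "\<dots> = (\<Sum>p\<in>?B. \<Sum>v\<in>{v\<in>units_mod c. \<pi> v = p}. ?K (\<pi> v))"
    by (rule sum.group [symmetric]) (use sub in auto)
  also have "\<dots> \<le> (\<Sum>p\<in>?B. of_int (gcd n c) * ?K p)"
  proof (intro sum_mono)
    fix p assume "p \<in> ?B"
    have "card {v\<in>units_mod c. \<pi> v = p} \<le> card {u\<in>{0..<c}. [n * u = snd p] (mod c)}"
    proof (rule card_inj_on_le)
      show "inj_on ?i {v\<in>units_mod c. \<pi> v = p}"
      proof (rule inj_onI)
        fix u v assume u: "u \<in> {v\<in>units_mod c. \<pi> v = p}" and v: "v \<in> {v\<in>units_mod c. \<pi> v = p}" and eq: "?i u = ?i v"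
        have "[u * (?i u * v) = v] (mod c)"
          using u cong_mult[OF cong_modular_inverse1 cong_refl, of u c v] by (auto dest: units_modD simp: mult_ac)
        moreover have "[u * (?i v * v) = u] (mod c)"
          using v cong_mult[OF cong_modular_inverse1 cong_refl, of v c u] by (auto dest: units_modD simp: mult_ac)
        ultimately have "[u = v] (mod c)"
          using eq by (metis cong_sym cong_trans)
        then show "u = v"
          using u v by (auto simp: cong_def units_mod_def)
      qed
      show "?i ` {v\<in>units_mod c. \<pi> v = p} \<subseteq> {u\<in>{0..<c}. [n * u = snd p] (mod c)}"
        using c by (auto simp: \<pi>_def cong_def modular_inverse_int_nonneg modular_inverse_int_less)
      show "finite {u\<in>{0..<c}. [n * u = snd p] (mod c)}"
        by (rule finite_subset[of _ "{0..<c}"]) auto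
    qed
    also have "\<dots> \<le> nat (gcd n c)"
      by (rule card_linear_congruence_le[OF c])
    finally have "int (card {v\<in>units_mod c. \<pi> v = p}) \<le> gcd n c"
      using c by (simp add: le_nat_iff)
    then have "real (card {v\<in>units_mod c. \<pi> v = p}) \<le> of_int (gcd n c)"
      by (metis of_int_le_iff of_int_of_nat_eq)
    moreover have "(\<Sum>v\<in>{v\<in>units_mod c. \<pi> v = p}. ?K (\<pi> v)) = real (card {v\<in>units_mod c. \<pi> v = p}) * ?K p"
      by simp
    ultimately show "(\<Sum>v\<in>{v\<in>units_mod c. \<pi> v = p}. ?K (\<pi> v)) \<le> of_int (gcd n c) * ?K p"
      by (simp add: mult_right_mono)
  qed
  also have "\<dots> = of_int (gcd n c) * (\<Sum>m\<in>{0..<c}. \<Sum>n\<in>{0..<c}. norm (kloosterman c m n) ^ 4)"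
    by (simp add: sum_distrib_left sum.cartesian_product case_prod_unfold)
  also have "\<dots> \<le> of_int (gcd n c) * (2 * of_int c ^ 4 * real (ndiv c) ^ 2)"
    by (intro mult_left_mono kloosterman_fourth_moment c) auto
  finally have *: "real (totient (nat c)) * norm (kloosterman c m n) ^ 4 \<le> of_int (gcd n c) * (2 * of_int c ^ 4 * real (ndiv c) ^ 2)" .
  have "of_int c * norm (kloosterman c m n) ^ 4 \<le> real (totient (nat c) * ndiv c) * norm (kloosterman c m n) ^ 4"
  proof (intro mult_right_mono)
    show "of_int c \<le> real (totient (nat c) * ndiv c)"
      using le_totient_mult_ndiv[OF c] c by linarith
  qed auto
  also have "\<dots> = real (ndiv c) * (real (totient (nat c)) * norm (kloosterman c m n) ^ 4)"
    by simp
  also have "\<dots> \<le> real (ndiv c) * (of_int (gcd n c) * (2 * of_int c ^ 4 * real (ndiv c) ^ 2))"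
    by (intro mult_left_mono *) auto
  also have "\<dots> = of_int c * (2 * of_int (gcd n c) * of_int c ^ 3 * real (ndiv c) ^ 3)"
    by (simp add: power4_eq_xxxx power3_eq_cube power2_eq_square mult_ac)
  finally show ?thesis
    using c by simp
qed

section \<open>Geometric sums and finite Fourier analysis\<close>

text \<open>Jordan's inequality: the sine is concave on \<open>{0..pi/2}\<close> and so lies above
  its chord.\<close>

lemma jordan_sin_ge:
  fixes y :: real
  assumes "0 \<le> y" "y \<le> pi / 2"
  shows "2 / pi * y \<le> sin y"
proof -
  have "convex_on {0..pi/2} (\<lambda>x. - sin x)"
  proof (rule f''_ge0_imp_convex)
    show "((\<lambda>x. - sin x) has_real_derivative - cos x) (at x)" for x :: real
      by (auto intro!: derivative_eq_intros)
    show "((\<lambda>x. - cos x) has_real_derivative sin x) (at x)" for x :: real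
      by (auto intro!: derivative_eq_intros)
    show "0 \<le> sin x" if "x \<in> {0..pi/2}" for x :: real
      using that by (intro sin_ge_zero) auto
  qed auto
  from convex_onD_Icc[OF this, of "2 / pi * y"] assms show ?thesis
    by (simp add: field_simps)
qed

lemma norm_e_minus_1: "norm (e (of_real t) - 1) = 2 * \<bar>sin (pi * t)\<bar>"
proof -
  have "e (of_real t) = cis (2 * (pi * t))"
    by (simp add: e_def cis_conv_exp mult_ac)
  then have "norm (e (of_real t) - 1) ^ 2 = (cos (2 * (pi * t)) - 1) ^ 2 + sin (2 * (pi * t)) ^ 2"
    by (simp add: cmod_power2)
  also have "\<dots> = (2 * sin (pi * t)) ^ 2"
    unfolding cos_double_sin sin_double cos_squared_eq power_mult_distrib
    by (simp add: algebra_simps power2_eq_square)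
  finally have "norm (e (of_real t) - 1) ^ 2 = (2 * \<bar>sin (pi * t)\<bar>) ^ 2"
    by (simp add: power_mult_distrib)
  then show ?thesis
    by (subst (asm) power2_eq_iff_nonneg) auto
qed

text \<open>The distance from \<open>k\<close> to the nearest multiple of \<open>c\<close>.\<close>

definition zdist :: "int \<Rightarrow> int \<Rightarrow> int" where
  "zdist c k = min (k mod c) (c - k mod c)"

lemma ec_eq_e_real: "ec c k = e (of_real (of_int k / of_int c))"
  by (simp add: ec_def)

lemma norm_ec_minus_1_ge:
  assumes "c > 0"
  shows "norm (ec c k - 1) \<ge> 4 * of_int (zdist c k) / of_int c"
proof -
  define r where "r = k mod c"
  have r: "0 \<le> r" "r < c" using assms by (auto simp: r_def)
  have "ec c k = ec c r"
    using assms by (intro ec_cong) (auto simp: r_def cong_def)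
  then have n: "norm (ec c k - 1) = 2 * \<bar>sin (pi * (of_int r / of_int c))\<bar>"
    using norm_e_minus_1[of "of_int r / of_int c"] by (simp add: ec_eq_e_real)
  have s: "sin (pi * (of_int r / of_int c)) \<ge> 2 * (of_int (zdist c k) / of_int c)"
  proof (cases "2 * r \<le> c")
    case True
    then have "real_of_int r / of_int c \<le> 1 / 2"
      using assms by (simp add: field_simps)
    then have "pi * (of_int r / of_int c) \<le> pi * (1/2)"
      by (intro mult_left_mono) auto
    then have "2 / pi * (pi * (of_int r / of_int c)) \<le> sin (pi * (of_int r / of_int c))"
      using r by (intro jordan_sin_ge) auto
    with True show ?thesis using r by (simp add: zdist_def r_def min_def)
  next
    case False
    then have *: "real_of_int (c - r) / of_int c \<le> 1 / 2"
      using assms by (simp add: field_simps)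
    then have "pi * (of_int (c - r) / of_int c) \<le> pi * (1/2)"
      by (intro mult_left_mono) auto
    then have "2 / pi * (pi * (of_int (c - r) / of_int c)) \<le> sin (pi * (of_int (c - r) / of_int c))"
      using r by (intro jordan_sin_ge) auto
    also have "pi * (of_int (c - r) / of_int c) = pi - pi * (of_int r / of_int c)"
      using assms by (simp add: field_simps)
    also have "sin \<dots> = sin (pi * (of_int r / of_int c))"
      by simp
    also have "2 / pi * (pi - pi * (of_int r / of_int c)) = 2 * (of_int (c - r) / of_int c)"
      using assms by (simp add: field_simps)
    finally have "2 * (of_int (c - r) / of_int c) \<le> sin (pi * (real_of_int r / of_int c))" .
    with False show ?thesis using r by (simp add: zdist_def r_def min_def)
  qed
  then show ?thesis using n by linarith
qed

lemma zdist_nonneg: "c > 0 \<Longrightarrow> zdist c k \<ge> 0"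
  by (simp add: zdist_def order_less_imp_le)

lemma zdist_pos: "c > 0 \<Longrightarrow> \<not> c dvd k \<Longrightarrow> zdist c k > 0"
  unfolding zdist_def dvd_eq_mod_eq_0 using pos_mod_bound[of c k] pos_mod_sign[of c k] by linarith

lemma zdist_uminus: "c > 0 \<Longrightarrow> zdist c (- k) = zdist c k"
  by (cases "c dvd k") (auto simp: zdist_def zmod_zminus1_eq_if dvd_eq_mod_eq_0 min_def)

lemma zdist_small: "0 \<le> k \<Longrightarrow> k < c \<Longrightarrow> zdist c k = min k (c - k)"
  by (simp add: zdist_def)

text \<open>The numerator of the closed form is at most 2 whatever \<open>N\<close> is, so only the
  distance of \<open>k\<close> from the multiples of \<open>c\<close> enters.\<close>

lemma norm_geometric_ec_le:
  assumes "c > 0" "\<not> c dvd k"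
  shows "norm (\<Sum>a<N. ec c (int a * k)) \<le> of_int c / (2 * of_int (zdist c k))"
proof -
  have z: "zdist c k > 0" using assms by (intro zdist_pos)
  have ne: "ec c k \<noteq> 1" using assms by (simp add: ec_eq_1_iff)
  have "(\<Sum>a<N. ec c (int a * k)) = (\<Sum>a<N. ec c k ^ a)"
    by (simp add: ec_power)
  also have "norm \<dots> = norm (1 - ec c k ^ N) / norm (ec c k - 1)"
    using ne by (simp add: sum_gp_strict norm_divide norm_minus_commute)
  also have "\<dots> \<le> 2 / norm (ec c k - 1)"
    using norm_triangle_ineq4[of 1 "ec c k ^ N"] by (intro divide_right_mono) (auto simp: norm_power)
  also have "\<dots> \<le> 2 / (4 * of_int (zdist c k) / of_int c)"
    using assms z ne by (intro divide_left_mono norm_ec_minus_1_ge mult_pos_pos) auto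
  finally show ?thesis by (simp add: field_simps)
qed

lemma harm_le_ln: "n > 0 \<Longrightarrow> harm n \<le> 1 + ln (real n)"
  using decseqD[OF decseq_harm_diff_ln, of 0 "n - 1"] by (simp add: harm_expand)

lemma sum_inverse_zdist_le:
  assumes "c > 0"
  shows "(\<Sum>n\<in>{1..<c}. 1 / real_of_int (zdist c n)) \<le> 2 * (1 + ln (of_int c))"
proof (cases "c = 1")
  case True
  then show ?thesis by simp
next
  case False
  with assms have c: "c > 1" by simp
  have h: "(\<Sum>n\<in>{1..<c}. 1 / real_of_int n) \<le> 1 + ln (of_int c)"
  proof -
    have "(\<Sum>n\<in>{1..<c}. 1 / real_of_int n) = (\<Sum>i\<in>{1..nat (c - 1)}. 1 / real i)"
      by (rule sum.reindex_bij_witness[of _ int nat]) (use c in auto)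
    also have "\<dots> = harm (nat (c - 1))"
      by (simp add: harm_def inverse_eq_divide)
    also have "\<dots> \<le> 1 + ln (real (nat (c - 1)))"
      using c by (intro harm_le_ln) auto
    also have "\<dots> \<le> 1 + ln (of_int c)"
      using c by auto
    finally show ?thesis .
  qed
  have "(\<Sum>n\<in>{1..<c}. 1 / of_int (zdist c n)) \<le> (\<Sum>n\<in>{1..<c}. 1 / real_of_int n + 1 / of_int (c - n))"
    by (intro sum_mono) (auto simp: zdist_small min_def)
  also have "\<dots> = (\<Sum>n\<in>{1..<c}. 1 / real_of_int n) + (\<Sum>n\<in>{1..<c}. 1 / real_of_int (c - n))"
    by (rule sum.distrib)
  also have "(\<Sum>n\<in>{1..<c}. 1 / real_of_int (c - n)) = (\<Sum>n\<in>{1..<c}. 1 / real_of_int n)"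
    by (rule sum.reindex_bij_witness[of _ "\<lambda>n. c - n" "\<lambda>n. c - n"]) auto
  finally show ?thesis using h by simp
qed

section \<open>Discrete Parseval identity and Fourier inversion\<close>

lemma ec_parseval:
  assumes "c > 0"
  shows "(\<Sum>n\<in>{0..<c}. norm (\<Sum>k\<in>{0..<c}. \<phi> k * ec c (- (n * k))) ^ 2) = of_int c * (\<Sum>k\<in>{0..<c}. norm (\<phi> k) ^ 2)"
    (is "?L = ?R")
proof -
  let ?I = "{0..<c}"
  have "complex_of_real ?L = (\<Sum>n\<in>?I. \<Sum>k\<in>?I. \<Sum>l\<in>?I. \<phi> k * cnj (\<phi> l) * ec c (n * (l - k)))"
    unfolding of_real_sum complex_norm_square
    by (simp add: sum_product ec_minus right_diff_distrib ec_diff mult_ac)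
  also have "\<dots> = (\<Sum>k\<in>?I. \<Sum>n\<in>?I. \<Sum>l\<in>?I. \<phi> k * cnj (\<phi> l) * ec c (n * (l - k)))"
    by (rule sum.swap)
  also have "\<dots> = (\<Sum>k\<in>?I. \<Sum>l\<in>?I. \<Sum>n\<in>?I. \<phi> k * cnj (\<phi> l) * ec c (n * (l - k)))"
    by (intro sum.cong refl sum.swap)
  also have "\<dots> = (\<Sum>k\<in>?I. \<Sum>l\<in>?I. if l = k then of_int c * (\<phi> k * cnj (\<phi> k)) else 0)"
  proof (intro sum.cong refl)
    fix k l assume kl: "k \<in> ?I" "l \<in> ?I"
    have "c dvd l - k \<longleftrightarrow> l = k"
      using kl by (metis atLeastLessThan_iff mod_eq_dvd_iff mod_pos_pos_trivial)
    then show "(\<Sum>n\<in>?I. \<phi> k * cnj (\<phi> l) * ec c (n * (l - k))) = (if l = k then of_int c * (\<phi> k * cnj (\<phi> k)) else 0)"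
      using assms by (simp add: ec_orthogonality flip: sum_distrib_left)
  qed
  also have "\<dots> = complex_of_real ?R"
    by (simp add: sum_distrib_left complex_norm_square [symmetric])
  finally show ?thesis by (simp only: of_real_eq_iff)
qed

lemma ec_inversion:
  assumes "c > 0" and per: "\<And>k. \<psi> (k mod c) = \<psi> k"
  shows "\<psi> j = (\<Sum>n\<in>{0..<c}. (\<Sum>k\<in>{0..<c}. \<psi> k * ec c (- (n * k))) / of_int c * ec c (n * j))"
proof -
  let ?I = "{0..<c}"
  have "(\<Sum>n\<in>?I. (\<Sum>k\<in>?I. \<psi> k * ec c (- (n * k))) / of_int c * ec c (n * j))
      = (\<Sum>n\<in>?I. \<Sum>k\<in>?I. \<psi> k / of_int c * ec c (n * (j - k)))"
    by (simp add: sum_distrib_left sum_distrib_right sum_divide_distrib ec_minus ec_diff right_diff_distrib mult_ac)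
  also have "\<dots> = (\<Sum>k\<in>?I. \<Sum>n\<in>?I. \<psi> k / of_int c * ec c (n * (j - k)))"
    by (rule sum.swap)
  also have "\<dots> = (\<Sum>k\<in>?I. if k = j mod c then \<psi> k else 0)"
  proof (intro sum.cong refl)
    fix k assume k: "k \<in> ?I"
    have "c dvd j - k \<longleftrightarrow> k = j mod c"
      using k by (metis atLeastLessThan_iff mod_eq_dvd_iff mod_pos_pos_trivial)
    then show "(\<Sum>n\<in>?I. \<psi> k / of_int c * ec c (n * (j - k))) = (if k = j mod c then \<psi> k else 0)"
      using assms by (subst sum_distrib_left [symmetric]) (simp add: ec_orthogonality)
  qed
  also have "\<dots> = \<psi> j"
    using assms by simp
  finally show ?thesis by simp
qed

section \<open>Sums over inverses of units in an interval\<close>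

lemma modular_inverse_int_cong:
  assumes "[a = b] (mod c)" "c > (0::int)"
  shows "modular_inverse c a = modular_inverse c b"
proof (cases "coprime b c")
  case True
  have "[a * modular_inverse c b = b * modular_inverse c b] (mod c)"
    by (intro cong_mult cong_refl assms)
  also have "[b * modular_inverse c b = 1] (mod c)"
    using True by (rule cong_modular_inverse1)
  finally show ?thesis
    using assms by (intro modular_inverse_int_eqI) (auto simp: modular_inverse_int_nonneg modular_inverse_int_less)
next
  \<comment> \<open>For non-units both sides are the default value of
    \<open>modular_inverse\<close>.\<close>
  case False
  then have "\<not> coprime a c"
    using assms(1) by (metis cong_imp_coprime)
  with False show ?thesis by simp
qed

text \<open>Orthogonality in \<open>m\<close> detects \<open>u = a mod c\<close>, which trades the
  interval for complete Kloosterman sums weighted by geometric sums. Only \<open>a mod c\<close>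
  enters, so the interval may extend past one period.\<close>

lemma incomplete_kloosterman_completion:
  assumes c: "c > 0"
  shows "(\<Sum>a | a < N \<and> coprime (int a) c. ec c (n * modular_inverse c (int a)))
       = (\<Sum>m\<in>{0..<c}. (\<Sum>a<N. ec c (int a * - m)) * kloosterman c m n) / of_int c"
proof -
  let ?i = "modular_inverse c"
  have "(\<Sum>m\<in>{0..<c}. (\<Sum>a<N. ec c (int a * - m)) * kloosterman c m n)
      = (\<Sum>m\<in>{0..<c}. \<Sum>a<N. \<Sum>u\<in>units_mod c. ec c (m * (u - int a)) * ec c (n * ?i u))"
    unfolding kloosterman_def sum_product
    by (intro sum.cong refl) (simp add: algebra_simps flip: ec_add)
  also have "\<dots> = (\<Sum>a<N. \<Sum>m\<in>{0..<c}. \<Sum>u\<in>units_mod c. ec c (m * (u - int a)) * ec c (n * ?i u))"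
    by (rule sum.swap)
  also have "\<dots> = (\<Sum>a<N. \<Sum>u\<in>units_mod c. \<Sum>m\<in>{0..<c}. ec c (m * (u - int a)) * ec c (n * ?i u))"
    by (intro sum.cong refl sum.swap)
  also have "\<dots> = (\<Sum>a<N. \<Sum>u\<in>units_mod c. if u = int a mod c then of_int c * ec c (n * ?i (int a)) else 0)"
  proof (intro sum.cong refl)
    fix a u assume u: "u \<in> units_mod c"
    have "c dvd u - int a \<longleftrightarrow> u = int a mod c"
      using u by (metis mod_eq_dvd_iff mod_pos_pos_trivial units_modD(1,2))
    moreover have "?i u = ?i (int a)" if "u = int a mod c"
      using that c by (intro modular_inverse_int_cong) (auto simp: cong_def)
    ultimately show "(\<Sum>m\<in>{0..<c}. ec c (m * (u - int a)) * ec c (n * ?i u))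
        = (if u = int a mod c then of_int c * ec c (n * ?i (int a)) else 0)"
      using c by (subst sum_distrib_right [symmetric]) (auto simp: ec_orthogonality)
  qed
  also have "\<dots> = (\<Sum>a<N. if coprime (int a) c then of_int c * ec c (n * ?i (int a)) else 0)"
  proof (intro sum.cong refl)
    fix a
    have "int a mod c \<in> units_mod c \<longleftrightarrow> coprime (int a) c"
      using c by (auto simp: units_mod_def)
    then show "(\<Sum>u\<in>units_mod c. if u = int a mod c then of_int c * ec c (n * ?i (int a)) else 0)
        = (if coprime (int a) c then of_int c * ec c (n * ?i (int a)) else 0)"
      by (simp add: sum.delta)
  qed
  also have "\<dots> = of_int c * (\<Sum>a | a < N \<and> coprime (int a) c. ec c (n * ?i (int a)))"
    by (simp add: sum.inter_filter [symmetric] sum_distrib_left lessThan_def)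
  finally show ?thesis using c by simp
qed

text \<open>The geometric weights sum to \<open>O(c log c)\<close>: frequency 0 gives
  \<open>N\<close>, the others a harmonic sum of \<open>1 / zdist\<close>. After division by
  \<open>c\<close>, completion costs only a logarithm. The range \<open>N \<le> c + 1\<close> admits
  both endpoints \<open>a = 0\<close> and \<open>a = c\<close>.\<close>

lemma incomplete_kloosterman_bound:
  assumes c: "c > 0" and N: "int N \<le> c + 1"
  shows "norm (\<Sum>a | a < N \<and> coprime (int a) c. ec c (n * modular_inverse c (int a)))
       \<le> (3 + ln (of_int c)) * (2 * of_int (gcd n c) * of_int c ^ 3 * real (ndiv c) ^ 3) powr (1/4)"
proof -
  define B where "B = (2 * of_int (gcd n c) * of_int c ^ 3 * real (ndiv c) ^ 3) powr (1/4)"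
  have B: "norm (kloosterman c m n) \<le> B" for m
  proof -
    have "norm (kloosterman c m n) = (norm (kloosterman c m n) ^ 4) powr (1/4)"
      using powr_powr[of "norm (kloosterman c m n)" 4 "1/4"] by simp
    also have "\<dots> \<le> B"
      unfolding B_def by (intro powr_mono2 kloosterman_bound c) auto
    finally show ?thesis .
  qed
  have B0: "B \<ge> 0" by (simp add: B_def)
  have split: "{0..<c} = insert 0 {1..<c}" using c by auto
  have c1: "real_of_int c \<ge> 1" using c by linarith
  have "(\<Sum>m\<in>{0..<c}. norm (\<Sum>a<N. ec c (int a * - m))) = real N + (\<Sum>m\<in>{1..<c}. norm (\<Sum>a<N. ec c (int a * - m)))"
    by (subst split) simp
  also have "\<dots> \<le> (of_int c + 1) + (\<Sum>m\<in>{1..<c}. of_int c / 2 * (1 / of_int (zdist c m)))"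
  proof (intro add_mono sum_mono)
    fix m assume m: "m \<in> {1..<c}"
    then have "\<not> c dvd - m" by (auto dest: zdvd_imp_le)
    from norm_geometric_ec_le[OF c this, of N]
    show "norm (\<Sum>a<N. ec c (int a * - m)) \<le> of_int c / 2 * (1 / of_int (zdist c m))"
      by (simp add: zdist_uminus c)
  qed (use N in linarith)
  also have "\<dots> = (of_int c + 1) + of_int c / 2 * (\<Sum>m\<in>{1..<c}. 1 / of_int (zdist c m))"
    by (simp add: sum_distrib_left)
  also have "\<dots> \<le> (of_int c + 1) + of_int c / 2 * (2 * (1 + ln (of_int c)))"
    using c by (intro add_left_mono mult_left_mono sum_inverse_zdist_le) auto
  also have "\<dots> \<le> of_int c * (3 + ln (of_int c))"
    using c1 by (simp add: algebra_simps)
  finally have S: "(\<Sum>m\<in>{0..<c}. norm (\<Sum>a<N. ec c (int a * - m))) \<le> of_int c * (3 + ln (of_int c))" .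
  have "norm (\<Sum>m\<in>{0..<c}. (\<Sum>a<N. ec c (int a * - m)) * kloosterman c m n)
      \<le> (\<Sum>m\<in>{0..<c}. norm (\<Sum>a<N. ec c (int a * - m)) * B)"
    by (intro sum_norm_le) (auto simp: norm_mult intro!: mult_left_mono B)
  also have "\<dots> = (\<Sum>m\<in>{0..<c}. norm (\<Sum>a<N. ec c (int a * - m))) * B"
    by (rule sum_distrib_right [symmetric])
  also have "\<dots> \<le> of_int c * (3 + ln (of_int c)) * B"
    by (intro mult_right_mono S B0)
  finally have "norm ((\<Sum>m\<in>{0..<c}. (\<Sum>a<N. ec c (int a * - m)) * kloosterman c m n) / of_int c) \<le> (3 + ln (of_int c)) * B"
    using c by (simp add: norm_divide divide_le_eq mult_ac)
  then show ?thesis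
    unfolding incomplete_kloosterman_completion[OF c] B_def .
qed

text \<open>A Sobolev-type argument: the Lipschitz bound controls the weighted \<open>L\<^sup>2\<close> norm of the Fourier
  coefficients, so their sum against the Kloosterman bound loses only logarithms.\<close>
lemma sum_inverse_units_lipschitz:
  fixes \<psi> :: "int \<Rightarrow> complex"
  assumes c: "c > 0" and N: "int N \<le> c + 1" and w: "coprime w c"
    and per: "\<And>k. \<psi> (k mod c) = \<psi> k"
    and lip: "\<And>k. norm (\<psi> (k + 1) - \<psi> k) \<le> L / of_int c"
  shows "norm (\<Sum>a | a < N \<and> coprime (int a) c. \<psi> (w * modular_inverse c (int a)))
     \<le> (of_int c + 1) * norm ((\<Sum>k\<in>{0..<c}. \<psi> k) / of_int c)
        + 2 * L * (1 + ln (of_int c)) * (3 + ln (of_int c)) * (2 * of_int c ^ 3 * real (ndiv c) ^ 3) powr (1/4)"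
proof -
  let ?I = "{0..<c}"
  define h where "h = (\<lambda>n. (\<Sum>k\<in>?I. \<psi> k * ec c (- (n * k))) / of_int c)"
  define Q where "Q = (\<lambda>n. \<Sum>a | a < N \<and> coprime (int a) c. ec c (n * w * modular_inverse c (int a)))"
  define B where "B = (2 * of_int c ^ 3 * real (ndiv c) ^ 3) powr (1/4)"
  define l where "l = ln (real_of_int c)"
  have c1: "real_of_int c \<ge> 1" using c by linarith
  have l: "l \<ge> 0" using c1 by (simp add: l_def)
  have L: "L \<ge> 0"
    using lip[of 0] c1 by (smt (verit) divide_neg_pos norm_ge_zero)
  have B0: "B \<ge> 0" by (simp add: B_def)

  have z: "real_of_int (zdist c n) \<ge> 1" if "n \<in> {1..<c}" for n
    using that by (auto simp: zdist_small min_def)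
  have "(\<Sum>a | a < N \<and> coprime (int a) c. \<psi> (w * modular_inverse c (int a)))
      = (\<Sum>a | a < N \<and> coprime (int a) c. \<Sum>n\<in>?I. h n * ec c (n * (w * modular_inverse c (int a))))"
    unfolding h_def by (intro sum.cong refl ec_inversion c per)
  also have "\<dots> = (\<Sum>n\<in>?I. \<Sum>a | a < N \<and> coprime (int a) c. h n * ec c (n * (w * modular_inverse c (int a))))"
    by (rule sum.swap)
  also have "\<dots> = (\<Sum>n\<in>?I. h n * Q n)"
    by (simp add: Q_def sum_distrib_left mult.assoc)
  also have "\<dots> = h 0 * Q 0 + (\<Sum>n\<in>{1..<c}. h n * Q n)"
  proof -
    have "?I = insert 0 {1..<c}" using c by auto
    then show ?thesis by simp
  qed
  also have "norm \<dots> \<le> norm (h 0) * (of_int c + 1) + (\<Sum>n\<in>{1..<c}. norm (h n) * (sqrt (of_int (zdist c n)) * ((3 + l) * B)))"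
  proof (rule order_trans[OF norm_triangle_ineq], intro add_mono sum_norm_le)
    have "norm (Q 0) \<le> (\<Sum>a | a < N \<and> coprime (int a) c. 1)"
      unfolding Q_def by (rule sum_norm_le) simp
    also have "\<dots> \<le> (\<Sum>a<N. 1)"
      by (intro sum_mono2) auto
    also have "\<dots> \<le> of_int c + 1" using N by simp
    finally show "norm (h 0 * Q 0) \<le> norm (h 0) * (of_int c + 1)"
      by (simp add: norm_mult mult_left_mono)
  next
    fix n assume n: "n \<in> {1..<c}"
    have "gcd (n * w) c = gcd n c"
      using w by (metis coprime_commute gcd_mult_left_right_cancel)
    \<comment> \<open>The gcd divides both \<open>n\<close> and \<open>c - n\<close>, so the
      distance to the nearest multiple of \<open>c\<close> dominates it. The lossy passage to a
      square root below is the form suited to Cauchy-Schwarz.\<close>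
    have "gcd n c \<le> n" "gcd n c \<le> c - n"
      using n by (auto intro!: zdvd_imp_le gcd_le1_int dvd_diff)
    then have g: "real_of_int (gcd n c) \<le> of_int (zdist c n)"
      using n by (simp add: zdist_small)
    have "norm (Q n) \<le> (3 + l) * (2 * of_int (gcd (n * w) c) * of_int c ^ 3 * real (ndiv c) ^ 3) powr (1/4)"
      unfolding Q_def l_def by (rule incomplete_kloosterman_bound[OF c N])
    also have "\<dots> = (3 + l) * (of_int (gcd n c) powr (1/4) * B)"
      unfolding \<open>gcd (n * w) c = gcd n c\<close> B_def using c
      by (subst powr_mult [symmetric]) (auto simp: mult_ac)
    also have "\<dots> \<le> (3 + l) * (sqrt (of_int (zdist c n)) * B)"
    proof (intro mult_left_mono mult_right_mono B0)
      have "real_of_int (gcd n c) powr (1/4) \<le> of_int (zdist c n) powr (1/4)"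
        using g by (intro powr_mono2) auto
      also have "\<dots> \<le> of_int (zdist c n) powr (1/2)"
        using z[OF n] by (intro powr_mono) auto
      also have "\<dots> = sqrt (of_int (zdist c n))"
        using z[OF n] by (simp add: powr_half_sqrt)
      finally show "real_of_int (gcd n c) powr (1/4) \<le> sqrt (of_int (zdist c n))" .
    qed (use l in auto)
    finally have "norm (Q n) \<le> (3 + l) * (sqrt (of_int (zdist c n)) * B)" .
    from mult_left_mono[OF this norm_ge_zero[of "h n"]]
    show "norm (h n * Q n) \<le> norm (h n) * (sqrt (of_int (zdist c n)) * ((3 + l) * B))"
      by (simp add: norm_mult mult_ac)
  qed
  \<comment> \<open>The weight is redistributed for Cauchy-Schwarz:
    \<open>zdist * norm (h n)\<close> has a bounded square sum by the Lipschitz condition, and the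
    squares of \<open>1 / sqrt zdist\<close> sum to a logarithm.\<close>
  also have "(\<Sum>n\<in>{1..<c}. norm (h n) * (sqrt (of_int (zdist c n)) * ((3 + l) * B)))
      = (\<Sum>n\<in>{1..<c}. (of_int (zdist c n) * norm (h n)) * (1 / sqrt (of_int (zdist c n)))) * ((3 + l) * B)"
    unfolding sum_distrib_right
  proof (intro sum.cong refl)
    fix n assume n: "n \<in> {1..<c}"
    have "of_int (zdist c n) * (1 / sqrt (of_int (zdist c n))) = sqrt (real_of_int (zdist c n))"
      using z[OF n] by (simp add: real_div_sqrt)
    then show "norm (h n) * (sqrt (of_int (zdist c n)) * ((3 + l) * B))
        = (of_int (zdist c n) * norm (h n)) * (1 / sqrt (of_int (zdist c n))) * ((3 + l) * B)"
      by (metis mult.assoc mult.commute)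
  qed
  also have "\<dots> \<le> (L * (2 * (1 + l))) * ((3 + l) * B)"
  proof (intro mult_right_mono)
    \<comment> \<open>The discrete form of differentiation: passing to the forward difference of
      \<open>\<psi>\<close> multiplies the coefficient by \<open>ec c n - 1\<close>, whose norm is
      at least \<open>4 zdist / c\<close>.\<close>
    have diff: "(ec c n - 1) * h n = (\<Sum>k\<in>?I. (\<psi> (k + 1) - \<psi> k) * ec c (- (n * k))) / of_int c" for n
    proof -
      have "ec c n * (\<Sum>k\<in>?I. \<psi> k * ec c (- (n * k))) = (\<Sum>k\<in>?I. \<psi> (k + 1) * ec c (- (n * k)))"
      proof -
        have "(\<Sum>k\<in>?I. \<psi> (k + 1) * ec c (- (n * k))) = (\<Sum>k\<in>?I. \<psi> k * ec c (- (n * (k - 1))))"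
        proof (rule sum.reindex_bij_witness[of _ "\<lambda>k. (k - 1) mod c" "\<lambda>k. (k + 1) mod c"])
          fix k assume k: "k \<in> ?I"
          show "((k + 1) mod c - 1) mod c = k" "((k - 1) mod c + 1) mod c = k"
            using k by (simp_all add: mod_diff_left_eq mod_add_left_eq)
          have "ec c (- (n * ((k + 1) mod c - 1))) = ec c (- (n * k))"
          proof (rule ec_cong)
            have "[- (n * ((k + 1) mod c - 1)) = - (n * ((k + 1) - 1))] (mod c)"
              unfolding cong_minus_minus_iff by (intro cong_mult cong_diff cong_refl) (simp add: cong_def)
            then show "[- (n * ((k + 1) mod c - 1)) = - (n * k)] (mod c)" by simp
          qed (use c in auto)
          then show "\<psi> ((k + 1) mod c) * ec c (- (n * ((k + 1) mod c - 1))) = \<psi> (k + 1) * ec c (- (n * k))"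
            by (simp add: per)
        qed (use c in auto)
        also have "\<dots> = ec c n * (\<Sum>k\<in>?I. \<psi> k * ec c (- (n * k)))"
          unfolding sum_distrib_left by (intro sum.cong refl) (simp add: algebra_simps ec_diff ec_add ec_minus)
        finally show ?thesis by simp
      qed
      then show ?thesis
        by (simp add: h_def left_diff_distrib sum_subtractf diff_divide_distrib times_divide_eq_right)
    qed
    have "(\<Sum>n\<in>{1..<c}. (of_int (zdist c n) * norm (h n)) ^ 2) \<le> (\<Sum>n\<in>{1..<c}. norm (\<Sum>k\<in>?I. (\<psi> (k + 1) - \<psi> k) * ec c (- (n * k))) ^ 2)"
    proof (intro sum_mono power_mono)
      fix n assume n: "n \<in> {1..<c}"
      have "of_int (zdist c n) * norm (h n) \<le> of_int c * norm (ec c n - 1) * norm (h n)"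
      proof (intro mult_right_mono)
        have "4 * real_of_int (zdist c n) \<le> of_int c * norm (ec c n - 1)"
          using norm_ec_minus_1_ge[OF c, of n] c by (simp add: field_simps)
        then show "real_of_int (zdist c n) \<le> of_int c * norm (ec c n - 1)"
          using z[OF n] by linarith
      qed auto
      also have "\<dots> = norm (\<Sum>k\<in>?I. (\<psi> (k + 1) - \<psi> k) * ec c (- (n * k)))"
        using arg_cong[OF diff[of n], of norm] c unfolding norm_mult[of _ "h n"] norm_divide by (simp add: mult.assoc)
      finally show "of_int (zdist c n) * norm (h n) \<le> norm (\<Sum>k\<in>?I. (\<psi> (k + 1) - \<psi> k) * ec c (- (n * k)))" .
    qed (use z in \<open>auto intro!: mult_nonneg_nonneg zdist_nonneg c\<close>)
    also have "\<dots> \<le> (\<Sum>n\<in>?I. norm (\<Sum>k\<in>?I. (\<psi> (k + 1) - \<psi> k) * ec c (- (n * k))) ^ 2)"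
      by (intro sum_mono2) auto
    also have "\<dots> = of_int c * (\<Sum>k\<in>?I. norm (\<psi> (k + 1) - \<psi> k) ^ 2)"
      by (rule ec_parseval[OF c])
    also have "\<dots> \<le> of_int c * (\<Sum>k\<in>?I. (L / of_int c) ^ 2)"
      using c by (intro mult_left_mono sum_mono power_mono lip) auto
    also have "\<dots> = L ^ 2"
      using c by (simp add: power2_eq_square)
    finally have 1: "(\<Sum>n\<in>{1..<c}. (of_int (zdist c n) * norm (h n)) ^ 2) \<le> L ^ 2" .
    have "(\<Sum>n\<in>{1..<c}. (1 / sqrt (of_int (zdist c n))) ^ 2) = (\<Sum>n\<in>{1..<c}. 1 / real_of_int (zdist c n))"
      by (intro sum.cong refl) (auto simp: power_divide zdist_nonneg c)
    also have "\<dots> \<le> 2 * (1 + l)"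
      unfolding l_def by (rule sum_inverse_zdist_le[OF c])
    finally have 2: "(\<Sum>n\<in>{1..<c}. (1 / sqrt (of_int (zdist c n))) ^ 2) \<le> 2 * (1 + l)" .
    have "(\<Sum>n\<in>{1..<c}. (of_int (zdist c n) * norm (h n)) * (1 / sqrt (of_int (zdist c n)))) ^ 2
        \<le> (\<Sum>n\<in>{1..<c}. (of_int (zdist c n) * norm (h n)) ^ 2) * (\<Sum>n\<in>{1..<c}. (1 / sqrt (of_int (zdist c n))) ^ 2)"
      by (rule Cauchy_Schwarz_ineq_sum)
    also have "\<dots> \<le> L ^ 2 * (2 * (1 + l))"
      using l by (intro mult_mono 1 2 sum_nonneg) auto
    \<comment> \<open>The factor \<open>2 * (1 + l)\<close> is at least 1; squaring it makes the
      right side a perfect square.\<close>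
    also have "\<dots> \<le> L ^ 2 * (2 * (1 + l)) ^ 2"
      using l by (intro mult_left_mono self_le_power) auto
    finally show "(\<Sum>n\<in>{1..<c}. (of_int (zdist c n) * norm (h n)) * (1 / sqrt (of_int (zdist c n)))) \<le> L * (2 * (1 + l))"
      using L l by (intro power2_le_imp_le[OF _ mult_nonneg_nonneg]) (auto simp: power_mult_distrib)
  qed (use l B0 in auto)
  finally show ?thesis
    by (simp add: h_def l_def B_def mult_ac)
qed

section \<open>The divisor bound\<close>

lemma card_divisors_mult_le:
  fixes m n :: nat
  assumes "m > 0" "n > 0"
  shows "card {d. d dvd m * n} \<le> card {d. d dvd m} * card {d. d dvd n}"
proof -
  have "{d. d dvd m * n} \<subseteq> (\<lambda>(a, b). a * b) ` ({d. d dvd m} \<times> {d. d dvd n})"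
    by (auto simp: image_iff elim!: dvd_productE)
  then have "card {d. d dvd m * n} \<le> card ((\<lambda>(a, b). a * b) ` ({d. d dvd m} \<times> {d. d dvd n}))"
    using assms by (intro card_mono) auto
  also have "\<dots> \<le> card ({d. d dvd m} \<times> {d. d dvd n})"
    using assms by (intro card_image_le) auto
  finally show ?thesis by (simp add: card_cartesian_product)
qed

lemma card_divisors_prime_power:
  assumes "prime (p::nat)"
  shows "card {d. d dvd p ^ k} = k + 1"
proof -
  have "{d. d dvd p ^ k} = (\<lambda>i. p ^ i) ` {..k}"
    using assms by (auto simp: divides_primepow_nat)
  moreover have "inj_on (\<lambda>i. p ^ i) {..k}"
    using prime_gt_1_nat[OF assms] by (auto simp: inj_on_def power_inject_exp)
  ultimately show ?thesis by (simp add: card_image)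
qed

text \<open>With \<open>t = \<epsilon> k ln 2\<close> the power dominates \<open>exp t\<close>,
  which is at least 1 and at least \<open>t\<close>. The constant converts \<open>t\<close> back
  into \<open>k\<close>.\<close>

lemma Suc_le_mult_powr:
  fixes \<epsilon> :: real
  assumes "\<epsilon> > 0" "x \<ge> 2"
  shows "real k + 1 \<le> (1 + 1 / (\<epsilon> * ln 2)) * (x ^ k) powr \<epsilon>"
proof -
  define t where "t = \<epsilon> * real k * ln 2"
  have l2: "ln (2::real) > 0" by simp
  have t: "t \<ge> 0" using assms by (simp add: t_def)
  have "exp t \<le> (x ^ k) powr \<epsilon>"
  proof -
    have "(x ^ k) powr \<epsilon> = exp (\<epsilon> * real k * ln x)"
      using assms by (simp add: powr_def ln_realpow)
    moreover have "ln 2 \<le> ln x" using assms by simp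
    ultimately show ?thesis
      using assms by (auto simp: t_def intro!: mult_left_mono)
  qed
  moreover have "1 \<le> exp t" "t \<le> exp t" using t exp_ge_add_one_self[of t] by linarith+
  ultimately have *: "1 \<le> (x ^ k) powr \<epsilon>" "t \<le> (x ^ k) powr \<epsilon>"
    by linarith+
  have "real k = (1 / (\<epsilon> * ln 2)) * t"
    using assms l2 by (simp add: t_def)
  also have "\<dots> \<le> (1 / (\<epsilon> * ln 2)) * (x ^ k) powr \<epsilon>"
    using assms l2 * by (intro mult_left_mono) auto
  finally show ?thesis using *(1) by (simp add: algebra_simps)
qed

text \<open>Split off the full power \<open>p ^ k\<close> of one prime. If
  \<open>p powr \<epsilon> \<ge> 2\<close>, then \<open>k + 1 \<le> 2 ^ k\<close> is absorbed by
  \<open>(p ^ k) powr \<epsilon>\<close> at no cost; each of the remaining small primes costs one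
  factor \<open>K\<close>.\<close>

lemma divisor_bound_prime_factors:
  fixes \<epsilon> :: real
  assumes e: "\<epsilon> > 0" and n: "n > 0"
  defines "K \<equiv> 1 + 1 / (\<epsilon> * ln 2)"
  shows "real (card {d. d dvd n}) \<le> K ^ card {p\<in>prime_factors n. real p < 2 powr (1/\<epsilon>)} * real n powr \<epsilon>"
  using n
proof (induction n rule: less_induct)
  case (less n)
  have K: "K \<ge> 1" using e by (simp add: K_def)
  show ?case
  proof (cases "n = 1")
    case True
    then show ?thesis by simp
  next
    case False
    with less.prems obtain p where p: "prime p" "p dvd n"
      by (metis prime_factor_nat)
    define k where "k = multiplicity p n"
    obtain m where m: "n = p ^ k * m" "\<not> p dvd m"
      using multiplicity_decompose'[of n p] p less.prems unfolding k_def
      by (metis not_prime_unit less_irrefl)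
    have k: "k > 0" unfolding k_def using p less.prems by (simp add: prime_multiplicity_gt_zero_iff)
    have m0: "m > 0" using m less.prems by (cases "m = 0") auto
    have "1 < p ^ k" using prime_gt_1_nat[OF p(1)] k by (rule one_less_power)
    then have "m < n" using m m0 by simp
    define S where "S = (\<lambda>n. {p\<in>prime_factors n. real p < 2 powr (1/\<epsilon>)})"
    have fin: "finite (S j)" for j by (auto simp: S_def)
    have IH: "real (card {d. d dvd m}) \<le> K ^ card (S m) * real m powr \<epsilon>"
      using less.IH[OF \<open>m < n\<close> m0] by (simp add: S_def)
    have sub: "S m \<subseteq> S n"
      using m less.prems by (auto simp: S_def prime_factors_dvd)
    have pm: "p \<notin> S m" using m by (auto simp: S_def)
    have powr: "real n powr \<epsilon> = (real p ^ k) powr \<epsilon> * real m powr \<epsilon>"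
      by (simp add: m powr_mult)
    have "card {d. d dvd n} \<le> card {d. d dvd p ^ k} * card {d. d dvd m}"
      unfolding m(1) using p m0 by (intro card_divisors_mult_le) (auto simp: prime_gt_0_nat)
    also have "\<dots> = (k + 1) * card {d. d dvd m}"
      using p by (simp add: card_divisors_prime_power)
    finally have "real (card {d. d dvd n}) \<le> real ((k + 1) * card {d. d dvd m})"
      by (simp only: of_nat_le_iff)
    also have "\<dots> \<le> (real k + 1) * (K ^ card (S m) * real m powr \<epsilon>)"
      using mult_left_mono[OF IH, of "real k + 1"] by (simp add: algebra_simps)
    also have "\<dots> \<le> K ^ card (S n) * real n powr \<epsilon>"
    proof (cases "real p < 2 powr (1/\<epsilon>)")
      case True
      have "real k + 1 \<le> K * (real p ^ k) powr \<epsilon>"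
        unfolding K_def using p prime_ge_2_nat[of p] by (intro Suc_le_mult_powr e) auto
      then have "(real k + 1) * (K ^ card (S m) * real m powr \<epsilon>) \<le> K * (real p ^ k) powr \<epsilon> * (K ^ card (S m) * real m powr \<epsilon>)"
        using K by (intro mult_right_mono) auto
      also have "\<dots> = K ^ Suc (card (S m)) * real n powr \<epsilon>"
        by (simp add: powr mult_ac)
      also have "\<dots> \<le> K ^ card (S n) * real n powr \<epsilon>"
      proof (intro mult_right_mono power_increasing K)
        have "p \<in> S n" using p True less.prems by (auto simp: S_def prime_factors_dvd)
        then have "insert p (S m) \<subseteq> S n" using sub by auto
        then have "card (insert p (S m)) \<le> card (S n)" by (intro card_mono fin)
        then show "Suc (card (S m)) \<le> card (S n)" using pm fin by simp
      qed auto
      finally show ?thesis .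
    next
      case False
      have "2 \<le> real p powr \<epsilon>"
      proof -
        have "2 = (2 powr (1/\<epsilon>)) powr \<epsilon>" using e by (simp add: powr_powr)
        also have "\<dots> \<le> real p powr \<epsilon>" using False e by (intro powr_mono2) auto
        finally show ?thesis .
      qed
      have "real k + 1 \<le> 2 ^ k"
        using of_nat_less_two_power[of k, where 'a = real] by (metis Suc_leI of_nat_Suc of_nat_le_iff of_nat_numeral of_nat_power less_exp add.commute)
      also have "\<dots> \<le> (real p powr \<epsilon>) ^ k"
        using \<open>2 \<le> real p powr \<epsilon>\<close> by (intro power_mono) auto
      also have "\<dots> = (real p ^ k) powr \<epsilon>"
        using p prime_gt_0_nat[of p] by (simp add: powr_powr mult.commute flip: powr_realpow)
      finally have "(real k + 1) * (K ^ card (S m) * real m powr \<epsilon>) \<le> (real p ^ k) powr \<epsilon> * (K ^ card (S m) * real m powr \<epsilon>)"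
        using K by (intro mult_right_mono) auto
      also have "\<dots> = K ^ card (S m) * real n powr \<epsilon>"
        by (simp add: powr mult_ac)
      also have "\<dots> \<le> K ^ card (S n) * real n powr \<epsilon>"
        by (intro mult_right_mono power_increasing K card_mono fin sub) auto
      finally show ?thesis .
    qed
    finally show ?thesis by (simp add: S_def)
  qed
qed

lemma divisor_bound:
  fixes \<epsilon> :: real
  assumes e: "\<epsilon> > 0"
  obtains C where "C > 0" "\<And>n. n > 0 \<Longrightarrow> real (card {d. d dvd n}) \<le> C * real n powr \<epsilon>"
proof
  define K where "K = 1 + 1 / (\<epsilon> * ln 2)"
  \<comment> \<open>Only primes below \<open>2 powr (1/\<epsilon>)\<close> cost a factor, so the
    number of factors is bounded independently of \<open>n\<close>.\<close>
  define R where "R = nat \<lceil>2 powr (1/\<epsilon>)\<rceil>"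
  have K: "K \<ge> 1" using e by (simp add: K_def)
  show "K ^ R > 0" using K by simp
  fix n :: nat assume n: "n > 0"
  have "{p\<in>prime_factors n. real p < 2 powr (1/\<epsilon>)} \<subseteq> {..<R}"
    by (auto simp: R_def) linarith
  then have "card {p\<in>prime_factors n. real p < 2 powr (1/\<epsilon>)} \<le> R"
    using card_mono[of "{..<R}"] by auto
  then have "K ^ card {p\<in>prime_factors n. real p < 2 powr (1/\<epsilon>)} * real n powr \<epsilon> \<le> K ^ R * real n powr \<epsilon>"
    by (intro mult_right_mono power_increasing K) auto
  with divisor_bound_prime_factors[OF e n] show "real (card {d. d dvd n}) \<le> K ^ R * real n powr \<epsilon>"
    by (simp add: K_def)
qed

section \<open>Periodic holomorphic functions vanishing at the cusp\<close>

lemma open_uhp: "open upper_half_plane"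
  unfolding upper_half_plane_def by (rule open_halfspace_Im_gt)

lemma convex_uhp: "convex upper_half_plane"
  unfolding upper_half_plane_def by (rule convex_halfspace_Im_gt)

lemma in_uhp_iff [simp]: "z \<in> upper_half_plane \<longleftrightarrow> Im z > 0"
  by (simp add: upper_half_plane_def)

lemma uhp_primitive:
  assumes "h holomorphic_on upper_half_plane"
  obtains F where "\<And>z. Im z > 0 \<Longrightarrow> (F has_field_derivative h z) (at z)"
proof -
  obtain F where "\<And>z. z \<in> upper_half_plane \<Longrightarrow> (F has_field_derivative h z) (at z within upper_half_plane)"
    using holomorphic_convex_primitive'[OF convex_uhp open_uhp assms] by blast
  then show ?thesis
    using at_within_open[OF _ open_uhp] by (intro that[of F]) (metis in_uhp_iff)
qed

lemma uhp_deriv_zero_constant: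
  assumes "\<And>z. Im z > 0 \<Longrightarrow> (D has_field_derivative 0) (at z)"
  obtains k where "\<And>z. Im z > 0 \<Longrightarrow> D z = k"
proof -
  have "\<exists>k. \<forall>z\<in>upper_half_plane. D z = k"
    by (rule has_field_derivative_zero_constant[OF convex_uhp])
       (auto intro: assms has_field_derivative_at_within)
  with that show ?thesis by auto
qed

lemma horizontal_lipschitz:
  assumes F: "\<And>z. Im z = y \<Longrightarrow> (F has_field_derivative h z) (at z)"
    and B: "\<And>z. Im z = y \<Longrightarrow> norm (h z) \<le> B"
    and "Im z = y" "Im z' = y"
  shows "norm (F z - F z') \<le> B * norm (z - z')"
proof (rule field_differentiable_bound[of "{z. Im z = y}" F h B])
  show "convex {z. Im z = y}"
    using convex_hyperplane[of \<i> y] by (simp add: inner_complex_def)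
qed (auto intro: assms has_field_derivative_at_within)

text \<open>The mean value inequality is applied to \<open>\<Phi> u - F z * u\<close>, whose
  derivative \<open>F u - F z\<close> is at most \<open>B * s\<close> on the segment. Bounds are
  required on a single horizontal line, where the Riemann sums live.\<close>

lemma horizontal_taylor:
  assumes F: "\<And>z. Im z = y \<Longrightarrow> (F has_field_derivative h z) (at z)"
    and Phi: "\<And>z. Im z = y \<Longrightarrow> (\<Phi> has_field_derivative F z) (at z)"
    and B: "\<And>z. Im z = y \<Longrightarrow> norm (h z) \<le> B"
    and z: "Im z = y" and s: "s \<ge> 0"
  shows "norm (\<Phi> (z + of_real s) - \<Phi> z - F z * of_real s) \<le> B * s ^ 2"
proof -
  let ?S = "{u. Im u = y} \<inter> ({u. Re u \<ge> Re z} \<inter> {u. Re u \<le> Re z + s})"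
  have B0: "B \<ge> 0" using B[OF z] norm_ge_zero order_trans by blast
  have "norm ((\<Phi> (z + of_real s) - F z * (z + of_real s)) - (\<Phi> z - F z * z)) \<le> (B * s) * norm ((z + of_real s) - z)"
  proof (rule field_differentiable_bound[of ?S])
    show "convex ?S"
      using convex_hyperplane[of \<i> y]
      by (intro convex_Int convex_halfspace_Re_ge convex_halfspace_Re_le) (simp add: inner_complex_def)
  next
    fix u assume u: "u \<in> ?S"
    then show "((\<lambda>u. \<Phi> u - F z * u) has_field_derivative (F u - F z)) (at u within ?S)"
      by (auto intro!: derivative_eq_intros has_field_derivative_at_within[OF Phi])
    have "norm (F u - F z) \<le> B * norm (u - z)"
      using u z by (intro horizontal_lipschitz[of y F h B] F B) auto
    also have "norm (u - z) = \<bar>Re u - Re z\<bar>"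
      using u z by (simp add: cmod_eq_Re)
    finally show "norm (F u - F z) \<le> B * s"
      using u B0 by (smt (verit) IntE mem_Collect_eq mult_left_mono)
  qed (use z s in auto)
  then show ?thesis
    using s by (simp add: algebra_simps power2_eq_square)
qed

text \<open>This isolates what a slashed form retains at its cusp, with \<open>w\<close> a period.
  Only uniform vanishing at \<open>i \<infinity>\<close> is demanded; rates of decay are derived
  from it.\<close>

definition cuspidal_periodic :: "real \<Rightarrow> (complex \<Rightarrow> complex) \<Rightarrow> bool" where
  "cuspidal_periodic w h \<longleftrightarrow> w > 0 \<and> h holomorphic_on upper_half_plane
     \<and> (\<forall>z. Im z > 0 \<longrightarrow> h (z + of_real w) = h z)
     \<and> (\<forall>\<epsilon>>0. \<exists>Y. \<forall>z. Im z > Y \<longrightarrow> norm (h z) < \<epsilon>)"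

text \<open>The additive constant of \<open>F\<close> is chosen so that \<open>F\<close> has mean zero over a period, i.e. so that
  its own primitive \<open>\<Phi>\<close> is periodic.\<close>
lemma cuspidal_periodic_primitive:
  assumes h: "cuspidal_periodic w h"
  obtains F \<Phi> where
    "\<And>z. Im z > 0 \<Longrightarrow> (F has_field_derivative h z) (at z)"
    "\<And>z. Im z > 0 \<Longrightarrow> (\<Phi> has_field_derivative F z) (at z)"
    "\<And>z. Im z > 0 \<Longrightarrow> F (z + of_real w) = F z"
    "\<And>z. Im z > 0 \<Longrightarrow> \<Phi> (z + of_real w) = \<Phi> z"
proof -
  have w: "w > 0" and hol: "h holomorphic_on upper_half_plane"
    and per: "\<And>z. Im z > 0 \<Longrightarrow> h (z + of_real w) = h z"
    and lim: "\<And>\<epsilon>. \<epsilon> > 0 \<Longrightarrow> \<exists>Y. \<forall>z. Im z > Y \<longrightarrow> norm (h z) < \<epsilon>"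
    using h by (auto simp: cuspidal_periodic_def)
  have shift: "((\<lambda>z. P (z + of_real w)) has_field_derivative p (z + of_real w)) (at z)"
    if "\<And>z. Im z > 0 \<Longrightarrow> (P has_field_derivative p z) (at z)" "Im z > 0" for P p z
    using DERIV_shift[of P "p (z + of_real w)" z "of_real w"] that by simp
  obtain P where P: "\<And>z. Im z > 0 \<Longrightarrow> (P has_field_derivative h z) (at z)"
    using uhp_primitive[OF hol] by blast
  have "((\<lambda>z. P (z + of_real w) - P z) has_field_derivative 0) (at z)" if "Im z > 0" for z
    using DERIV_diff[OF shift[OF P that] P[OF that]] per[OF that] by simp
  then obtain k where k: "\<And>z. Im z > 0 \<Longrightarrow> P (z + of_real w) - P z = k"
    using uhp_deriv_zero_constant[of "\<lambda>z. P (z + of_real w) - P z"] by blast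
  \<comment> \<open>The increment over a period does not depend on the height, yet it is at most
    \<open>w\<close> times the supremum of \<open>h\<close> at that height, which tends to
    0.\<close>
  have "k = 0"
  proof (rule ccontr)
    assume "k \<noteq> 0"
    then obtain Y where Y: "\<And>z. Im z > Y \<Longrightarrow> norm (h z) < norm k / (2 * w)"
      using lim[of "norm k / (2 * w)"] w by auto
    define y where "y = max Y 0 + 1"
    have y: "y > Y" "y > 0" by (auto simp: y_def)
    define z where "z = \<i> * of_real y"
    have "norm (P (z + of_real w) - P z) \<le> norm k / (2 * w) * norm ((z + of_real w) - z)"
      using y by (intro horizontal_lipschitz[of y P h]) (auto intro!: P less_imp_le[OF Y] simp: z_def)
    then have "norm k \<le> norm k / 2"
      using k[of z] y w by (simp add: z_def)
    with \<open>k \<noteq> 0\<close> show False by simp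
  qed
  have "P holomorphic_on upper_half_plane"
    unfolding holomorphic_on_def field_differentiable_def
    using P has_field_derivative_at_within by (metis in_uhp_iff)
  then obtain Q where Q: "\<And>z. Im z > 0 \<Longrightarrow> (Q has_field_derivative P z) (at z)"
    using uhp_primitive by blast
  have "((\<lambda>z. Q (z + of_real w) - Q z) has_field_derivative 0) (at z)" if "Im z > 0" for z
    using DERIV_diff[OF shift[OF Q that] Q[OF that]] k[OF that] \<open>k = 0\<close> by simp
  then obtain m where m: "\<And>z. Im z > 0 \<Longrightarrow> Q (z + of_real w) - Q z = m"
    using uhp_deriv_zero_constant[of "\<lambda>z. Q (z + of_real w) - Q z"] by blast
  show ?thesis
  proof (rule that[of "\<lambda>z. P z - m / of_real w" "\<lambda>z. Q z - m / of_real w * z"])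
    fix z assume z: "Im z > 0"
    show "((\<lambda>z. P z - m / of_real w) has_field_derivative h z) (at z)"
      using P[OF z] by (auto intro!: derivative_eq_intros)
    show "((\<lambda>z. Q z - m / of_real w * z) has_field_derivative P z - m / of_real w) (at z)"
      using Q[OF z] w by (auto intro!: derivative_eq_intros)
    show "P (z + of_real w) - m / of_real w = P z - m / of_real w"
      using k[OF z] \<open>k = 0\<close> by simp
    show "Q (z + of_real w) - m / of_real w * (z + of_real w) = Q z - m / of_real w * z"
      using m[OF z] w by (simp add: field_simps)
  qed
qed

text \<open>Over a full period the increment of \<open>\<Phi>\<close> vanishes, so the Taylor
  remainder alone bounds \<open>w * F z\<close>.\<close>

lemma periodic_primitive_bound:
  assumes F: "\<And>z. Im z > 0 \<Longrightarrow> (F has_field_derivative h z) (at z)"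
    and Phi: "\<And>z. Im z > 0 \<Longrightarrow> (\<Phi> has_field_derivative F z) (at z)"
    and per: "\<And>z. Im z > 0 \<Longrightarrow> \<Phi> (z + of_real w) = \<Phi> z"
    and w: "w > 0" and z: "Im z > 0" and B: "\<And>u. Im u = Im z \<Longrightarrow> norm (h u) \<le> B"
  shows "norm (F z) \<le> w * B"
proof -
  have "norm (\<Phi> (z + of_real w) - \<Phi> z - F z * of_real w) \<le> B * w ^ 2"
    using assms by (intro horizontal_taylor[of "Im z" F h \<Phi>]) auto
  then have "w * norm (F z) \<le> w * (w * B)"
    using per[OF z] w by (simp add: norm_mult power2_eq_square mult_ac)
  then show ?thesis using w by simp
qed

text \<open>The equidistant sum over one period telescopes up to Taylor remainders of
  \<open>\<Phi>\<close>. Compared with the pointwise bound, averaging \<open>K\<close> samples gains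
  a factor \<open>K\<close>.\<close>

lemma periodic_primitive_mean_bound:
  assumes F: "\<And>z. Im z > 0 \<Longrightarrow> (F has_field_derivative h z) (at z)"
    and Phi: "\<And>z. Im z > 0 \<Longrightarrow> (\<Phi> has_field_derivative F z) (at z)"
    and per: "\<And>z. Im z > 0 \<Longrightarrow> \<Phi> (z + of_real w) = \<Phi> z"
    and w: "w > 0" and z: "Im z > 0" and B: "\<And>u. Im u = Im z \<Longrightarrow> norm (h u) \<le> B"
    and K: "K > 0"
  shows "norm ((\<Sum>k<K. F (z + of_real (w * real k / real K))) / of_nat K) \<le> w * B / real K"
proof -
  define s where "s = w / real K"
  have s: "s > 0" "real K * s = w" using w K by (auto simp: s_def)
  define u where "u = (\<lambda>k::nat. z + of_real (s * real k))"
  have "(\<Sum>k<K. \<Phi> (u (Suc k)) - \<Phi> (u k)) = \<Phi> (u K) - \<Phi> (u 0)"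
    by (rule sum_lessThan_telescope)
  also have "\<dots> = 0"
  proof -
    have "s * real K = w" using s(2) by (simp add: mult.commute)
    then have "u K = z + of_real w" by (simp only: u_def)
    with per[OF z] show ?thesis by (simp add: u_def)
  qed
  finally have tel: "(\<Sum>k<K. \<Phi> (u (Suc k)) - \<Phi> (u k)) = 0" .
  have "norm (\<Sum>k<K. (\<Phi> (u (Suc k)) - \<Phi> (u k)) - F (u k) * of_real s) \<le> (\<Sum>k<K. B * s ^ 2)"
  proof (rule sum_norm_le)
    fix k
    have eq: "u (Suc k) = u k + of_real s"
      by (simp add: u_def algebra_simps)
    show "norm ((\<Phi> (u (Suc k)) - \<Phi> (u k)) - F (u k) * of_real s) \<le> B * s ^ 2"
      unfolding eq using z s by (intro horizontal_taylor[of "Im z" F h \<Phi>] F Phi B) (auto simp: u_def)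
  qed
  also have "(\<Sum>k<K. (\<Phi> (u (Suc k)) - \<Phi> (u k)) - F (u k) * of_real s) = - ((\<Sum>k<K. F (u k)) * of_real s)"
    using tel by (simp add: sum_subtractf sum_distrib_right)
  finally have "norm (\<Sum>k<K. F (u k)) * s \<le> real K * (B * s ^ 2)"
    using s by (simp add: norm_mult)
  then have "norm (\<Sum>k<K. F (u k)) * s \<le> (w * B) * s"
    using s(2) by (simp add: power2_eq_square algebra_simps)
  then have "norm (\<Sum>k<K. F (u k)) \<le> w * B"
    using s by (simp add: mult_le_cancel_right)
  then have "norm (\<Sum>k<K. F (u k)) / real K \<le> w * B / real K"
    by (rule divide_right_mono) simp
  moreover have "(\<Sum>k<K. F (u k)) = (\<Sum>k<K. F (z + of_real (w * real k / real K)))"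
    by (simp add: u_def s_def)
  ultimately show ?thesis by (simp add: norm_divide)
qed

text \<open>\<open>h\<close> is the derivative of a primitive bounded by \<open>w * B\<close> on the
  disc of radius \<open>Im z / 2\<close>, so Cauchy's inequality gains one factor
  \<open>1 / Im z\<close>. Starting from a bound \<open>C / Im z\<close>, it yields inverse square
  decay.\<close>

lemma cuspidal_periodic_decay:
  assumes h: "cuspidal_periodic w h" and z: "Im z > 0"
    and B: "\<And>u. Im u \<ge> Im z / 2 \<Longrightarrow> norm (h u) \<le> B"
  shows "norm (h z) \<le> 2 * w * B / Im z"
proof -
  have w: "w > 0" using h by (simp add: cuspidal_periodic_def)
  obtain F \<Phi> where F: "\<And>z. Im z > 0 \<Longrightarrow> (F has_field_derivative h z) (at z)"
    and Phi: "\<And>z. Im z > 0 \<Longrightarrow> (\<Phi> has_field_derivative F z) (at z)"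
    and per: "\<And>z. Im z > 0 \<Longrightarrow> \<Phi> (z + of_real w) = \<Phi> z"
    using cuspidal_periodic_primitive[OF h] by metis
  let ?r = "Im z / 2"
  have im: "Im u \<ge> Im z / 2" if "norm (z - u) \<le> ?r" for u
    using abs_Im_le_cmod[of "z - u"] that by simp
  have holF: "F holomorphic_on upper_half_plane"
    unfolding holomorphic_on_def field_differentiable_def
    using F has_field_derivative_at_within by (metis in_uhp_iff)
  have sub: "cball z ?r \<subseteq> upper_half_plane"
  proof
    fix u assume "u \<in> cball z ?r"
    then show "u \<in> upper_half_plane" using im[of u] z by (simp add: dist_norm)
  qed
  have "norm ((deriv ^^ 1) F z) \<le> fact 1 * (w * B) / ?r ^ 1"
  proof (rule Cauchy_inequality)
    show "F holomorphic_on ball z ?r"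
      using holF sub ball_subset_cball holomorphic_on_subset by blast
    show "continuous_on (cball z ?r) F"
      using holF sub holomorphic_on_imp_continuous_on continuous_on_subset by blast
    fix u assume "norm (z - u) = ?r"
    then have u: "Im u \<ge> Im z / 2" using im[of u] by simp
    show "norm (F u) \<le> w * B"
      by (rule periodic_primitive_bound[of F h \<Phi>]) (use F Phi per w u z B in auto)
  qed (use z in auto)
  moreover have "deriv F z = h z" using F[OF z] by (rule DERIV_imp_deriv)
  ultimately show ?thesis by (simp add: field_simps)
qed

section \<open>Weight two cusp forms\<close>

lemma uhp_denom_nonzero:
  assumes "a * d - b * c = (1::int)" "Im z > 0"
  shows "of_int c * z + of_int d \<noteq> (0::complex)"
proof
  assume *: "of_int c * z + of_int d = (0::complex)"
  have "Im (of_int c * z + of_int d) = of_int c * Im z" by simp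
  with * assms have "c = 0" by simp
  moreover from this * have "d = 0" by simp
  ultimately show False using assms by simp
qed

lemma Im_moebius:
  assumes det: "a * d - b * c = (1::int)" and z: "Im z > 0"
  shows "Im (moebius_int a b c d z) = Im z / norm (of_int c * z + of_int d) ^ 2"
proof -
  let ?D = "of_int c * z + of_int d"
  have "real_of_int a * of_int d - of_int b * of_int c = 1"
    using det by (metis of_int_1 of_int_diff of_int_mult)
  then have d: "real_of_int a * of_int d = 1 + of_int b * of_int c" by simp
  have "Im (moebius_int a b c d z) = Im ((of_int a * z + of_int b) * cnj ?D) / norm ?D ^ 2"
    unfolding moebius_int_def by (simp add: complex_div_cnj[of _ ?D] del: complex_cnj_add complex_cnj_mult)
  also have "Im ((of_int a * z + of_int b) * cnj ?D) = (of_int a * of_int d - of_int b * of_int c) * Im z"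
    by (simp add: algebra_simps)
  also have "\<dots> = Im z" by (simp add: d)
  finally show ?thesis .
qed

lemma Im_moebius_pos:
  assumes "a * d - b * c = (1::int)" "Im z > 0"
  shows "Im (moebius_int a b c d z) > 0"
  using Im_moebius[OF assms] uhp_denom_nonzero[OF assms] assms(2) by simp

lemma moebius_denom_compose:
  assumes "a' * d' - b' * c' = (1::int)" "Im z > 0"
  shows "of_int c * moebius_int a' b' c' d' z + of_int d
       = (of_int (c * a' + d * c') * z + of_int (c * b' + d * d')) / (of_int c' * z + of_int d')"
  using uhp_denom_nonzero[OF assms] unfolding moebius_int_def by (simp add: field_simps)

lemma moebius_compose:
  assumes "a' * d' - b' * c' = (1::int)" "Im z > 0"
  shows "moebius_int a b c d (moebius_int a' b' c' d' z)
       = moebius_int (a * a' + b * c') (a * b' + b * d') (c * a' + d * c') (c * b' + d * d') z"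
  using uhp_denom_nonzero[OF assms]
  unfolding moebius_int_def[of a b c d] moebius_denom_compose[OF assms]
  unfolding moebius_int_def by simp

lemma slash2_compose:
  assumes "a' * d' - b' * c' = (1::int)" "Im z > 0"
  shows "slash2 (slash2 f a b c d) a' b' c' d' z
       = slash2 f (a * a' + b * c') (a * b' + b * d') (c * a' + d * c') (c * b' + d * d') z"
  using uhp_denom_nonzero[OF assms]
  unfolding slash2_def moebius_denom_compose[OF assms] moebius_compose[OF assms]
  by (simp add: power_divide field_simps)

lemma slash2_cong:
  assumes "a * d - b * c = (1::int)" "Im z > 0" "\<And>z. Im z > 0 \<Longrightarrow> f z = g z"
  shows "slash2 f a b c d z = slash2 g a b c d z"
  using assms Im_moebius_pos[OF assms(1,2)] by (simp add: slash2_def)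

lemma norm_slash2:
  assumes "a * d - b * c = (1::int)" "Im z > 0"
  shows "norm (slash2 f a b c d z) * Im z
       = norm (f (moebius_int a b c d z)) * Im (moebius_int a b c d z)"
  unfolding slash2_def Im_moebius[OF assms]
  by (simp add: norm_mult norm_inverse norm_power divide_inverse)

lemma S2D:
  assumes "f \<in> S2 q"
  shows S2_holomorphic: "f holomorphic_on upper_half_plane"
    and S2_slash: "\<And>a b c d z. a * d - b * c = 1 \<Longrightarrow> int q dvd c \<Longrightarrow> Im z > 0 \<Longrightarrow> slash2 f a b c d z = f z"
    and S2_cusp: "\<And>a b c d \<epsilon>. a * d - b * c = 1 \<Longrightarrow> \<epsilon> > 0 \<Longrightarrow> \<exists>Y. \<forall>z. Im z > Y \<longrightarrow> norm (slash2 f a b c d z) < \<epsilon>"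
  using assms unfolding S2_def in_uhp_iff by blast+

text \<open>The second matrix times the inverse of the first has lower left entry
  \<open>c' * d - d' * c\<close>, so the divisibility puts it into \<open>\<Gamma>_0(q)\<close>. The
  slashed form therefore depends only on the class of the bottom row modulo
  \<open>q\<close>.\<close>

lemma S2_slash_eq:
  assumes f: "f \<in> S2 q" and det: "a * d - b * c = 1" and det': "a' * d' - b' * c' = 1"
    and dvd: "int q dvd c' * d - d' * c" and z: "Im z > 0"
  shows "slash2 f a' b' c' d' z = slash2 f a b c d z"
proof -
  let ?A = "a' * d - b' * c" and ?B = "b' * a - a' * b" and ?C = "c' * d - d' * c" and ?D = "d' * a - c' * b"
  have "?A * ?D - ?B * ?C = (a * d - b * c) * (a' * d' - b' * c')"
    by (simp add: algebra_simps)
  then have D: "?A * ?D - ?B * ?C = 1" using det det' by simp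
  have "slash2 f a b c d z = slash2 (slash2 f ?A ?B ?C ?D) a b c d z"
    by (rule slash2_cong[OF det z], rule S2_slash[OF f D dvd, symmetric])
  also have "\<dots> = slash2 f (?A * a + ?B * c) (?A * b + ?B * d) (?C * a + ?D * c) (?C * b + ?D * d) z"
    by (rule slash2_compose[OF det z])
  also have "?A * a + ?B * c = a' * (a * d - b * c)" by (simp add: algebra_simps)
  also have "?A * b + ?B * d = b' * (a * d - b * c)" by (simp add: algebra_simps)
  also have "?C * a + ?D * c = c' * (a * d - b * c)" by (simp add: algebra_simps)
  also have "?C * b + ?D * d = d' * (a * d - b * c)" by (simp add: algebra_simps)
  finally show ?thesis using det by simp
qed

lemma slash2_holomorphic:
  assumes f: "f holomorphic_on upper_half_plane" and det: "a * d - b * c = 1"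
  shows "slash2 f a b c d holomorphic_on upper_half_plane"
proof -
  have "(\<lambda>z. inverse ((of_int c * z + of_int d)^2) * (f \<circ> moebius_int a b c d) z) holomorphic_on upper_half_plane"
  proof (intro holomorphic_intros holomorphic_on_compose_gen[OF _ f])
    show "moebius_int a b c d holomorphic_on upper_half_plane"
      unfolding moebius_int_def using uhp_denom_nonzero[OF det] by (intro holomorphic_intros) auto
    show "moebius_int a b c d ` upper_half_plane \<subseteq> upper_half_plane"
      using Im_moebius_pos[OF det] by auto
  qed (use uhp_denom_nonzero[OF det] in auto)
  then show ?thesis by (simp add: slash2_def [abs_def])
qed

text \<open>Conjugating the translation by \<open>N\<close> with the matrix produces the lower left
  entry \<open>- c * c * N\<close>, whence the divisibility condition.\<close>

lemma S2_cuspidal_periodic: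
  assumes f: "f \<in> S2 q" and det: "a * d - b * c = 1" and N: "N > 0" "int q dvd c * c * N"
  shows "cuspidal_periodic (of_int N) (slash2 f a b c d)"
  unfolding cuspidal_periodic_def
proof (intro conjI allI impI)
  fix z assume z: "Im z > 0"
  have "slash2 f a b c d (z + of_real (of_int N)) = slash2 (slash2 f a b c d) 1 N 0 1 z"
    by (simp add: slash2_def[of "slash2 f a b c d"] moebius_int_def)
  also have "\<dots> = slash2 f a (a * N + b) c (c * N + d) z"
    using z by (subst slash2_compose) (auto simp: add.commute)
  also have "\<dots> = slash2 f a b c d z"
    using N det by (intro S2_slash_eq[OF f det _ _ z]) (auto simp: algebra_simps)
  finally show "slash2 f a b c d (z + of_real (of_int N)) = slash2 f a b c d z" .
next
  show "slash2 f a b c d holomorphic_on upper_half_plane"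
    by (rule slash2_holomorphic[OF S2_holomorphic[OF f] det])
  show "\<exists>Y. \<forall>z. Im z > Y \<longrightarrow> norm (slash2 f a b c d z) < \<epsilon>" if "\<epsilon> > 0" for \<epsilon>
    by (rule S2_cusp[OF f det that])
qed (use N in auto)

lemma periodic_int_shift:
  assumes per: "\<And>z. Im z > 0 \<Longrightarrow> h (z + of_real w) = h z" and z: "Im z > 0"
  shows "h (z + of_int n * of_real w) = h z"
proof -
  have nat: "h (z + of_nat m * of_real w) = h z" if "Im z > 0" for m z
    using that
  proof (induction m)
    case (Suc m)
    then show ?case using per[of "z + of_nat m * of_real w"] by (simp add: algebra_simps)
  qed auto
  show ?thesis
  proof (cases "n \<ge> 0")
    case True
    then show ?thesis using nat[OF z, of "nat n"] by simp
  next
    case False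
    then show ?thesis using nat[of "z + of_int n * of_real w" "nat (- n)"] z by simp
  qed
qed

lemma cuspidal_periodic_bounded:
  assumes h: "cuspidal_periodic w h" and y: "y0 > 0"
  obtains B where "\<And>z. Im z \<ge> y0 \<Longrightarrow> norm (h z) \<le> B"
proof -
  have w: "w > 0" and hol: "h holomorphic_on upper_half_plane"
    and per: "\<And>z. Im z > 0 \<Longrightarrow> h (z + of_real w) = h z"
    using h by (auto simp: cuspidal_periodic_def)
  obtain Y where Y: "\<And>z. Im z > Y \<Longrightarrow> norm (h z) < 1"
    using h zero_less_one unfolding cuspidal_periodic_def by metis
  define K where "K = cbox (Complex 0 y0) (Complex w Y)"
  have "K \<subseteq> upper_half_plane"
    using y by (auto simp: K_def in_cbox_complex_iff)
  then have "continuous_on K h"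
    by (rule continuous_on_subset[OF holomorphic_on_imp_continuous_on[OF hol]])
  then have "compact (h ` K)"
    by (rule compact_continuous_image) (simp add: K_def)
  then obtain B where B: "\<And>z. z \<in> K \<Longrightarrow> norm (h z) \<le> B"
    using compact_imp_bounded[of "h ` K"] unfolding bounded_iff by blast
  have "norm (h z) \<le> max 1 B" if z: "Im z \<ge> y0" for z
  proof (cases "Im z > Y")
    case True
    then show ?thesis using Y[of z] by simp
  next
    case False
    define n where "n = \<lfloor>Re z / w\<rfloor>"
    define u where "u = z + of_int (- n) * of_real w"
    have "of_int n * w \<le> Re z" "Re z \<le> of_int n * w + w"
      using floor_divide_lower[OF w, of "Re z"] floor_divide_upper[OF w, of "Re z"]
      unfolding n_def by (auto simp: algebra_simps)
    then have "u \<in> K"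
      using False z by (simp add: u_def K_def in_cbox_complex_iff)
    moreover have "h u = h z"
      unfolding u_def using z y by (intro periodic_int_shift per) auto
    ultimately show ?thesis using B[of u] by simp
  qed
  then show ?thesis by (rule that)
qed

section \<open>Growth of cusp forms by reduction theory\<close>

text \<open>Dirichlet approximation of \<open>Re z\<close> with denominators up to about
  \<open>1 / sqrt y\<close> gives a bottom row \<open>(k, - h)\<close> with
  \<open>norm (k z - h) ^ 2 \<le> y + 4 y\<close>; this is the origin of \<open>1/5\<close>.\<close>

lemma exists_moebius_Im_ge:
  assumes z: "Im z > 0"
  obtains a b c d :: int where "a * d - b * c = 1" "Im (moebius_int a b c d z) \<ge> 1/5"
proof (cases "Im z \<ge> 1")
  case True
  then show ?thesis using that[of 1 1 0 0] by (simp add: moebius_int_def)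
next
  case False
  define y where "y = Im z"
  define N where "N = nat \<lceil>1 / sqrt y\<rceil>"
  have y: "0 < y" "y < 1" using z False by (auto simp: y_def)
  have s: "sqrt y > 0" "sqrt y < 1" using y by auto
  have N1: "real N \<ge> 1 / sqrt y" unfolding N_def by (rule real_nat_ceiling_ge)
  have "real N = of_int \<lceil>1 / sqrt y\<rceil>"
    unfolding N_def using s by (intro of_nat_nat) (simp add: order_less_le_trans[of "-1" 0])
  then have "real N \<le> 1 / sqrt y + 1"
    by linarith
  also have "\<dots> \<le> 1 / sqrt y + 1 / sqrt y"
    using s y by (intro add_left_mono) (simp add: le_divide_eq)
  also have "\<dots> = 2 / sqrt y" by simp
  finally have N2: "real N \<le> 2 / sqrt y" .
  have N0: "N > 0" using N1 s by (metis divide_pos_pos of_nat_0_less_iff order_less_le_trans zero_less_one)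
  obtain h k where hk: "coprime h k" "0 < k" "k \<le> int N" "\<bar>of_int k * Re z - of_int h\<bar> < 1 / N"
    using Dirichlet_approx_coprime[OF N0] by metis
  obtain u v where uv: "u * h + v * k = 1"
    using hk(1) by (metis bezout_int coprime_iff_gcd_eq_1)
  have det: "(- u) * (- h) - (- v) * k = 1" using uv by simp
  have "norm (of_int k * z + of_int (- h)) ^ 2 = (of_int k * Re z - of_int h) ^ 2 + (of_int k * y) ^ 2"
    by (simp add: cmod_power2 y_def)
  also have "\<dots> \<le> (1 / N) ^ 2 + (real N * y) ^ 2"
  proof (intro add_mono)
    show "(of_int k * Re z - of_int h) ^ 2 \<le> (1 / real N) ^ 2"
      using hk(4) by (intro abs_le_square_iff[THEN iffD1]) auto
    show "(of_int k * y) ^ 2 \<le> (real N * y) ^ 2"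
      using hk y by (intro power_mono mult_right_mono) auto
  qed
  also have "\<dots> \<le> (sqrt y) ^ 2 + (2 * sqrt y) ^ 2"
  proof (intro add_mono power_mono)
    show "1 / real N \<le> sqrt y" using N1 N0 s by (simp add: field_simps)
    have "real N * y = real N * sqrt y * sqrt y" using y by simp
    also have "\<dots> \<le> 2 * sqrt y" using N2 s by (intro mult_right_mono) (auto simp: field_simps)
    finally show "real N * y \<le> 2 * sqrt y" .
  qed (use y in auto)
  also have "\<dots> = 5 * y" using y by (simp add: power_mult_distrib)
  finally have le: "norm (of_int k * z + of_int (- h)) ^ 2 \<le> 5 * y" .
  have "norm (of_int k * z + of_int (- h)) ^ 2 > 0"
    using uhp_denom_nonzero[OF det z] by simp
  then have "Im (moebius_int (- u) (- v) k (- h) z) \<ge> 1/5"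
    unfolding Im_moebius[OF det z] using le by (simp add: y_def field_simps)
  then show ?thesis using that[OF det] by simp
qed

text \<open>By \<open>norm_slash2\<close> it suffices to bound the slashed forms on
  \<open>Im z \<ge> 1/5\<close>. They fall into finitely many classes according to the bottom row
  modulo \<open>q\<close>, each of period \<open>q\<close> and decaying at least like
  \<open>1 / Im z\<close>.\<close>

lemma S2_bound:
  assumes q: "q \<ge> 1" and f: "f \<in> S2 q"
  obtains C where "C \<ge> 0" "\<And>z. Im z > 0 \<Longrightarrow> norm (f z) * Im z \<le> C"
proof -
  define R where "R = {0..<int q} \<times> {0..<int q}"
  define P where "P = (\<lambda>r B. \<forall>a b c d z. a * d - b * c = 1 \<and> (c mod int q, d mod int q) = r \<and> Im z \<ge> 1/5
          \<longrightarrow> norm (slash2 f a b c d z) * Im z \<le> B)"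
  have "\<exists>B. P r B" for r
  proof (cases "\<exists>a b c d. a * d - b * c = 1 \<and> (c mod int q, d mod int q) = r")
    case True
    then obtain a b c d where det: "a * d - b * c = 1" and r: "r = (c mod int q, d mod int q)" by blast
    have cp: "cuspidal_periodic (of_int (int q)) (slash2 f a b c d)"
      using q by (intro S2_cuspidal_periodic[OF f det]) auto
    obtain B where B: "\<And>z. Im z \<ge> 1/10 \<Longrightarrow> norm (slash2 f a b c d z) \<le> B"
      using cuspidal_periodic_bounded[OF cp, of "1/10"] by auto
    show ?thesis
      unfolding P_def
    proof (intro exI[of _ "2 * real q * B"] allI impI, elim conjE)
      fix a' b' c' d' z assume det': "a' * d' - b' * c' = 1" and r': "(c' mod int q, d' mod int q) = r"
        and z: "Im z \<ge> 1/5"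
      have "[c' * d = c * d'] (mod int q)"
        using r r' by (intro cong_mult) (auto simp: cong_def)
      then have "int q dvd c' * d - d' * c"
        by (simp add: cong_iff_dvd_diff mult.commute)
      then have "slash2 f a' b' c' d' z = slash2 f a b c d z"
        using z by (intro S2_slash_eq[OF f det det']) auto
      also have "norm (slash2 f a b c d z) \<le> 2 * of_int (int q) * B / Im z"
        using z by (intro cuspidal_periodic_decay[OF cp] B) auto
      finally show "norm (slash2 f a' b' c' d' z) * Im z \<le> 2 * real q * B"
        using z by (simp add: field_simps)
    qed
  next
    case False
    then have "P r 0" unfolding P_def by blast
    then show ?thesis by blast
  qed
  then obtain B where B: "\<And>r. P r (B r)" by metis
  show ?thesis
  proof (rule that[of "\<Sum>r\<in>R. \<bar>B r\<bar>"])
    fix z assume z: "Im z > 0"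
    obtain a b c d :: int where det: "a * d - b * c = 1" and im: "Im (moebius_int a b c d z) \<ge> 1/5"
      using exists_moebius_Im_ge[OF z] by blast
    define u where "u = moebius_int a b c d z"
    have u: "Im u \<ge> 1/5" using im by (simp add: u_def)
    have det': "d * a - (- b) * (- c) = 1" using det by (simp add: algebra_simps)
    have "moebius_int d (- b) (- c) a u = z"
      unfolding u_def using det
      by (subst moebius_compose[OF det z]) (simp add: moebius_int_def algebra_simps flip: of_int_mult of_int_diff)
    then have "norm (f z) * Im z = norm (slash2 f d (- b) (- c) a u) * Im u"
      using norm_slash2[OF det', of u f] u by simp
    also have "\<dots> \<le> B ((- c) mod int q, a mod int q)"
      using B det' u unfolding P_def by blast
    also have "\<dots> \<le> \<bar>B ((- c) mod int q, a mod int q)\<bar>" by simp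
    also have "\<dots> \<le> (\<Sum>r\<in>R. \<bar>B r\<bar>)"
      using q by (intro member_le_sum) (auto simp: R_def)
    finally show "norm (f z) * Im z \<le> (\<Sum>r\<in>R. \<bar>B r\<bar>)" .
  qed (auto intro: sum_nonneg)
qed

section \<open>Values at the cusps\<close>

lemma moebius_has_derivative:
  assumes det: "a * d - b * c = (1::int)" and z: "Im z > 0"
  shows "(moebius_int a b c d has_field_derivative inverse ((of_int c * z + of_int d) ^ 2)) (at z)"
proof -
  have nz: "of_int c * z + of_int d \<noteq> 0" by (rule uhp_denom_nonzero[OF det z])
  have "of_int (a * d - b * c) = (1::complex)" using det by simp
  then have d: "of_int a * of_int d = (1::complex) + of_int b * of_int c" by (simp add: algebra_simps)
  have "((\<lambda>z. (of_int a * z + of_int b) / (of_int c * z + of_int d)) has_field_derivative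
      (of_int a * (of_int c * z + of_int d) - (of_int a * z + of_int b) * of_int c) / ((of_int c * z + of_int d) * (of_int c * z + of_int d))) (at z)"
    using nz by (auto intro!: derivative_eq_intros)
  also have "of_int a * (of_int c * z + of_int d) - (of_int a * z + of_int b) * of_int c = of_int a * of_int d - of_int b * of_int c"
    by (simp add: algebra_simps)
  also have "\<dots> = 1" by (simp add: d)
  finally show ?thesis
    by (simp add: moebius_int_def [abs_def] power2_eq_square divide_inverse)
qed

lemma Im_of_int_divide [simp]: "Im (of_int a / of_int c) = 0"
  by (metis Im_complex_of_real of_real_divide of_real_of_int_eq)

text \<open>Squarefreeness of \<open>q\<close> makes \<open>N = q / gcd c q\<close> coprime to \<open>c\<close>, so that every cusp with denominator
  \<open>c\<close> is reached by a matrix with \<open>N dvd d\<close>; all of these share one slashed form, of width \<open>N\<close>.\<close>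
lemma cusp_expansion:
  fixes c :: int
  assumes q: "q \<ge> 1" "squarefree q" and f: "f \<in> S2 q" and c: "c > 0"
    and F: "\<And>z. Im z > 0 \<Longrightarrow> (F has_field_derivative f z) (at z)"
    and C: "\<And>z. Im z > 0 \<Longrightarrow> norm (f z) * Im z \<le> C"
  obtains N w h Fs \<Phi> where "N > 0" "N \<le> int q" "coprime w c" "cuspidal_periodic (of_int N) h"
    "\<And>z. Im z > 0 \<Longrightarrow> norm (h z) * Im z \<le> C"
    "\<And>z. Im z > 0 \<Longrightarrow> (Fs has_field_derivative h z) (at z)"
    "\<And>z. Im z > 0 \<Longrightarrow> (\<Phi> has_field_derivative Fs z) (at z)"
    "\<And>z. Im z > 0 \<Longrightarrow> Fs (z + of_int N) = Fs z"
    "\<And>z. Im z > 0 \<Longrightarrow> \<Phi> (z + of_int N) = \<Phi> z"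
    "\<And>a. coprime a c \<Longrightarrow> \<exists>\<kappa>. \<forall>y>0. F (of_int a / of_int c + \<i> * of_real y)
        = \<kappa> + Fs (- (of_int (N * (w * modular_inverse c a)) / of_int c) + \<i> * of_real (1 / (of_int c ^ 2 * y)))"
    "\<And>a y. coprime a c \<Longrightarrow> y > 0 \<Longrightarrow> norm (f (of_int a / of_int c + \<i> * of_real y)) \<le> 4 * of_int N * C * of_int c ^ 2"
proof -
  define g where "g = gcd c (int q)"
  define N where "N = int q div g"
  have g: "g > 0" "g dvd c" "g * N = int q" using q by (auto simp: g_def N_def)
  have N: "N > 0" using g q by (smt (verit) mult_nonneg_nonpos of_nat_le_0_iff of_nat_1 of_nat_le_iff)
  have "1 * N \<le> g * N" using g(1) N by (intro mult_right_mono) auto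
  then have Nq: "N \<le> int q" using g by simp
  have "coprime N c"
  proof (rule coprimeI)
    fix k assume k: "k dvd N" "k dvd c"
    then have "k dvd int q" using g by (metis dvd_mult)
    with k have "k dvd g" by (simp add: g_def)
    with k have "k ^ 2 dvd g * N" by (simp add: power2_eq_square mult_dvd_mono)
    then have "k ^ 2 dvd int q" using g by simp
    then have "int ((nat \<bar>k\<bar>) ^ 2) dvd int q" by simp
    then have "(nat \<bar>k\<bar>) ^ 2 dvd q" by (simp only: of_nat_dvd_iff)
    then have "is_unit (nat \<bar>k\<bar>)" by (rule squarefreeD[OF q(2)])
    then show "is_unit k" by simp
  qed
  define w where "w = modular_inverse c N"
  have w: "coprime w c" unfolding w_def using \<open>coprime N c\<close> by (rule coprime_modular_inverse)
  \<comment> \<open>As \<open>w\<close> inverts \<open>N\<close> modulo \<open>c\<close>, this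
    \<open>d a\<close> inverts \<open>a\<close> modulo \<open>c\<close> and is a multiple of
    \<open>N\<close> as well. Since \<open>q\<close> divides \<open>c * N\<close>, the latter makes
    all these matrices equivalent under \<open>\<Gamma>_0(q)\<close>.\<close>
  define d where "d = (\<lambda>a. N * (w * modular_inverse c a))"
  define b where "b = (\<lambda>a. (a * d a - 1) div c)"
  have det: "a * d a - b a * c = 1" if "coprime a c" for a
  proof -
    have "[(a * modular_inverse c a) * (N * w) = 1 * 1] (mod c)"
      unfolding w_def using that \<open>coprime N c\<close> by (intro cong_mult cong_modular_inverse1)
    then have "[a * d a = 1] (mod c)" by (simp add: d_def mult_ac)
    then have "c dvd a * d a - 1" by (simp add: cong_iff_dvd_diff)
    then show ?thesis by (simp add: b_def)
  qed
  have one: "coprime 1 c" by simp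
  define h where "h = slash2 f 1 (b 1) c (d 1)"
  have qdvd: "int q dvd c * (N * k)" for k
    using g by (metis dvd_mult2 mult.assoc mult_dvd_mono dvd_refl)
  have h: "slash2 f a (b a) c (d a) z = h z" if "coprime a c" "Im z > 0" for a z
    unfolding h_def
  proof (rule S2_slash_eq[OF f det[OF one] det[OF that(1)] _ that(2)])
    have "c * d 1 - d a * c = c * (N * (w * modular_inverse c 1 - w * modular_inverse c a))"
      by (simp add: d_def algebra_simps)
    then show "int q dvd c * d 1 - d a * c" by (simp only: qdvd)
  qed
  have cp: "cuspidal_periodic (of_int N) h"
    unfolding h_def using N qdvd[of c] by (intro S2_cuspidal_periodic[OF f det[OF one]]) (auto simp: mult_ac)
  have hC: "norm (h z) * Im z \<le> C" if z: "Im z > 0" for z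
    unfolding h_def norm_slash2[OF det[OF one] z] by (intro C Im_moebius_pos[OF det[OF one] z])
  have C0: "C \<ge> 0" using C[of \<i>] norm_ge_zero[of "f \<i>"] by (simp del: norm_ge_zero)
  obtain Fs \<Phi> where Fs: "\<And>z. Im z > 0 \<Longrightarrow> (Fs has_field_derivative h z) (at z)"
    and Phi: "\<And>z. Im z > 0 \<Longrightarrow> (\<Phi> has_field_derivative Fs z) (at z)"
    and perF: "\<And>z. Im z > 0 \<Longrightarrow> Fs (z + of_real (of_int N)) = Fs z"
    and per: "\<And>z. Im z > 0 \<Longrightarrow> \<Phi> (z + of_real (of_int N)) = \<Phi> z"
    using cuspidal_periodic_primitive[OF cp] by blast
  \<comment> \<open>The point that the matrix sends to \<open>a / c + i y\<close>: at
    \<open>- d / c + i Y\<close> the denominator is \<open>i c Y\<close>, so the image has height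
    \<open>1 / (c^2 Y)\<close>.\<close>
  define zz where "zz = (\<lambda>a y. - (of_int (d a) / of_int c) + \<i> * of_real (1 / (of_int c ^ 2 * y)))"
  have Imzz: "Im (zz a y) = 1 / (of_int c ^ 2 * y)" if "y > 0" for a y
    by (simp add: zz_def)
  have Imzz_pos: "Im (zz a y) > 0" if "y > 0" for a y
    using that c by (simp add: Imzz)
  have den: "of_int c * zz a y + of_int (d a) = \<i> * of_real (1 / (of_int c * y))" if "y > 0" for a y
    using that c by (simp add: zz_def power2_eq_square field_simps)
  have mz: "moebius_int a (b a) c (d a) (zz a y) = of_int a / of_int c + \<i> * of_real y" if "coprime a c" "y > 0" for a y
  proof -
    have "of_int (a * d a - b a * c) = (1::complex)" using det[OF that(1)] by simp
    then have bd: "of_int (b a) * of_int c = of_int a * of_int (d a) - (1::complex)" by (simp add: algebra_simps)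
    let ?D = "of_int c * zz a y + of_int (d a)"
    have "moebius_int a (b a) c (d a) (zz a y) = (of_int a * ?D - 1) / (of_int c * ?D)"
    proof -
      have "of_int c * (of_int a * zz a y + of_int (b a)) = of_int a * ?D - 1"
        using bd by (simp add: algebra_simps)
      then show ?thesis using c unfolding moebius_int_def
        by (metis mult_divide_mult_cancel_left of_int_eq_0_iff less_irrefl)
    qed
    also have "\<dots> = of_int a / of_int c - 1 / (of_int c * ?D)"
      using c uhp_denom_nonzero[OF det[OF that(1)] Imzz_pos[OF that(2)]] by (simp add: diff_divide_distrib)
    also have "1 / (of_int c * ?D) = - (\<i> * of_real y)"
      unfolding den[OF that(2)] using c that(2) by (simp add: field_simps)
    finally show ?thesis by simp
  qed
  show ?thesis
  proof (rule that[of N w h Fs \<Phi>])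
    fix a assume a: "coprime a c"
    let ?m = "moebius_int a (b a) c (d a)"
    have "((\<lambda>z. F (?m z) - Fs z) has_field_derivative 0) (at z)" if z: "Im z > 0" for z
    proof -
      have "((\<lambda>z. F (?m z)) has_field_derivative f (?m z) * inverse ((of_int c * z + of_int (d a)) ^ 2)) (at z)"
        by (rule DERIV_chain2[OF F[OF Im_moebius_pos[OF det[OF a] z]] moebius_has_derivative[OF det[OF a] z]])
      also have "f (?m z) * inverse ((of_int c * z + of_int (d a)) ^ 2) = h z"
        using h[OF a z] by (simp add: slash2_def mult.commute)
      finally show ?thesis
        using DERIV_diff[OF _ Fs[OF z]] by fastforce
    qed
    then obtain k where k: "\<And>z. Im z > 0 \<Longrightarrow> F (?m z) - Fs z = k"
      using uhp_deriv_zero_constant[of "\<lambda>z. F (?m z) - Fs z"] by blast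
    show "\<exists>\<kappa>. \<forall>y>0. F (of_int a / of_int c + \<i> * of_real y)
        = \<kappa> + Fs (- (of_int (N * (w * modular_inverse c a)) / of_int c) + \<i> * of_real (1 / (of_int c ^ 2 * y)))"
    proof (intro exI[of _ k] allI impI)
      fix y :: real assume y: "y > 0"
      show "F (of_int a / of_int c + \<i> * of_real y)
        = k + Fs (- (of_int (N * (w * modular_inverse c a)) / of_int c) + \<i> * of_real (1 / (of_int c ^ 2 * y)))"
        using k[OF Imzz_pos[OF y, of a]] unfolding mz[OF a y] by (simp add: zz_def d_def algebra_simps)
    qed
    fix y :: real assume y: "y > 0"
    let ?z = "zz a y"
    \<comment> \<open>The inverse square decay of \<open>h\<close> at its own cusp, transported by
      the invariance of \<open>norm (f z) * Im z\<close>, cancels the factor \<open>1 / y\<close>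
      and bounds \<open>f\<close> on the whole vertical line above \<open>a / c\<close>.\<close>
    have "norm (h ?z) \<le> 2 * of_int N * (2 * C / Im ?z) / Im ?z"
    proof (rule cuspidal_periodic_decay[OF cp Imzz_pos[OF y]])
      fix u assume u: "Im u \<ge> Im ?z / 2"
      with Imzz_pos[OF y, of a] have "Im u > 0" by linarith
      then have "norm (h u) \<le> C / Im u" using hC by (simp add: pos_le_divide_eq)
      also have "\<dots> \<le> C / (Im ?z / 2)"
        using u Imzz_pos[OF y, of a] C0 by (intro divide_left_mono) auto
      finally show "norm (h u) \<le> 2 * C / Im ?z" by (simp add: mult.commute)
    qed
    also have "\<dots> = 4 * of_int N * C * (of_int c ^ 2 * y) ^ 2"
      unfolding Imzz[OF y] by (simp add: power2_eq_square)
    finally have "norm (h ?z) \<le> 4 * of_int N * C * (of_int c ^ 2 * y) ^ 2" .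
    moreover have "norm (h ?z) * Im ?z = norm (f (of_int a / of_int c + \<i> * of_real y)) * y"
      using norm_slash2[OF det[OF a] Imzz_pos[OF y, of a], of f] unfolding mz[OF a y] h[OF a Imzz_pos[OF y]]
      by simp
    ultimately have "norm (f (of_int a / of_int c + \<i> * of_real y)) * y \<le> 4 * of_int N * C * (of_int c ^ 2 * y) ^ 2 * (1 / (of_int c ^ 2 * y))"
      unfolding Imzz[OF y] using c y by (metis divide_nonneg_nonneg mult_right_mono order_less_imp_le zero_le_one mult_nonneg_nonneg zero_le_power2)
    also have "\<dots> = 4 * of_int N * C * of_int c ^ 2 * y"
      using c y by (simp add: power2_eq_square)
    finally show "norm (f (of_int a / of_int c + \<i> * of_real y)) \<le> 4 * of_int N * C * of_int c ^ 2"
      using y by simp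
  qed (use N Nq w cp hC Fs Phi perF per in auto)
qed

section \<open>Modular symbols as boundary values of the primitive\<close>

lemma set_integrable_inverse_square: "set_integrable lborel {0<..} (\<lambda>t::real. 1 / (1 + t) ^ 2)"
proof -
  have "set_integrable lborel (einterval 0 \<infinity>) (\<lambda>t::real. 1 / (1 + t) ^ 2)"
  proof (rule interval_integral_FTC_nonneg(1)[of 0 \<infinity> "\<lambda>t. - 1 / (1 + t)" _ "-1" 0])
    fix t :: real assume "0 < ereal t"
    then have t: "t > 0" by simp
    show "((\<lambda>t. - 1 / (1 + t)) has_real_derivative 1 / (1 + t) ^ 2) (at t)"
      using t by (auto intro!: derivative_eq_intros simp: power2_eq_square)
    show "isCont (\<lambda>t. 1 / (1 + t) ^ 2) t"
      using t by (intro continuous_intros) auto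
  next
    show "(((\<lambda>t. - 1 / (1 + t)) \<circ> real_of_ereal) \<longlongrightarrow> -1) (at_right 0)"
      unfolding zero_ereal_def ereal_tendsto_simps by real_asymp
    show "(((\<lambda>t. - 1 / (1 + t)) \<circ> real_of_ereal) \<longlongrightarrow> 0) (at_left \<infinity>)"
      unfolding ereal_tendsto_simps by real_asymp
  qed auto
  then show ?thesis by (simp add: zero_ereal_def)
qed

text \<open>The bounds \<open>b1\<close> and \<open>b2\<close> control the integrand at the two
  ends, so it is absolutely integrable. This identifies the gauge integral in \<open>modsym\<close>
  with the Lebesgue integral and permits the fundamental theorem on the half-line. The minus sign in
  \<open>modsym\<close> cancels that of \<open>0 - Re \<kappa>\<close>.\<close>

lemma modsym_eq_Re:
  assumes f: "f holomorphic_on upper_half_plane"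
    and F: "\<And>z. Im z > 0 \<Longrightarrow> (F has_field_derivative f z) (at z)"
    and b1: "\<And>z. Im z > 0 \<Longrightarrow> norm (f z) \<le> D / Im z ^ 2"
    and b2: "\<And>y. y > 0 \<Longrightarrow> norm (f (of_real r + \<i> * of_real y)) \<le> D"
    and lim0: "((\<lambda>y. F (of_real r + \<i> * of_real y)) \<longlongrightarrow> \<kappa>) (at_right 0)"
    and lim1: "((\<lambda>y. F (of_real r + \<i> * of_real y)) \<longlongrightarrow> 0) at_top"
  shows "modsym f r = 2 * of_real pi * \<i> * of_real (Re \<kappa>)"
proof -
  let ?l = "\<lambda>y. of_real r + \<i> * of_real y :: complex"
  let ?g = "\<lambda>t::real. Re (f (?l t) * \<i>)"
  have D: "D \<ge> 0" using b2[of 1] norm_ge_zero[of "f (?l 1)"] by linarith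
  have cont: "continuous_on {0<..} ?g"
  proof -
    have "continuous_on {0<..} (\<lambda>t. f (?l t))"
      by (rule continuous_on_compose2[OF holomorphic_on_imp_continuous_on[OF f]])
         (auto intro!: continuous_intros)
    then show ?thesis by (intro continuous_intros)
  qed
  \<comment> \<open>One majorant serves both ranges because \<open>1 + t \<le> 2 * max 1 t\<close>,
    whence the factor 4.\<close>
  have int: "set_integrable lborel {0<..} ?g"
  proof (rule set_integrable_bound[of _ _ "\<lambda>t. 4 * D * (1 / (1 + t) ^ 2)"])
    show "set_integrable lborel {0<..} (\<lambda>t. 4 * D * (1 / (1 + t) ^ 2))"
      by (rule set_integrable_mult_right) (use set_integrable_inverse_square in auto)
    show "set_borel_measurable lborel {0<..} ?g"
      using borel_measurable_continuous_on_indicator[OF _ cont] by (simp add: set_borel_measurable_def)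
    have "norm (?g t) \<le> norm (4 * D * (1 / (1 + t) ^ 2))" if t: "t > 0" for t
    proof -
      have "norm (?g t) \<le> norm (f (?l t))"
        using abs_Im_le_cmod[of "f (?l t)"] by simp
      also have "\<dots> \<le> 4 * D / (1 + t) ^ 2"
      proof (cases "t \<le> 1")
        case True
        have "(1 + t) ^ 2 \<le> 2 ^ 2" using True t by (intro power_mono) auto
        then have "D * (1 + t) ^ 2 \<le> 4 * D" using D by (simp add: mult_left_mono mult.commute)
        then have "D \<le> 4 * D / (1 + t) ^ 2" using t by (simp add: pos_le_divide_eq)
        with b2[OF t] show ?thesis by linarith
      next
        case False
        have "(1 + t) ^ 2 \<le> (2 * t) ^ 2" using False t by (intro power_mono) auto
        then have "D * (1 + t) ^ 2 \<le> D * (4 * t ^ 2)" using D by (intro mult_left_mono) (auto simp: power_mult_distrib)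
        then have "D / t ^ 2 \<le> 4 * D / (1 + t) ^ 2" using t by (simp add: field_simps)
        with b1[of "?l t"] t show ?thesis by simp
      qed
      finally show ?thesis using D by simp
    qed
    then show "AE t in lborel. t \<in> {0<..} \<longrightarrow> norm (?g t) \<le> norm (4 * D * (1 / (1 + t) ^ 2))"
      by (intro AE_I2) auto
  qed
  have "(LBINT t=0..\<infinity>. ?g t) = 0 - Re \<kappa>"
  proof (rule interval_integral_FTC_integrable)
    fix t :: real assume "0 < ereal t"
    then have t: "t > 0" by simp
    have "((\<lambda>t. F (?l t)) has_vector_derivative f (?l t) * \<i>) (at t)"
    proof -
      have "(?l has_vector_derivative \<i>) (at t)"
        by (auto intro!: derivative_eq_intros simp: has_vector_derivative_def scaleR_conv_of_real)
      from field_vector_diff_chain_at[OF this F] t show ?thesis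
        by (simp add: o_def mult.commute)
    qed
    then show "((\<lambda>t. Re (F (?l t))) has_vector_derivative ?g t) (at t)"
      by (auto simp: has_vector_derivative_complex_iff has_real_derivative_iff_has_vector_derivative)
    show "isCont ?g t"
      using cont t by (simp add: continuous_on_eq_continuous_at)
  next
    show "set_integrable lborel (einterval 0 \<infinity>) ?g" using int by (simp add: zero_ereal_def)
    show "(((\<lambda>t. Re (F (?l t))) \<circ> real_of_ereal) \<longlongrightarrow> Re \<kappa>) (at_right 0)"
      unfolding zero_ereal_def ereal_tendsto_simps by (intro tendsto_intros lim0)
    have "((\<lambda>t. Re (F (?l t))) \<longlongrightarrow> Re 0) at_top" by (intro tendsto_intros lim1)
    then show "(((\<lambda>t. Re (F (?l t))) \<circ> real_of_ereal) \<longlongrightarrow> 0) (at_left \<infinity>)"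
      unfolding ereal_tendsto_simps by simp
  qed auto
  then have "(LINT t:{0<..}|lborel. ?g t) = - Re \<kappa>"
    by (simp add: interval_lebesgue_integral_0_infty)
  then have "integral {0<..} ?g = - Re \<kappa>"
    using set_borel_integral_eq_integral(2)[OF int] by simp
  then show ?thesis by (simp add: modsym_def)
qed

section \<open>Fourier coefficients\<close>

lemma e_Suc_mult: "e (of_nat (Suc n) * z) = e z * e z ^ n"
  by (simp add: e_def exp_of_nat_mult [symmetric] exp_add [symmetric] algebra_simps)

text \<open>After removal of one factor \<open>e z\<close> the expansion is a power series in
  \<open>e z\<close>; convergence at height \<open>y / 2\<close> forces absolute convergence at
  height \<open>y\<close>.\<close>

lemma fourier_norm_summable:
  assumes f: "\<And>z. Im z > 0 \<Longrightarrow> (\<lambda>n. A n * e (of_nat (Suc n) * z)) sums f z" and y: "y > 0"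
  shows "summable (\<lambda>n. norm (A n) * exp (- 2 * pi * real (Suc n) * y))"
proof -
  define z where "z = \<i> * complex_of_real (y / 2)"
  define z' where "z' = \<i> * complex_of_real y"
  have "summable (\<lambda>n. A n * e (of_nat (Suc n) * z))"
    using f[of z] y by (auto simp: z_def sums_iff)
  then have "summable (\<lambda>n. inverse (e z) * (A n * e (of_nat (Suc n) * z)))"
    by (rule summable_mult)
  moreover have "e z \<noteq> 0" by (simp add: e_def)
  then have "inverse (e z) * (A n * e (of_nat (Suc n) * z)) = A n * e z ^ n" for n
    unfolding e_Suc_mult by (simp add: field_simps)
  ultimately have "summable (\<lambda>n. A n * e z ^ n)"
    by (simp only:)
  then have "summable (\<lambda>n. norm (A n * e z' ^ n))"
    by (rule powser_insidea) (use y in \<open>simp add: norm_e z_def z'_def\<close>)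
  then have "summable (\<lambda>n. norm (e z') * norm (A n * e z' ^ n))"
    by (rule summable_mult)
  moreover have "norm (e z') * norm (A n * e z' ^ n) = norm (A n) * exp (- 2 * pi * real (Suc n) * y)" for n
    by (simp add: norm_mult norm_power norm_e z'_def exp_of_nat_mult [symmetric] exp_add [symmetric] algebra_simps)
  ultimately show ?thesis by simp
qed

text \<open>Sampling at the multiples of \<open>1 / (N + 1)\<close> is enough: the frequencies
  \<open>0..N\<close> are distinct modulo \<open>N + 1\<close>, so the discrete Parseval identity is
  exact. Frequency 0 receives coefficient 0.\<close>

lemma trigonometric_bessel:
  fixes b :: "nat \<Rightarrow> complex"
  assumes B: "\<And>u::real. norm (\<Sum>m<N. b m * e (of_nat (Suc m) * of_real u)) \<le> B"
  shows "(\<Sum>m<N. norm (b m) ^ 2) \<le> B ^ 2"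
proof -
  define c where "c = int (Suc N)"
  have c: "c > 0" by (simp add: c_def)
  define \<phi> where "\<phi> = (\<lambda>k::int. if k \<ge> 1 then b (nat (k - 1)) else 0)"
  have reindex: "(\<Sum>k\<in>{0..<c}. G k) = G 0 + (\<Sum>m<N. G (int (Suc m)))" for G :: "int \<Rightarrow> 'a :: comm_monoid_add"
  proof -
    have "(\<Sum>k\<in>{0..<c}. G k) = (\<Sum>i<Suc N. G (int i))"
      using c by (subst sum_int_interval_eq_nat) (simp_all only: c_def nat_int less_imp_le)
    also have "\<dots> = G 0 + (\<Sum>m<N. G (int (Suc m)))"
      by (simp only: sum.lessThan_Suc_shift of_nat_0)
    finally show ?thesis .
  qed
  have "of_int c * (\<Sum>m<N. norm (b m) ^ 2) = of_int c * (\<Sum>k\<in>{0..<c}. norm (\<phi> k) ^ 2)"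
    by (simp add: reindex \<phi>_def)
  also have "\<dots> = (\<Sum>n\<in>{0..<c}. norm (\<Sum>k\<in>{0..<c}. \<phi> k * ec c (- (n * k))) ^ 2)"
    by (rule ec_parseval[OF c, symmetric])
  also have "\<dots> \<le> (\<Sum>n\<in>{0..<c}. B ^ 2)"
  proof (intro sum_mono power_mono)
    fix n
    have "(\<Sum>k\<in>{0..<c}. \<phi> k * ec c (- (n * k))) = (\<Sum>m<N. b m * e (of_nat (Suc m) * of_real (- of_int n / of_int c)))"
      by (subst reindex) (auto simp: \<phi>_def ec_def mult_ac intro!: sum.cong)
    with B[of "- of_int n / of_int c"] show "norm (\<Sum>k\<in>{0..<c}. \<phi> k * ec c (- (n * k))) \<le> B"
      by (simp only:)
  qed auto
  also have "\<dots> = of_int c * B ^ 2" using c by simp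
  finally show ?thesis using c by simp
qed

text \<open>Bessel's inequality on the line \<open>Im z = y\<close>, where
  \<open>norm (f z) \<le> C / y\<close>. It is applied to the truncation at \<open>M\<close>, whose
  tail \<open>t M\<close> is an error that tends to 0.\<close>

lemma fourier_coeff_square_sum:
  assumes f: "\<And>z. Im z > 0 \<Longrightarrow> (\<lambda>n. A n * e (of_nat (Suc n) * z)) sums f z" and y: "y > 0"
    and C: "\<And>z. Im z > 0 \<Longrightarrow> norm (f z) * Im z \<le> C"
  shows "(\<Sum>n<N. norm (A n) ^ 2 * exp (- 4 * pi * real (Suc n) * y)) \<le> (C / y) ^ 2"
proof -
  define b where "b = (\<lambda>n. A n * of_real (exp (- 2 * pi * real (Suc n) * y)))"
  define t where "t = (\<lambda>M. \<Sum>n. norm (b (n + M)))"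
  have C0: "C \<ge> 0" using C[of \<i>] norm_ge_zero[of "f \<i>"] by (simp del: norm_ge_zero)
  have sumb: "summable (\<lambda>n. norm (b n))"
    using fourier_norm_summable[OF f y] by (simp add: b_def norm_mult)
  have eb: "A n * e (of_nat (Suc n) * (of_real u + \<i> * of_real y)) = b n * e (of_nat (Suc n) * of_real u)" for n u
    by (simp add: b_def e_def exp_of_real [symmetric] exp_add [symmetric] algebra_simps)
  have bessel: "(\<Sum>m<M. norm (b m) ^ 2) \<le> (C / y + t M) ^ 2" for M
  proof (rule trigonometric_bessel)
    fix u :: real
    let ?z = "of_real u + \<i> * of_real y :: complex"
    let ?s = "\<lambda>n. b n * e (of_nat (Suc n) * of_real u)"
    have ne: "norm (?s n) = norm (b n)" for n
      by (simp add: norm_mult norm_e)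
    have s: "?s sums f ?z" using f[of ?z] y unfolding eb by simp
    have summ: "summable (\<lambda>n. norm (?s n))" using sumb by (simp only: ne)
    have "f ?z = (\<Sum>n. ?s (n + M)) + (\<Sum>m<M. ?s m)"
      using suminf_split_initial_segment[OF sums_summable[OF s], of M] s by (simp add: sums_iff)
    then have "(\<Sum>m<M. ?s m) = f ?z - (\<Sum>n. ?s (n + M))" by simp
    also have "norm \<dots> \<le> norm (f ?z) + norm (\<Sum>n. ?s (n + M))" by (rule norm_triangle_ineq4)
    also have "\<dots> \<le> C / y + t M"
    proof (rule add_mono)
      show "norm (f ?z) \<le> C / y" using C[of ?z] y by (simp add: pos_le_divide_eq)
      have "norm (\<Sum>n. ?s (n + M)) \<le> (\<Sum>n. norm (?s (n + M)))"
        using summ summable_iff_shift[of "\<lambda>n. norm (?s n)" M] by (intro summable_norm) simp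
      then show "norm (\<Sum>n. ?s (n + M)) \<le> t M" by (simp only: ne t_def)
    qed
    finally show "norm (\<Sum>m<M. ?s m) \<le> C / y + t M" .
  qed
  have "t \<longlonglongrightarrow> 0"
    unfolding t_def using suminf_exist_split2[OF sumb] by simp
  then have "(\<lambda>M. (C / y + t M) ^ 2) \<longlonglongrightarrow> (C / y + 0) ^ 2"
    by (intro tendsto_intros)
  moreover have "eventually (\<lambda>M. (\<Sum>n<N. norm (b n) ^ 2) \<le> (C / y + t M) ^ 2) sequentially"
    using eventually_ge_at_top[of N]
  proof eventually_elim
    case (elim M)
    have "(\<Sum>n<N. norm (b n) ^ 2) \<le> (\<Sum>n<M. norm (b n) ^ 2)"
      using elim by (intro sum_mono2) auto
    with bessel[of M] show ?case by linarith
  qed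
  ultimately have "(\<Sum>n<N. norm (b n) ^ 2) \<le> (C / y + 0) ^ 2"
    by (rule tendsto_lowerbound) simp
  moreover have "norm (b n) ^ 2 = norm (A n) ^ 2 * exp (- 4 * pi * real (Suc n) * y)" for n
    by (simp add: b_def norm_mult power_mult_distrib exp_double [symmetric] del: of_nat_Suc)
  ultimately show ?thesis by simp
qed

section \<open>Convergence of coefficient series\<close>

text \<open>In place of partial summation, \<open>fourier_coeff_square_sum\<close> is averaged over
  the heights \<open>1 / Suc k\<close>. The weight at \<open>n\<close> is dominated by a sum of
  \<open>k powr (- 3 - \<delta>)\<close> times the exponential over the dyadic block from
  \<open>n\<close> to \<open>2 n\<close>. After the swap each height contributes
  \<open>(C k)^2\<close>, which leaves the convergent series of
  \<open>k powr (- 1 - \<delta>)\<close>.\<close>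

lemma fourier_coeff_square_summable:
  assumes f: "\<And>z. Im z > 0 \<Longrightarrow> (\<lambda>n. A n * e (of_nat (Suc n) * z)) sums f z"
    and C: "\<And>z. Im z > 0 \<Longrightarrow> norm (f z) * Im z \<le> C" and d: "\<delta> > 0" "\<delta> \<le> 1"
  shows "summable (\<lambda>n. norm (A n) ^ 2 * real (Suc n) powr (- 2 - \<delta>))"
proof -
  \<comment> \<open>On the dyadic block the power loses at most
    \<open>2 powr (3 + \<delta>) \<le> 16\<close>, and the exponential at most
    \<open>exp (4 * pi)\<close>.\<close>
  define K where "K = 16 * exp (4 * pi)"
  define S where "S = (\<Sum>k. real (Suc k) powr (- 1 - \<delta>))"
  have sumS: "summable (\<lambda>k. real (Suc k) powr (- 1 - \<delta>))"
    using d by (subst summable_Suc_iff) (simp add: summable_real_powr_iff)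
  have key: "real (Suc n) powr (- 2 - \<delta>) \<le> K * (\<Sum>k\<in>{n..<2 * n + 1}. real (Suc k) powr (- 3 - \<delta>) * exp (- 4 * pi * real (Suc n) * (1 / real (Suc k))))" for n
  proof -
    define \<nu> where "\<nu> = real (Suc n)"
    have nu: "\<nu> > 0" by (simp add: \<nu>_def)
    have "(\<Sum>k\<in>{n..<2 * n + 1}. (2 * \<nu>) powr (- 3 - \<delta>) * exp (- 4 * pi)) \<le> (\<Sum>k\<in>{n..<2 * n + 1}. real (Suc k) powr (- 3 - \<delta>) * exp (- 4 * pi * \<nu> * (1 / real (Suc k))))"
    proof (intro sum_mono mult_mono)
      fix k assume k: "k \<in> {n..<2 * n + 1}"
      show "(2 * \<nu>) powr (- 3 - \<delta>) \<le> real (Suc k) powr (- 3 - \<delta>)"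
        using k d by (intro powr_mono2') (auto simp: \<nu>_def)
      have "\<nu> / real (Suc k) \<le> 1" using k by (simp add: \<nu>_def)
      then have "4 * pi * (\<nu> / real (Suc k)) \<le> 4 * pi * 1" by (intro mult_left_mono) auto
      then show "exp (- 4 * pi) \<le> exp (- 4 * pi * \<nu> * (1 / real (Suc k)))" by simp
    qed auto
    moreover have "(\<Sum>k\<in>{n..<2 * n + 1}. (2 * \<nu>) powr (- 3 - \<delta>) * exp (- 4 * pi)) = \<nu> * ((2 * \<nu>) powr (- 3 - \<delta>) * exp (- 4 * pi))"
      by (simp add: \<nu>_def)
    moreover have "\<nu> powr (- 2 - \<delta>) \<le> K * (\<nu> * ((2 * \<nu>) powr (- 3 - \<delta>) * exp (- 4 * pi)))"
    proof -
      have "\<nu> powr (- 2 - \<delta>) = \<nu> * \<nu> powr (- 3 - \<delta>)"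
        using nu powr_add[of \<nu> 1 "- 3 - \<delta>"] by simp
      moreover have "16 * 2 powr (- 3 - \<delta>) \<ge> (1::real)"
      proof -
        have "(2::real) powr (- 4) \<le> 2 powr (- 3 - \<delta>)" using d by (intro powr_mono) auto
        moreover have "(2::real) powr (- 4) = 1 / 16" by (subst powr_minus) simp
        ultimately show ?thesis by simp
      qed
      then have "\<nu> * \<nu> powr (- 3 - \<delta>) * 1 \<le> \<nu> * \<nu> powr (- 3 - \<delta>) * (16 * 2 powr (- 3 - \<delta>))"
        using nu by (intro mult_left_mono) auto
      moreover have "K * (\<nu> * ((2 * \<nu>) powr (- 3 - \<delta>) * exp (- 4 * pi))) = \<nu> * \<nu> powr (- 3 - \<delta>) * (16 * 2 powr (- 3 - \<delta>))"
        using nu by (simp add: K_def powr_mult exp_minus field_simps)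
      ultimately show ?thesis by (simp only: mult_1_right)
    qed
    ultimately show ?thesis
      unfolding \<nu>_def [symmetric] by (smt (verit) K_def exp_gt_zero mult_left_mono)
  qed
  show ?thesis
  proof (rule summableI_nonneg_bounded[of _ "K * (C ^ 2 * S)"])
    fix N
    have "(\<Sum>n<N. norm (A n) ^ 2 * real (Suc n) powr (- 2 - \<delta>))
        \<le> (\<Sum>n<N. norm (A n) ^ 2 * (K * (\<Sum>k\<in>{n..<2 * n + 1}. real (Suc k) powr (- 3 - \<delta>) * exp (- 4 * pi * real (Suc n) * (1 / real (Suc k))))))"
      by (intro sum_mono mult_left_mono key) auto
    also have "\<dots> \<le> (\<Sum>n<N. norm (A n) ^ 2 * (K * (\<Sum>k<2 * N. real (Suc k) powr (- 3 - \<delta>) * exp (- 4 * pi * real (Suc n) * (1 / real (Suc k))))))"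
      by (intro sum_mono mult_left_mono sum_mono2) (auto simp: K_def)
    also have "\<dots> = K * (\<Sum>n<N. \<Sum>k<2 * N. real (Suc k) powr (- 3 - \<delta>) * (norm (A n) ^ 2 * exp (- 4 * pi * real (Suc n) * (1 / real (Suc k)))))"
      by (simp add: sum_distrib_left mult_ac)
    also have "(\<Sum>n<N. \<Sum>k<2 * N. real (Suc k) powr (- 3 - \<delta>) * (norm (A n) ^ 2 * exp (- 4 * pi * real (Suc n) * (1 / real (Suc k)))))
       = (\<Sum>k<2 * N. real (Suc k) powr (- 3 - \<delta>) * (\<Sum>n<N. norm (A n) ^ 2 * exp (- 4 * pi * real (Suc n) * (1 / real (Suc k)))))"
      by (subst sum.swap) (simp add: sum_distrib_left)
    also have "\<dots> \<le> (\<Sum>k<2 * N. real (Suc k) powr (- 3 - \<delta>) * (C / (1 / real (Suc k))) ^ 2)"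
      by (intro sum_mono mult_left_mono fourier_coeff_square_sum[OF f _ C]) auto
    also have "\<dots> = (\<Sum>k<2 * N. C ^ 2 * real (Suc k) powr (- 1 - \<delta>))"
    proof (intro sum.cong refl)
      fix k
      have "real (Suc k) powr (- 1 - \<delta>) = real (Suc k) powr (- 3 - \<delta>) * real (Suc k) ^ 2"
        using powr_add[of "real (Suc k)" "- 3 - \<delta>" 2] by (simp del: of_nat_Suc)
      then show "real (Suc k) powr (- 3 - \<delta>) * (C / (1 / real (Suc k))) ^ 2 = C ^ 2 * real (Suc k) powr (- 1 - \<delta>)"
        by (simp add: power_mult_distrib del: of_nat_Suc)
    qed
    also have "\<dots> = C ^ 2 * (\<Sum>k<2 * N. real (Suc k) powr (- 1 - \<delta>))"
      by (rule sum_distrib_left [symmetric])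
    also have "\<dots> \<le> C ^ 2 * S"
      unfolding S_def by (intro mult_left_mono sum_le_suminf[OF sumS]) auto
    finally show "(\<Sum>n<N. norm (A n) ^ 2 * real (Suc n) powr (- 2 - \<delta>)) \<le> K * (C ^ 2 * S)"
      by (simp add: K_def)
  qed auto
qed

text \<open>The exponent splits as \<open>- 7/4 = (- 1 - \<delta>/2) + (- 3/4 + \<delta>/2)\<close>.
  The squares of both factors are summable, the second because
  \<open>- 3/2 + \<delta> < - 1\<close>.\<close>

lemma fourier_coeff_summable:
  assumes "summable (\<lambda>n. norm (A n) ^ 2 * real (Suc n) powr (- 2 - \<delta>))" and d: "\<delta> < 1/2"
  shows "summable (\<lambda>n. norm (A n) * real (Suc n) powr (- 7/4))"
proof (rule summable_comparison_test')
  have "summable (\<lambda>n. real (Suc n) powr (- 3/2 + \<delta>))"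
    using d by (subst summable_Suc_iff) (simp add: summable_real_powr_iff)
  with assms(1) show "summable (\<lambda>n. norm (A n) ^ 2 * real (Suc n) powr (- 2 - \<delta>) + real (Suc n) powr (- 3/2 + \<delta>))"
    by (rule summable_add)
  fix n :: nat
  define u where "u = norm (A n) * real (Suc n) powr (- 1 - \<delta>/2)"
  define v where "v = real (Suc n) powr (- 3/4 + \<delta>/2)"
  have "norm (A n) * real (Suc n) powr (- 7/4) = u * v"
    by (simp add: u_def v_def powr_add [symmetric] del: of_nat_Suc)
  also have "\<dots> \<le> u ^ 2 + v ^ 2"
  proof -
    have "0 \<le> u * v" by (simp add: u_def v_def)
    then show ?thesis using sum_squares_bound[of u v] by linarith
  qed
  also have "u ^ 2 = norm (A n) ^ 2 * real (Suc n) powr (- 2 - \<delta>)"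
    by (simp add: u_def power_mult_distrib powr_power algebra_simps del: of_nat_Suc)
  also have "v ^ 2 = real (Suc n) powr (- 3/2 + \<delta>)"
    by (simp add: v_def powr_power algebra_simps del: of_nat_Suc)
  finally show "norm (norm (A n) * real (Suc n) powr (- 7/4)) \<le> norm (A n) ^ 2 * real (Suc n) powr (- 2 - \<delta>) + real (Suc n) powr (- 3/2 + \<delta>)"
    by simp
qed

lemma exp_geometric_sums:
  assumes "y > 0"
  shows "summable (\<lambda>n. exp (- 2 * pi * real (Suc n) * y))" "(\<Sum>n. exp (- 2 * pi * real (Suc n) * y)) \<le> 1 / y"
proof -
  define r where "r = exp (- 2 * pi * y)"
  have r: "0 < r" "r < 1" using assms by (auto simp: r_def)
  have eq: "exp (- 2 * pi * real (Suc n) * y) = r * r ^ n" for n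
    by (simp add: r_def exp_of_nat_mult [symmetric] exp_add [symmetric] algebra_simps)
  have "(\<lambda>n. r * r ^ n) sums (r * (1 / (1 - r)))"
    using r by (intro sums_mult geometric_sums) auto
  then have s: "(\<lambda>n. exp (- 2 * pi * real (Suc n) * y)) sums (r / (1 - r))"
    unfolding eq by simp
  then show "summable (\<lambda>n. exp (- 2 * pi * real (Suc n) * y))" by (simp add: sums_iff)
  have "r * (1 + y) \<le> 1"
  proof -
    have "1 + y \<le> exp y" by (rule exp_ge_add_one_self)
    also have "\<dots> \<le> exp (2 * pi * y)"
      using assms pi_gt3 by (simp add: mult_le_cancel_right1)
    also have "\<dots> = 1 / r" by (simp add: r_def exp_minus divide_inverse)
    finally show ?thesis using r by (simp add: field_simps)
  qed
  then have "r / (1 - r) \<le> 1 / y" using r assms by (simp add: field_simps)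
  with s show "(\<Sum>n. exp (- 2 * pi * real (Suc n) * y)) \<le> 1 / y" by (simp add: sums_iff)
qed

text \<open>A weighted Cauchy-Schwarz argument against the mean square series. It says that at
  height \<open>y\<close> the divisor part of the quadrature error costs about
  \<open>y powr (- 1/2)\<close>, up to small exponents.\<close>

lemma fourier_coeff_weighted_bound:
  assumes S: "summable (\<lambda>n. norm (A n) ^ 2 * real (Suc n) powr (- 2 - \<delta>))"
    and d: "\<delta> > 0" "\<epsilon> > 0" "\<delta> + 2 * \<epsilon> \<le> 1" and y: "y > 0"
  shows "summable (\<lambda>n. norm (A n) * real (Suc n) powr (- 1 + \<epsilon>) * exp (- 2 * pi * real (Suc n) * y))"
    "(\<Sum>n. norm (A n) * real (Suc n) powr (- 1 + \<epsilon>) * exp (- 2 * pi * real (Suc n) * y))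
       \<le> ((\<Sum>n. norm (A n) ^ 2 * real (Suc n) powr (- 2 - \<delta>)) + 1) * y powr (- (1 + \<delta> + 2 * \<epsilon>) / 2)"
proof -
  define s where "s = \<delta> + 2 * \<epsilon>"
  \<comment> \<open>This choice balances the two parts:
    \<open>y powr (- s) / \<mu> * (1 / y)\<close> equals \<open>\<mu>\<close>.\<close>
  define \<mu> where "\<mu> = y powr (- (1 + s) / 2)"
  have lam: "\<mu> > 0" using y by (simp add: \<mu>_def)
  let ?t = "\<lambda>n. norm (A n) * real (Suc n) powr (- 1 + \<epsilon>) * exp (- 2 * pi * real (Suc n) * y)"
  let ?m = "\<lambda>n. \<mu> * (norm (A n) ^ 2 * real (Suc n) powr (- 2 - \<delta>)) + (y powr (- s) / \<mu>) * exp (- 2 * pi * real (Suc n) * y)"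
  have le: "?t n \<le> ?m n" for n
  proof -
    define \<nu> where "\<nu> = real (Suc n)"
    have nu: "\<nu> > 0" by (simp add: \<nu>_def)
    define u where "u = norm (A n) * \<nu> powr (- 1 - \<delta>/2)"
    define v where "v = \<nu> powr (s/2) * exp (- 2 * pi * \<nu> * y)"
    have "- 1 - \<delta>/2 + s/2 = - 1 + \<epsilon>" by (simp add: s_def field_simps)
    then have "\<nu> powr (- 1 + \<epsilon>) = \<nu> powr (- 1 - \<delta>/2) * \<nu> powr (s/2)"
      by (simp only: powr_add [symmetric])
    then have "?t n = u * v"
      unfolding \<nu>_def [symmetric] u_def v_def by (simp only: mult_ac)
    also have "\<dots> \<le> \<mu> * u ^ 2 + v ^ 2 / \<mu>"
    proof -
      have "0 \<le> (\<mu> * u - v) ^ 2 + \<mu> * u * v"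
        using lam by (auto simp: u_def v_def)
      then have "\<mu> * (u * v) \<le> \<mu> * (\<mu> * u ^ 2 + v ^ 2 / \<mu>)"
        using lam by (simp add: power2_eq_square algebra_simps)
      then show ?thesis using lam by (simp only: mult_le_cancel_left_pos)
    qed
    also have "u ^ 2 = norm (A n) ^ 2 * \<nu> powr (- 2 - \<delta>)"
      using nu by (simp add: u_def power_mult_distrib powr_power algebra_simps)
    also have "v ^ 2 \<le> y powr (- s) * exp (- 2 * pi * \<nu> * y)"
    proof -
      have "v ^ 2 = \<nu> powr s * (exp (- 2 * pi * \<nu> * y) * exp (- 2 * pi * \<nu> * y))"
        using nu powr_add[of \<nu> "s/2" "s/2"] by (simp add: v_def power2_eq_square mult_ac)
      \<comment> \<open>Half of the exponential decay pays for the power: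
        \<open>(\<nu> * y) powr s\<close> is at most
        \<open>exp (2 * pi * \<nu> * y)\<close>.\<close>
      also have "\<nu> powr s * (exp (- 2 * pi * \<nu> * y) * exp (- 2 * pi * \<nu> * y)) \<le> y powr (- s) * exp (2 * pi * \<nu> * y) * (exp (- 2 * pi * \<nu> * y) * exp (- 2 * pi * \<nu> * y))"
      proof (intro mult_right_mono)
        have "\<nu> * y \<le> exp (\<nu> * y)"
          using exp_ge_add_one_self[of "\<nu> * y"] by linarith
        then have "(\<nu> * y) powr s \<le> exp (\<nu> * y) powr s"
          using nu y d by (intro powr_mono2) (auto simp: s_def)
        also have "\<dots> = exp (s * (\<nu> * y))" by (simp add: powr_def)
        also have "\<dots> \<le> exp (2 * pi * (\<nu> * y))"
          using nu y d pi_gt3 by (intro exp_mono mult_right_mono) (auto simp: s_def)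
        finally have "\<nu> powr s * y powr s \<le> exp (2 * pi * \<nu> * y)" using nu y by (simp add: powr_mult mult_ac)
        then show "\<nu> powr s \<le> y powr (- s) * exp (2 * pi * \<nu> * y)"
          using y by (simp add: powr_minus field_simps)
      qed auto
      also have "\<dots> = y powr (- s) * exp (- 2 * pi * \<nu> * y)"
        by (simp add: exp_add [symmetric])
      finally show ?thesis .
    qed
    finally show ?thesis
      using lam unfolding \<nu>_def by (simp add: divide_right_mono)
  qed
  have sumE: "summable (\<lambda>n. exp (- 2 * pi * real (Suc n) * y))" by (rule exp_geometric_sums[OF y])
  have sumM: "summable ?m"
    by (intro summable_add summable_mult S sumE)
  show summ: "summable ?t"
    by (rule summable_comparison_test'[OF sumM]) (use le in auto)
  have "(\<Sum>n. ?t n) \<le> (\<Sum>n. ?m n)"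
    by (intro suminf_le le summ sumM)
  also have "\<dots> = \<mu> * (\<Sum>n. norm (A n) ^ 2 * real (Suc n) powr (- 2 - \<delta>)) + y powr (- s) / \<mu> * (\<Sum>n. exp (- 2 * pi * real (Suc n) * y))"
    by (subst suminf_add [symmetric]) (intro summable_mult S sumE | simp only: suminf_mult S sumE)+
  also have "\<dots> \<le> \<mu> * (\<Sum>n. norm (A n) ^ 2 * real (Suc n) powr (- 2 - \<delta>)) + y powr (- s) / \<mu> * (1 / y)"
    using lam by (intro add_left_mono mult_left_mono exp_geometric_sums y) auto
  also have "y powr (- s) / \<mu> * (1 / y) = \<mu>"
  proof -
    have "- (1 + s) / 2 + - (1 + s) / 2 = - s + - 1" by (simp add: field_simps)
    then have "\<mu> * \<mu> = y powr (- s) * y powr (- 1)"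
      by (simp only: \<mu>_def powr_add [symmetric])
    then show ?thesis using lam y by (simp add: powr_minus field_simps)
  qed
  finally show "(\<Sum>n. ?t n) \<le> ((\<Sum>n. norm (A n) ^ 2 * real (Suc n) powr (- 2 - \<delta>)) + 1) * y powr (- (1 + \<delta> + 2 * \<epsilon>) / 2)"
    by (simp add: \<mu>_def s_def algebra_simps)
qed

text \<open>As a power series in \<open>e z\<close> the expansion may be integrated term by term.
  The result has the same derivative as \<open>F\<close>, and both tend to 0 up the imaginary axis,
  so they agree.\<close>

lemma primitive_fourier_sums:
  assumes f: "\<And>z. Im z > 0 \<Longrightarrow> (\<lambda>n. A n * e (of_nat (Suc n) * z)) sums f z"
    and F: "\<And>z. Im z > 0 \<Longrightarrow> (F has_field_derivative f z) (at z)"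
    and lim: "((\<lambda>y. F (\<i> * of_real y)) \<longlongrightarrow> 0) at_top"
    and z: "Im z > 0"
  shows "(\<lambda>n. A n / (2 * of_real pi * \<i> * of_nat (Suc n)) * e (of_nat (Suc n) * z)) sums F z"
proof -
  define c where "c = (\<lambda>m. if m = 0 then 0 else A (m - 1) / (2 * of_real pi * \<i> * of_nat m))"
  define p where "p = (\<lambda>w. \<Sum>m. c m * w ^ m)"
  have summ: "summable (\<lambda>m. c m * e u ^ m)" if u: "Im u > 0" for u
  proof -
    have "summable (\<lambda>n. c (Suc n) * e u ^ Suc n)"
    proof (rule summable_comparison_test'[OF fourier_norm_summable[OF f u]])
      fix n
      have "norm (c (Suc n)) \<le> norm (A n)"
      proof -
        have "norm (c (Suc n)) = norm (A n) / (2 * pi * real (Suc n))"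
          by (simp add: c_def norm_divide norm_mult del: of_nat_Suc)
        also have "\<dots> \<le> norm (A n) / 1"
        proof (intro divide_left_mono)
          have "1 * 1 \<le> (2 * pi) * real (Suc n)" using pi_gt3 by (intro mult_mono) auto
          then show "1 \<le> 2 * pi * real (Suc n)" by simp
        qed auto
        finally show ?thesis by simp
      qed
      moreover have "norm (e u ^ Suc n) = exp (- 2 * pi * real (Suc n) * Im u)"
        by (simp add: norm_mult norm_power norm_e exp_of_nat_mult [symmetric] exp_add [symmetric] algebra_simps)
      ultimately show "norm (c (Suc n) * e u ^ Suc n) \<le> norm (A n) * exp (- 2 * pi * real (Suc n) * Im u)"
        unfolding norm_mult by (simp add: mult_right_mono)
    qed
    then show ?thesis by (subst (asm) summable_Suc_iff)
  qed
  have dp: "(p has_field_derivative (\<Sum>n. diffs c n * w ^ n)) (at w)" if "norm w < norm (e u)" "Im u > 0" for w u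
    unfolding p_def by (rule termdiffs_strong[OF summ[OF that(2)] that(1)])
  have P: "((\<lambda>z. p (e z)) has_field_derivative f z) (at z)" if z: "Im z > 0" for z
  proof -
    have "norm (e z) < norm (e (\<i> * of_real (Im z / 2)))" using z by (simp add: norm_e)
    then have "(p has_field_derivative (\<Sum>n. diffs c n * e z ^ n)) (at (e z))"
      by (rule dp) (use z in auto)
    moreover have "(e has_field_derivative (e z * (2 * of_real pi * \<i>))) (at z)"
      unfolding e_def [abs_def] by (auto intro!: derivative_eq_intros)
    ultimately have "((\<lambda>z. p (e z)) has_field_derivative (\<Sum>n. diffs c n * e z ^ n) * (e z * (2 * of_real pi * \<i>))) (at z)"
      by (rule DERIV_chain2)
    also have "(\<Sum>n. diffs c n * e z ^ n) * (e z * (2 * of_real pi * \<i>)) = f z"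
    proof -
      have d: "diffs c n = A n / (2 * of_real pi * \<i>)" for n
        by (simp add: diffs_def c_def del: of_nat_Suc)
      have "(\<lambda>n. A n * e (of_nat (Suc n) * z) / (e z * (2 * of_real pi * \<i>))) sums (f z / (e z * (2 * of_real pi * \<i>)))"
        by (intro sums_divide f z)
      moreover have "A n * e (of_nat (Suc n) * z) / (e z * (2 * of_real pi * \<i>)) = diffs c n * e z ^ n" for n
        unfolding d e_Suc_mult by (simp add: e_def)
      ultimately have "(\<Sum>n. diffs c n * e z ^ n) = f z / (e z * (2 * of_real pi * \<i>))"
        by (simp add: sums_iff)
      then show ?thesis by (simp add: e_def)
    qed
    finally show ?thesis .
  qed
  have "((\<lambda>z. F z - p (e z)) has_field_derivative 0) (at z)" if "Im z > 0" for z
    using DERIV_diff[OF F[OF that] P[OF that]] by simp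
  then obtain k where k: "\<And>z. Im z > 0 \<Longrightarrow> F z - p (e z) = k"
    using uhp_deriv_zero_constant[of "\<lambda>z. F z - p (e z)"] by blast
  have "k = 0"
  proof -
    have "isCont p 0"
      by (rule DERIV_isCont, rule dp[of _ \<i>]) (auto simp: norm_e)
    moreover have "p 0 = 0" by (simp add: p_def c_def)
    moreover have "((\<lambda>y::real. e (\<i> * of_real y)) \<longlongrightarrow> 0) at_top"
    proof (rule tendsto_norm_zero_cancel)
      have "norm (e (\<i> * of_real y)) = exp (- 2 * pi * y)" for y :: real by (simp add: norm_e)
      moreover have "((\<lambda>y::real. exp (- 2 * pi * y)) \<longlongrightarrow> 0) at_top"
        using pi_gt_zero by real_asymp
      ultimately show "((\<lambda>y::real. norm (e (\<i> * of_real y))) \<longlongrightarrow> 0) at_top" by simp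
    qed
    ultimately have "((\<lambda>y::real. p (e (\<i> * of_real y))) \<longlongrightarrow> 0) at_top"
      using isCont_tendsto_compose[of 0 p] by metis
    then have "((\<lambda>y::real. F (\<i> * of_real y) - p (e (\<i> * of_real y))) \<longlongrightarrow> 0 - 0) at_top"
      by (intro tendsto_diff lim)
    moreover have "eventually (\<lambda>y::real. F (\<i> * of_real y) - p (e (\<i> * of_real y)) = k) at_top"
      using eventually_gt_at_top[of 0] by eventually_elim (auto intro!: k)
    ultimately have "((\<lambda>y::real. k) \<longlongrightarrow> 0 - 0) at_top"
      by (rule Lim_transform_eventually)
    then show ?thesis by (simp add: tendsto_const_iff)
  qed
  then have "F z = p (e z)" using k[OF z] by simp
  moreover have "(\<lambda>m. c m * e z ^ m) sums p (e z)"
    unfolding p_def using summ[OF z] by (rule summable_sums)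
  ultimately have "(\<lambda>n. c (Suc n) * e z ^ Suc n) sums F z"
    by (subst sums_Suc_iff) (simp add: c_def)
  then show ?thesis by (simp add: c_def e_Suc_mult del: of_nat_Suc)
qed

section \<open>Quadrature errors of exponentials\<close>

lemma nat_le_mult_set_eq:
  assumes "0 \<le> x" "x \<le> 1" "c > 0"
  obtains N where "{a::nat. real a \<le> real c * x} = {..<N}" "N \<le> c + 1"
    "real c * x < real N" "real N \<le> real c * x + 1"
proof
  \<comment> \<open>The extra 1 counts \<open>a = 0\<close>. At \<open>x = 1\<close> the endpoint
    \<open>a = c\<close> belongs to the set, so \<open>N\<close> can reach
    \<open>c + 1\<close>.\<close>
  define N where "N = nat \<lfloor>real c * x\<rfloor> + 1"
  have nn: "real c * x \<ge> 0" using assms by simp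
  have "real c * x \<le> real c * 1" using assms by (intro mult_left_mono) auto
  show "{a::nat. real a \<le> real c * x} = {..<N}"
    using nn by (auto simp: N_def less_Suc_eq_le le_nat_floor le_nat_iff le_floor_iff)
  show r: "real c * x < real N" "real N \<le> real c * x + 1" using nn unfolding N_def by linarith+
  with \<open>real c * x \<le> real c * 1\<close> have "real N \<le> real (c + 1)" by simp
  then show "N \<le> c + 1" by (simp only: of_nat_le_iff)
qed

text \<open>The subtracted term is the integral of \<open>e (n u)\<close> over
  \<open>{0..x}\<close>, so this is the error of the Riemann sum with nodes
  \<open>a / c\<close>.\<close>

definition quad_err :: "nat \<Rightarrow> nat \<Rightarrow> real \<Rightarrow> complex" where
  "quad_err c n x = (\<Sum>a\<in>{a::nat. real a \<le> real c * x}. e (of_nat n * of_real (real a / real c))) / of_nat c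
     - (e (of_nat n * of_real x) - 1) / (2 * of_real pi * \<i> * of_nat n)"

lemma e_eq_ec: "e (of_nat n * of_real (real a / real c)) = ec (int c) (int a * int n)"
  by (simp add: ec_def mult_ac)

lemma norm_primitive_term_le:
  assumes "n > 0"
  shows "norm ((e (of_nat n * of_real x) - 1) / (2 * of_real pi * \<i> * of_nat n)) \<le> 1 / (2 * real n)"
proof -
  have "norm (e (of_nat n * of_real x) - 1) \<le> norm (e (of_nat n * of_real x)) + norm (1::complex)"
    by (rule norm_triangle_ineq4)
  then have "norm (e (of_nat n * of_real x) - 1) \<le> 2" by (simp add: norm_e)
  then have "norm ((e (of_nat n * of_real x) - 1) / (2 * of_real pi * \<i> * of_nat n)) \<le> 2 / (2 * pi * real n)"
    unfolding norm_divide using assms by (intro frac_le) (auto simp: norm_mult)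
  also have "\<dots> \<le> 2 / (4 * real n)"
    using assms pi_gt3 by (intro divide_left_mono) auto
  finally show ?thesis by simp
qed

text \<open>The geometric sum gives \<open>1 / (2 zdist)\<close> unless \<open>c\<close> divides
  \<open>n\<close>, where the trivial bound 2 remains. The shift by 1 in the denominator merges both
  cases.\<close>

lemma quad_err_bound:
  assumes x: "0 \<le> x" "x \<le> 1" and c: "c > 0" and n: "n > 0"
  shows "norm (quad_err c n x) \<le> 1 / real n + 2 / (of_int (zdist (int c) (int n)) + 1)"
proof -
  let ?z = "zdist (int c) (int n)"
  obtain N where N: "{a::nat. real a \<le> real c * x} = {..<N}" "N \<le> c + 1"
    using nat_le_mult_set_eq[OF x c] by blast
  have "norm ((\<Sum>a<N. ec (int c) (int a * int n)) / of_nat c) \<le> 2 / (of_int ?z + 1)"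
  proof (cases "int c dvd int n")
    case True
    have "norm (\<Sum>a<N. ec (int c) (int a * int n)) \<le> (\<Sum>a<N. 1)"
      by (rule sum_norm_le) simp
    also have "\<dots> \<le> 2 * real c" using N(2) c by simp
    finally have "norm ((\<Sum>a<N. ec (int c) (int a * int n)) / of_nat c) \<le> 2"
      using c by (simp add: norm_divide divide_le_eq)
    moreover have "?z = 0" using True by (simp add: zdist_def)
    ultimately show ?thesis by simp
  next
    case False
    then have z: "?z \<ge> 1" using zdist_pos[of "int c" "int n"] c by simp
    have "norm (\<Sum>a<N. ec (int c) (int a * int n)) \<le> of_int (int c) / (2 * of_int ?z)"
      using c False by (intro norm_geometric_ec_le) auto
    then have "norm ((\<Sum>a<N. ec (int c) (int a * int n)) / of_nat c) \<le> 1 / (2 * of_int ?z)"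
      using c z by (simp add: norm_divide field_simps)
    also have "\<dots> \<le> 2 / (of_int ?z + 1)"
      using z by (simp add: field_simps)
    finally show ?thesis .
  qed
  moreover have "norm ((e (of_nat n * of_real x) - 1) / (2 * of_real pi * \<i> * of_nat n)) \<le> 1 / real n"
    using norm_primitive_term_le[OF n, of x] n by (auto elim!: order_trans simp: field_simps)
  ultimately show ?thesis
    unfolding quad_err_def N(1) e_eq_ec
    using norm_triangle_ineq4[of "(\<Sum>a<N. ec (int c) (int a * int n)) / of_nat c" "(e (of_nat n * of_real x) - 1) / (2 * of_real pi * \<i> * of_nat n)"]
    by linarith
qed

lemma quad_err_bound_large_c:
  assumes x: "0 \<le> x" "x \<le> 1" and n: "n > 0" and c: "c \<ge> 2 * n"
  shows "norm (quad_err c n x) \<le> 1 / real n"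
proof -
  have c0: "c > 0" using c n by simp
  obtain N where N: "{a::nat. real a \<le> real c * x} = {..<N}" "N \<le> c + 1"
    using nat_le_mult_set_eq[OF x c0] by blast
  have z: "zdist (int c) (int n) = int n" using c n by (subst zdist_small) auto
  have "\<not> int c dvd int n" using c n by (auto dest: dvd_imp_le)
  then have "norm (\<Sum>a<N. ec (int c) (int a * int n)) \<le> of_int (int c) / (2 * of_int (zdist (int c) (int n)))"
    using c0 by (intro norm_geometric_ec_le) auto
  then have "norm ((\<Sum>a<N. ec (int c) (int a * int n)) / of_nat c) \<le> 1 / (2 * real n)"
    using c0 n by (simp add: z norm_divide field_simps)
  then show ?thesis
    unfolding quad_err_def N(1) e_eq_ec
    using norm_triangle_ineq4[of "(\<Sum>a<N. ec (int c) (int a * int n)) / of_nat c" "(e (of_nat n * of_real x) - 1) / (2 * of_real pi * \<i> * of_nat n)"]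
      norm_primitive_term_le[OF n, of x] by linarith
qed

text \<open>Taylor estimates at the nodes gain \<open>1 / c\<close> for fixed \<open>n\<close>. The
  bound through \<open>zdist\<close> cannot do so: for large \<open>c\<close> it stays at
  \<open>1 / n\<close>.\<close>

lemma quad_err_riemann_sum:
  assumes x: "0 \<le> x" "x \<le> 1" and c: "c > 0" and n: "n > 0"
  shows "norm (quad_err c n x) \<le> 14 * real n / real c"
proof -
  define k where "k = 2 * of_real pi * \<i> * (of_nat n :: complex)"
  have k: "k \<noteq> 0" using n by (simp add: k_def)
  define E where "E = (\<lambda>z. e (of_nat n * z))"
  define \<Psi> where "\<Psi> = (\<lambda>z. E z / k)"
  have dE: "(E has_field_derivative k * E z) (at z)" for z
    unfolding E_def e_def k_def by (auto intro!: derivative_eq_intros)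
  have dPsi: "(\<Psi> has_field_derivative E z) (at z)" for z
    unfolding \<Psi>_def using k by (auto intro!: derivative_eq_intros dE)
  have nE: "norm (E z) = 1" if "Im z = 0" for z
    using that by (simp add: E_def norm_e)
  have nk: "norm k = 2 * pi * real n" by (simp add: k_def norm_mult)
  obtain N where N: "{a::nat. real a \<le> real c * x} = {..<N}" "N \<le> c + 1"
    "real c * x < real N" "real N \<le> real c * x + 1"
    using nat_le_mult_set_eq[OF x c] by blast
  define s where "s = 1 / real c"
  have s: "s > 0" using c by (simp add: s_def)
  define u where "u = (\<lambda>a::nat. complex_of_real (real a * s))"
  have tel: "(\<Sum>a<N. \<Psi> (u (Suc a)) - \<Psi> (u a)) = \<Psi> (u N) - \<Psi> (u 0)"
    by (rule sum_lessThan_telescope)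
  have 1: "norm (\<Sum>a<N. (\<Psi> (u (Suc a)) - \<Psi> (u a)) - E (u a) * of_real s) \<le> (\<Sum>a<N. norm k * s ^ 2)"
  proof (rule sum_norm_le)
    fix a
    have eq: "u (Suc a) = u a + of_real s" by (simp add: u_def algebra_simps)
    show "norm ((\<Psi> (u (Suc a)) - \<Psi> (u a)) - E (u a) * of_real s) \<le> norm k * s ^ 2"
      unfolding eq using s by (intro horizontal_taylor[of 0 E "\<lambda>z. k * E z" \<Psi>] dE dPsi) (auto simp: u_def norm_mult nE)
  qed
  have 2: "norm (\<Psi> (u N) - \<Psi> (of_real x)) \<le> s"
  proof -
    have "norm (\<Psi> (u N) - \<Psi> (of_real x)) \<le> 1 * norm (u N - of_real x)"
      by (rule horizontal_lipschitz[of 0 \<Psi> E]) (auto intro!: dPsi simp: nE u_def)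
    also have "\<dots> = \<bar>real N * s - x\<bar>" unfolding u_def by (simp only: of_real_diff [symmetric] norm_of_real mult_1)
    also have "real N * s - x = (real N - real c * x) * s"
      using c by (simp add: s_def field_simps)
    also have "\<bar>(real N - real c * x) * s\<bar> = (real N - real c * x) * s"
      using N(3) s by (intro abs_of_nonneg mult_nonneg_nonneg) auto
    also have "\<dots> \<le> 1 * s"
      using N(4) s by (intro mult_right_mono) auto
    also have "1 * s = s" by simp
    finally show ?thesis .
  qed
  have "quad_err c n x = (\<Sum>a<N. E (u a)) * of_real s - (\<Psi> (of_real x) - \<Psi> (u 0))"
    unfolding quad_err_def N(1) by (simp add: E_def \<Psi>_def u_def s_def k_def diff_divide_distrib)
  also have "\<dots> = (\<Psi> (u N) - \<Psi> (of_real x)) - (\<Sum>a<N. (\<Psi> (u (Suc a)) - \<Psi> (u a)) - E (u a) * of_real s)"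
    by (simp only: sum_subtractf[of "\<lambda>a. \<Psi> (u (Suc a)) - \<Psi> (u a)"] tel sum_distrib_right [symmetric]) simp
  also have "norm \<dots> \<le> s + (\<Sum>a<N. norm k * s ^ 2)"
    using norm_triangle_ineq4 1 2 by (smt (verit))
  also have "\<dots> = s + real N * (2 * pi * real n * s ^ 2)" by (simp add: nk)
  \<comment> \<open>With \<open>N \<le> 2 c\<close> and \<open>2 * pi \<le> 6.5\<close> the two
    parts are \<open>n / c\<close> and \<open>13 n / c\<close>.\<close>
  also have "\<dots> \<le> s * real n + (2 * real c) * (6.5 * real n * s ^ 2)"
  proof (intro add_mono mult_mono)
    show "s \<le> s * real n" using s n by simp
    show "real N \<le> 2 * real c" using N(2) c by simp
    show "2 * pi \<le> 6.5" using pi_approx by simp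
  qed auto
  also have "\<dots> = 14 * real n / real c"
    using c by (simp add: s_def power2_eq_square field_simps)
  finally show ?thesis .
qed

section \<open>Averages of quadrature errors over the moduli\<close>

lemma sum_powr_le:
  assumes "0 \<le> \<theta>" "\<theta> \<le> 1" "M > 0"
  shows "(\<Sum>c=1..M. real c powr (- \<theta>)) \<le> real M powr (1 - \<theta>) * (1 + ln (real M))"
proof -
  have "(\<Sum>c=1..M. real c powr (- \<theta>)) \<le> (\<Sum>c=1..M. real M powr (1 - \<theta>) * (1 / real c))"
  proof (intro sum_mono)
    fix c assume c: "c \<in> {1..M}"
    have "real c powr (- \<theta>) = real c powr (1 - \<theta>) * (1 / real c)"
      using c powr_add[of "real c" "1 - \<theta>" "- 1"] by (simp add: powr_minus divide_inverse)
    also have "\<dots> \<le> real M powr (1 - \<theta>) * (1 / real c)"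
      using c assms by (intro mult_right_mono powr_mono2) auto
    finally show "real c powr (- \<theta>) \<le> real M powr (1 - \<theta>) * (1 / real c)" .
  qed
  also have "\<dots> = real M powr (1 - \<theta>) * harm M"
    by (simp add: harm_def sum_distrib_left divide_inverse)
  also have "\<dots> \<le> real M powr (1 - \<theta>) * (1 + ln (real M))"
    using assms by (intro mult_left_mono harm_le_ln) auto
  finally show ?thesis .
qed

text \<open>Group the moduli by the distance \<open>z\<close>: each such \<open>c\<close> divides
  \<open>n + z\<close> or \<open>n - z\<close>, so two divisor counts bound the group, and the
  weights \<open>2 / (z + 1)\<close> sum to a logarithm. The restriction \<open>c < 2 * n\<close>
  keeps \<open>n - z\<close> positive in the second case; for larger \<open>c\<close> one has
  \<open>z = n\<close>, and divisibility of 0 says nothing.\<close>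

lemma sum_inverse_zdist_moduli_le:
  assumes C: "\<And>n. n > 0 \<Longrightarrow> real (card {d. d dvd n}) \<le> C * real n powr \<epsilon>" "C \<ge> 0" "\<epsilon> \<ge> 0" "\<epsilon> \<le> 1"
    and n: "n > 0" and M: "M > 0"
  shows "(\<Sum>c\<in>{c\<in>{1..M}. c < 2 * n}. 2 / (of_int (zdist (int c) (int n)) + 1)) \<le> 8 * C * (1 + ln (real M + 1)) * (real n powr \<epsilon> * real M powr \<epsilon>)"
proof -
  define S where "S = {c\<in>{1..M}. c < 2 * n}"
  define \<zeta> where "\<zeta> = (\<lambda>c::nat. nat (zdist (int c) (int n)))"
  define B where "B = C * (2 * (real n * real M)) powr \<epsilon>"
  have finS: "finite S" by (simp add: S_def)
  have zr: "of_int (zdist (int c) (int n)) = real (\<zeta> c)" if "c \<in> S" for c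
    using that zdist_nonneg[of "int c" "int n"] by (simp add: \<zeta>_def S_def)
  have zM: "\<zeta> c \<in> {..<M + 1}" if "c \<in> S" for c
    using that pos_mod_bound[of "int c" "int n"] by (auto simp: \<zeta>_def zdist_def S_def nat_less_iff)
  have div: "c dvd n + \<zeta> c \<or> (\<zeta> c < n \<and> c dvd n - \<zeta> c)" if c: "c \<in> S" for c
  proof (cases "int n mod int c \<le> int c - int n mod int c")
    case True
    then have z: "\<zeta> c = n mod c" by (simp add: \<zeta>_def zdist_def nat_mod_as_int)
    have "c \<le> n"
    proof (rule ccontr)
      assume "\<not> c \<le> n"
      then have "n mod c = n" by simp
      with True have "2 * n \<le> c" by (simp flip: of_nat_mod)
      with c show False by (simp add: S_def)
    qed
    have "c > 0" using c by (simp add: S_def)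
    then have "n mod c < c" by simp
    with \<open>c \<le> n\<close> have "\<zeta> c < n" using z by simp
    moreover have "c dvd n - \<zeta> c" unfolding z by (rule dvd_minus_mod)
    ultimately show ?thesis by simp
  next
    case False
    have c0: "c > 0" using c by (simp add: S_def)
    then have "n mod c < c" by simp
    then have z: "\<zeta> c = c - n mod c" using False by (simp add: \<zeta>_def zdist_def flip: of_nat_mod of_nat_diff)
    have "n + \<zeta> c = c * (n div c) + c"
      using z \<open>n mod c < c\<close> mult_div_mod_eq[of c n] by linarith
    also have "\<dots> = c * (n div c + 1)" by simp
    finally have "c dvd n + \<zeta> c" by simp
    then show ?thesis by simp
  qed
  have count: "real (card {c\<in>S. \<zeta> c = z}) \<le> 2 * B" if z: "z \<in> {..<M + 1}" for z
  proof -
    let ?D1 = "{d. d dvd n + z}" and ?D2 = "if z < n then {d. d dvd n - z} else {}"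
    have fin: "finite ?D1" "finite ?D2" using n by auto
    have dB: "real (card {d. d dvd k}) \<le> B" if "k > 0" "k \<le> n + z" for k
    proof -
      have "real (card {d. d dvd k}) \<le> C * real k powr \<epsilon>" by (rule C(1)[OF that(1)])
      also have "\<dots> \<le> B"
        unfolding B_def
      proof (intro mult_left_mono powr_mono2 C)
        have "k \<le> n + M" using that z by simp
        also have "\<dots> \<le> 2 * (n * M)"
          using n M by (cases n; cases M) auto
        finally show "real k \<le> 2 * (real n * real M)"
          by (metis of_nat_le_iff of_nat_mult of_nat_numeral)
      qed auto
      finally show ?thesis .
    qed
    have "{c\<in>S. \<zeta> c = z} \<subseteq> ?D1 \<union> ?D2" using div by fastforce
    then have "card {c\<in>S. \<zeta> c = z} \<le> card ?D1 + card ?D2"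
      using fin by (meson card_Un_le card_mono finite_UnI order_trans)
    then have "real (card {c\<in>S. \<zeta> c = z}) \<le> real (card ?D1) + real (card ?D2)"
      by (metis of_nat_add of_nat_le_iff)
    moreover have "real (card ?D1) \<le> B" using n by (intro dB) auto
    moreover have "real (card ?D2) \<le> B"
      using dB[of "n - z"] C by (auto simp: B_def)
    ultimately show ?thesis by linarith
  qed
  have "(\<Sum>c\<in>S. 2 / (of_int (zdist (int c) (int n)) + 1)) = (\<Sum>c\<in>S. 2 / (real (\<zeta> c) + 1))"
    by (intro sum.cong refl) (simp add: zr)
  also have "\<dots> = (\<Sum>z\<in>{..<M + 1}. \<Sum>c\<in>{c\<in>S. \<zeta> c = z}. 2 / (real (\<zeta> c) + 1))"
    by (rule sum.group [symmetric]) (use finS zM in auto)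
  also have "\<dots> = (\<Sum>z\<in>{..<M + 1}. real (card {c\<in>S. \<zeta> c = z}) * (2 / (real z + 1)))"
    by simp
  also have "\<dots> \<le> (\<Sum>z\<in>{..<M + 1}. 2 * B * (2 / (real z + 1)))"
    by (intro sum_mono mult_right_mono count) auto
  also have "\<dots> = 4 * B * harm (M + 1)"
    by (simp only: harm_altdef sum_distrib_left) (simp add: divide_inverse mult_ac add_ac)
  also have "\<dots> \<le> 4 * B * (1 + ln (real (M + 1)))"
    using C by (intro mult_left_mono harm_le_ln) (auto simp: B_def)
  also have "B \<le> 2 * C * (real n powr \<epsilon> * real M powr \<epsilon>)"
  proof -
    have "(2::real) powr \<epsilon> \<le> 2 powr 1" using C by (intro powr_mono) auto
    then have "C * (2 powr \<epsilon> * (real n powr \<epsilon> * real M powr \<epsilon>)) \<le> C * (2 * (real n powr \<epsilon> * real M powr \<epsilon>))"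
      using C by (intro mult_left_mono mult_right_mono) auto
    then show ?thesis by (simp add: B_def powr_mult)
  qed
  finally show ?thesis
    unfolding S_def by (simp add: mult_ac add.commute mult_left_mono mult_right_mono)
qed

text \<open>For \<open>c \<ge> 2 n\<close> neither estimate suffices alone: \<open>1 / n\<close>
  saves nothing over \<open>M\<close> terms, and \<open>14 n / c\<close> grows with
  \<open>n\<close>. Their geometric mean with weights \<open>7/8\<close> and \<open>1/8\<close>
  gives \<open>n powr (- 3/4)\<close> and \<open>c powr (- 1/8)\<close>. Together with the
  \<open>1 / n\<close> from integrating \<open>f\<close>, this meets the summable exponent
  \<open>- 7/4\<close>.\<close>

lemma sum_quad_err_le:
  assumes C: "\<And>n. n > 0 \<Longrightarrow> real (card {d. d dvd n}) \<le> C * real n powr \<epsilon>" "C \<ge> 0" "\<epsilon> \<ge> 0" "\<epsilon> \<le> 1"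
    and n: "n > 0" and M: "M > 0" and x: "0 \<le> x" "x \<le> 1"
  shows "(\<Sum>c=1..M. norm (quad_err c n x)) \<le> (1 + ln (real M + 1)) *
     (14 * real n powr (- 3/4) * real M powr (7/8) + (8 * C + 2) * (real n powr \<epsilon> * real M powr \<epsilon>))"
proof -
  define l where "l = 1 + ln (real M + 1)"
  have l: "l \<ge> 1" by (simp add: l_def)
  have large: "norm (quad_err c n x) \<le> 14 * real n powr (- 3/4) * real c powr (- 1/8)" if c: "c \<ge> 2 * n" for c
  proof -
    define t where "t = norm (quad_err c n x)"
    have c0: "c > 0" using c n by simp
    have t: "t \<le> 1 / real n" "t \<le> 14 * real n / real c" "t \<ge> 0"
      using quad_err_bound_large_c[OF x n c] quad_err_riemann_sum[OF x c0 n] by (auto simp: t_def)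
    have "t = t powr (7/8) * t powr (1/8)"
      using t(3) powr_add[of t "7/8" "1/8"] by (cases "t = 0") auto
    also have "\<dots> \<le> (1 / real n) powr (7/8) * (14 * real n / real c) powr (1/8)"
      using t by (intro mult_mono powr_mono2) auto
    also have "\<dots> = 14 powr (1/8) * (real n powr (- 7/8) * real n powr (1/8)) * real c powr (- 1/8)"
      using n c0 by (simp add: powr_divide powr_mult powr_minus field_simps)
    also have "real n powr (- 7/8) * real n powr (1/8) = real n powr (- 3/4)"
      by (simp add: powr_add [symmetric])
    also have "14 powr (1/8) * real n powr (- 3/4) * real c powr (- 1/8) \<le> 14 * real n powr (- 3/4) * real c powr (- 1/8)"
    proof (intro mult_right_mono)
      have "(14::real) powr (1/8) \<le> 14 powr 1" by (intro powr_mono) auto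
      then show "(14::real) powr (1/8) \<le> 14" by simp
    qed auto
    finally show ?thesis by (simp add: t_def)
  qed
  let ?S = "{c\<in>{1..M}. c < 2 * n}"
  have "(\<Sum>c=1..M. norm (quad_err c n x)) \<le> (\<Sum>c=1..M. 14 * real n powr (- 3/4) * real c powr (- 1/8)
       + (if c < 2 * n then 1 / real n + 2 / (of_int (zdist (int c) (int n)) + 1) else 0))"
  proof (intro sum_mono)
    fix c assume c: "c \<in> {1..M}"
    show "norm (quad_err c n x) \<le> 14 * real n powr (- 3/4) * real c powr (- 1/8)
       + (if c < 2 * n then 1 / real n + 2 / (of_int (zdist (int c) (int n)) + 1) else 0)"
    proof (cases "c < 2 * n")
      case True
      with quad_err_bound[OF x, of c n] c n show ?thesis
        by (simp add: add_increasing)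
    next
      case False
      with large[of c] show ?thesis by simp
    qed
  qed
  also have "\<dots> = 14 * real n powr (- 3/4) * (\<Sum>c=1..M. real c powr (- 1/8))
     + (\<Sum>c\<in>?S. 1 / real n + 2 / (of_int (zdist (int c) (int n)) + 1))"
    by (subst sum.distrib) (simp add: sum_distrib_left sum.inter_filter [symmetric])
  also have "\<dots> = 14 * real n powr (- 3/4) * (\<Sum>c=1..M. real c powr (- 1/8))
     + real (card ?S) / real n + (\<Sum>c\<in>?S. 2 / (of_int (zdist (int c) (int n)) + 1))"
    by (simp add: sum.distrib)
  also have "\<dots> \<le> 14 * real n powr (- 3/4) * (real M powr (7/8) * l) + 2 * (l * (real n powr \<epsilon> * real M powr \<epsilon>))
     + 8 * C * l * (real n powr \<epsilon> * real M powr \<epsilon>)"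
  proof (intro add_mono mult_left_mono)
    have "(\<Sum>c=1..M. real c powr (- (1/8))) \<le> real M powr (1 - 1/8) * (1 + ln (real M))"
      using M by (intro sum_powr_le) auto
    also have "\<dots> \<le> real M powr (7/8) * l"
      using M by (auto simp: l_def intro!: mult_left_mono)
    finally show "(\<Sum>c=1..M. real c powr (- 1/8)) \<le> real M powr (7/8) * l" by simp
    have "card ?S \<le> card {..<2 * n}" by (intro card_mono) auto
    then have "real (card ?S) / real n \<le> 2" using n by (simp add: divide_le_eq)
    also have "\<dots> \<le> 2 * (l * (real n powr \<epsilon> * real M powr \<epsilon>))"
    proof -
      have "1 * (1 * 1) \<le> l * (real n powr \<epsilon> * real M powr \<epsilon>)"
        using n M l C by (intro mult_mono ge_one_powr_ge_zero) auto
      then show ?thesis by simp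
    qed
    finally show "real (card ?S) / real n \<le> 2 * (l * (real n powr \<epsilon> * real M powr \<epsilon>))" .
    show "(\<Sum>c\<in>?S. 2 / (of_int (zdist (int c) (int n)) + 1)) \<le> 8 * C * l * (real n powr \<epsilon> * real M powr \<epsilon>)"
      unfolding l_def by (intro sum_inverse_zdist_moduli_le C n M)
  qed auto
  also have "\<dots> = l * (14 * real n powr (- 3/4) * real M powr (7/8) + (8 * C + 2) * (real n powr \<epsilon> * real M powr \<epsilon>))"
    by (simp add: algebra_simps)
  finally show ?thesis by (simp add: l_def)
qed

section \<open>Sums of cusp values\<close>

text \<open>\<open>Lim\<close> is a description operator; that the limit exists at the fractions in
  question is established within \<open>cusp_values\<close>.\<close>

definition cusp_value :: "(complex \<Rightarrow> complex) \<Rightarrow> real \<Rightarrow> complex" where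
  "cusp_value F r = Lim (at_right 0) (\<lambda>y::real. F (of_real r + \<i> * of_real y))"

text \<open>The fractions are sorted by their reduced denominator \<open>d\<close>, since the
  transformation at a cusp requires a coprime numerator.\<close>

lemma sum_fractions_eq:
  fixes Q :: "real \<Rightarrow> 'a::comm_monoid_add"
  assumes c: "c > 0"
  shows "(\<Sum>a\<in>{a::nat. real a \<le> real c * x}. Q (real a / real c))
       = (\<Sum>d | d dvd c. \<Sum>a\<in>{a::nat. real a \<le> real d * x \<and> coprime a d}. Q (real a / real d))"
proof -
  let ?S = "{a::nat. real a \<le> real c * x}"
  have fin: "finite ?S"
    by (rule finite_subset[of _ "{..nat \<lfloor>real c * x\<rfloor>}"]) (auto simp: le_nat_floor)
  have "(\<Sum>a\<in>?S. Q (real a / real c)) = (\<Sum>d | d dvd c. \<Sum>a\<in>{a\<in>?S. c div gcd a c = d}. Q (real a / real c))"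
  proof (rule sum.group [symmetric])
    have "c div gcd a c dvd c" for a by (metis dvd_div_mult_self dvd_triv_left gcd_dvd2)
    then show "(\<lambda>a. c div gcd a c) ` ?S \<subseteq> {d. d dvd c}" by auto
  qed (use fin c in auto)
  also have "\<dots> = (\<Sum>d | d dvd c. \<Sum>a\<in>{a::nat. real a \<le> real d * x \<and> coprime a d}. Q (real a / real d))"
  proof (rule sum.cong[OF refl])
    fix d assume "d \<in> {d. d dvd c}"
    then obtain g where g: "c = d * g" by auto
    have g0: "g > 0" "d > 0" using c g by (auto intro: Nat.gr0I)
    have gg: "gcd a c = g" if "c div gcd a c = d" for a
    proof -
      have "gcd a c * d = c" using that by (metis dvd_mult_div_cancel gcd_dvd2)
      then show ?thesis using g g0 by simp
    qed
    show "(\<Sum>a\<in>{a\<in>?S. c div gcd a c = d}. Q (real a / real c)) = (\<Sum>a\<in>{a::nat. real a \<le> real d * x \<and> coprime a d}. Q (real a / real d))"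
    proof (rule sum.reindex_bij_witness[of _ "\<lambda>a. a * g" "\<lambda>a. a div g"])
      fix a assume a: "a \<in> {a\<in>?S. c div gcd a c = d}"
      then have ga: "gcd a c = g" using gg by simp
      then have "g dvd a" by auto
      then obtain k where k: "a = k * g" by (metis dvdE mult.commute)
      show "a div g * g = a" using k g0 by simp
      have "g * gcd k d = gcd (g * k) (g * d)" by (rule gcd_mult_distrib_nat)
      also have "\<dots> = gcd a c" by (simp only: k g mult.commute[of g])
      also note ga
      finally have "gcd k d = Suc 0" using g0 by simp
      then have "coprime k d" by (metis coprime_iff_gcd_eq_1 One_nat_def)
      moreover have "real k \<le> real d * x"
      proof -
        have "real k * real g \<le> (real d * x) * real g" using a by (simp add: k g mult_ac)
        then show ?thesis using g0 by simp
      qed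
      ultimately show "a div g \<in> {a::nat. real a \<le> real d * x \<and> coprime a d}" using k g0 by simp
      show "Q (real (a div g) / real d) = Q (real a / real c)" using k g g0 by simp
    next
      fix a assume a: "a \<in> {a::nat. real a \<le> real d * x \<and> coprime a d}"
      show "a * g div g = a" using g0 by simp
      have "gcd (g * a) (g * d) = g * gcd a d" by (rule gcd_mult_distrib_nat [symmetric])
      then have "gcd (a * g) c = g" using a by (simp add: g mult.commute)
      moreover have "real (a * g) \<le> real c * x"
      proof -
        have "real a * real g \<le> (real d * x) * real g" using a by (intro mult_right_mono) auto
        then show ?thesis by (simp add: g mult_ac)
      qed
      ultimately show "a * g \<in> {a\<in>?S. c div gcd a c = d}" using g g0 by simp
    qed
  qed
  finally show ?thesis .
qed

lemma S2_primitive: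
  assumes q: "q \<ge> 1" and f: "f \<in> S2 q"
  obtains F C where "C \<ge> 0" "\<And>z. Im z > 0 \<Longrightarrow> norm (f z) * Im z \<le> C"
    "\<And>z. Im z > 0 \<Longrightarrow> norm (f z) \<le> 4 * C / Im z ^ 2"
    "\<And>z. Im z > 0 \<Longrightarrow> (F has_field_derivative f z) (at z)"
    "\<And>z. Im z > 0 \<Longrightarrow> norm (F z) \<le> C / Im z"
proof -
  obtain C where C: "C \<ge> 0" "\<And>z. Im z > 0 \<Longrightarrow> norm (f z) * Im z \<le> C"
    using S2_bound[OF q f] by blast
  have "slash2 f 1 0 0 1 = f" by (simp add: slash2_def [abs_def] moebius_int_def)
  then have cp: "cuspidal_periodic 1 f"
    using S2_cuspidal_periodic[OF f, of 1 1 0 0 1] by simp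
  obtain F \<Phi> where F: "\<And>z. Im z > 0 \<Longrightarrow> (F has_field_derivative f z) (at z)"
    and Phi: "\<And>z. Im z > 0 \<Longrightarrow> (\<Phi> has_field_derivative F z) (at z)"
    and per: "\<And>z. Im z > 0 \<Longrightarrow> \<Phi> (z + of_real 1) = \<Phi> z"
    using cuspidal_periodic_primitive[OF cp] by metis
  have fC: "norm (f u) \<le> C / Im u" if "Im u > 0" for u
    using C(2)[OF that] that by (simp add: pos_le_divide_eq)
  show ?thesis
  proof (rule that[OF C _ F])
    fix z assume z: "Im z > 0"
    have "norm (f z) \<le> 2 * 1 * (2 * C / Im z) / Im z"
    proof (rule cuspidal_periodic_decay[OF cp z])
      fix u assume u: "Im u \<ge> Im z / 2"
      then have "norm (f u) \<le> C / Im u" using z by (intro fC) auto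
      also have "\<dots> \<le> C / (Im z / 2)" using u z C by (intro divide_left_mono) auto
      finally show "norm (f u) \<le> 2 * C / Im z" by (simp add: mult.commute)
    qed
    then show "norm (f z) \<le> 4 * C / Im z ^ 2" by (simp add: power2_eq_square)
    have "norm (F z) \<le> 1 * (C / Im z)"
    proof (rule periodic_primitive_bound[OF F Phi per _ z])
      fix u assume "Im u = Im z"
      then show "norm (f u) \<le> C / Im z" using fC[of u] z by simp
    qed auto
    then show "norm (F z) \<le> C / Im z" by simp
  qed
qed

text \<open>On the vertical line \<open>F\<close> is the cusp value plus \<open>\<psi>\<close>, the
  dual primitive sampled at a fixed multiple of the inverse of \<open>a\<close>. As \<open>y\<close>
  tends to 0 the dual height tends to infinity and \<open>\<psi>\<close> vanishes, which identifies
  the cusp value. For fixed \<open>y\<close> the sum of \<open>\<psi>\<close> is of the type treated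
  in \<open>sum_inverse_units_lipschitz\<close>.\<close>

lemma cusp_values:
  assumes q: "q \<ge> 1" "squarefree q" and f: "f \<in> S2 q" and c: "c > 0"
    and C: "C \<ge> 0" "\<And>z. Im z > 0 \<Longrightarrow> norm (f z) * Im z \<le> C"
    and f2: "\<And>z. Im z > 0 \<Longrightarrow> norm (f z) \<le> 4 * C / Im z ^ 2"
    and F: "\<And>z. Im z > 0 \<Longrightarrow> (F has_field_derivative f z) (at z)"
    and FC: "\<And>z. Im z > 0 \<Longrightarrow> norm (F z) \<le> C / Im z"
  shows modsym_cusp_value: "\<And>a. coprime a c \<Longrightarrow>
      modsym f (real a / real c) = 2 * of_real pi * \<i> * of_real (Re (cusp_value F (real a / real c)))"
    and sum_cusp_value_error: "\<And>N y. N \<le> c + 1 \<Longrightarrow> y > 0 \<Longrightarrow>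
      norm (\<Sum>a | a < N \<and> coprime a c. F (of_real (real a / real c) + \<i> * of_real y) - cusp_value F (real a / real c))
      \<le> 2 * (real q * C * real c ^ 2 * y) * (1 + (1 + ln (real c)) * (3 + ln (real c)) * (2 * real c ^ 3 * real (card {d. d dvd c}) ^ 3) powr (1/4))"
proof -
  have c': "int c > 0" using c by simp
  obtain N w h Fs \<Phi> where N: "N > 0" "N \<le> int q" and w: "coprime w (int c)"
    and cp: "cuspidal_periodic (of_int N) h"
    and hC: "\<And>z. Im z > 0 \<Longrightarrow> norm (h z) * Im z \<le> C"
    and Fs: "\<And>z. Im z > 0 \<Longrightarrow> (Fs has_field_derivative h z) (at z)"
    and Phi: "\<And>z. Im z > 0 \<Longrightarrow> (\<Phi> has_field_derivative Fs z) (at z)"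
    and perF: "\<And>z. Im z > 0 \<Longrightarrow> Fs (z + of_int N) = Fs z"
    and per: "\<And>z. Im z > 0 \<Longrightarrow> \<Phi> (z + of_int N) = \<Phi> z"
    and exp: "\<And>a. coprime a (int c) \<Longrightarrow> \<exists>\<kappa>. \<forall>y>0. F (of_int a / of_int (int c) + \<i> * of_real y)
        = \<kappa> + Fs (- (of_int (N * (w * modular_inverse (int c) a)) / of_int (int c)) + \<i> * of_real (1 / (of_int (int c) ^ 2 * y)))"
    and fb: "\<And>a y. coprime a (int c) \<Longrightarrow> y > 0 \<Longrightarrow> norm (f (of_int a / of_int (int c) + \<i> * of_real y)) \<le> 4 * of_int N * C * of_int (int c) ^ 2"
    apply (rule cusp_expansion[OF q f c', of F C])
      apply (erule F)
     apply (erule C(2))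
    subgoal premises p for N w h Fs \<Phi> using p(2-) by (rule that)
    done
  have perF': "Fs (z + of_real (of_int N)) = Fs z" and per': "\<Phi> (z + of_real (of_int N)) = \<Phi> z" if "Im z > 0" for z
    using perF[OF that] per[OF that] by simp_all
  have hC': "norm (h u) \<le> C / Im u" if "Im u > 0" for u
    using hC[OF that] that by (simp add: pos_le_divide_eq)
  have FsC: "norm (Fs z) \<le> of_int N * (C / Im z)" if z: "Im z > 0" for z
  proof (rule periodic_primitive_bound[OF Fs Phi per' _ z])
    fix u assume "Im u = Im z"
    then show "norm (h u) \<le> C / Im z" using hC'[of u] z by simp
  qed (use N in auto)
  define \<psi> where "\<psi> = (\<lambda>y k. Fs (of_real (of_int N * of_int k / real c) + \<i> * of_real (1 / (real c ^ 2 * y))))"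
  define j where "j = (\<lambda>a::nat. - w * modular_inverse (int c) (int a))"
  have psiC: "norm (\<psi> y k) \<le> of_int N * C * real c ^ 2 * y" if y: "y > 0" for y k
    unfolding \<psi>_def by (rule order_trans[OF FsC]) (use y c in auto)
  have Feq: "F (of_real (real a / real c) + \<i> * of_real y) = cusp_value F (real a / real c) + \<psi> y (j a)"
    and Flim: "((\<lambda>y. F (of_real (real a / real c) + \<i> * of_real y)) \<longlongrightarrow> cusp_value F (real a / real c)) (at_right 0)"
    if a: "coprime a c" and y: "y > 0" for a y
  proof -
    obtain \<kappa> where k: "\<And>y. y > 0 \<Longrightarrow> F (of_real (real a / real c) + \<i> * of_real y) = \<kappa> + \<psi> y (j a)"
      using exp[of "int a"] a by (auto simp: \<psi>_def j_def mult_ac)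
    have "((\<lambda>y. \<psi> y (j a)) \<longlongrightarrow> 0) (at_right 0)"
    proof (rule Lim_null_comparison)
      show "eventually (\<lambda>y. norm (\<psi> y (j a)) \<le> of_int N * C * real c ^ 2 * y) (at_right 0)"
        using eventually_at_right_less[of 0] by eventually_elim (rule psiC)
      show "((\<lambda>y. of_int N * C * real c ^ 2 * y) \<longlongrightarrow> 0) (at_right 0)"
        by (auto intro!: tendsto_eq_intros)
    qed
    then have "((\<lambda>y. \<kappa> + \<psi> y (j a)) \<longlongrightarrow> \<kappa> + 0) (at_right 0)"
      by (intro tendsto_intros)
    moreover have "eventually (\<lambda>y. \<kappa> + \<psi> y (j a) = F (of_real (real a / real c) + \<i> * of_real y)) (at_right 0)"
      using eventually_at_right_less[of 0] by eventually_elim (rule k[symmetric])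
    ultimately have lim: "((\<lambda>y. F (of_real (real a / real c) + \<i> * of_real y)) \<longlongrightarrow> \<kappa>) (at_right 0)"
      unfolding add_0_right by (rule Lim_transform_eventually)
    then have "cusp_value F (real a / real c) = \<kappa>"
      unfolding cusp_value_def by (intro tendsto_Lim) auto
    with lim k[OF y] show "F (of_real (real a / real c) + \<i> * of_real y) = cusp_value F (real a / real c) + \<psi> y (j a)"
      "((\<lambda>y. F (of_real (real a / real c) + \<i> * of_real y)) \<longlongrightarrow> cusp_value F (real a / real c)) (at_right 0)" by simp_all
  qed
  show "modsym f (real a / real c) = 2 * of_real pi * \<i> * of_real (Re (cusp_value F (real a / real c)))"
    if a: "coprime a c" for a
  proof (rule modsym_eq_Re[OF S2_holomorphic[OF f] F])
    \<comment> \<open>\<open>modsym_eq_Re\<close> asks for one constant at both ends; since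
      \<open>N c^2 \<ge> 1\<close>, the bound near the cusp also dominates
      \<open>4 * C\<close>.\<close>
    have "1 * 1 \<le> real_of_int N * real c ^ 2"
      using N c by (intro mult_mono) auto
    then have "(4 * C) * 1 \<le> (4 * C) * (real_of_int N * real c ^ 2)"
      using C by (intro mult_left_mono) auto
    then have D: "4 * C \<le> 4 * of_int N * C * real c ^ 2" by (simp add: mult_ac)
    show "norm (f z) \<le> 4 * of_int N * C * real c ^ 2 / Im z ^ 2" if "Im z > 0" for z
      using f2[OF that] D by (smt (verit) divide_right_mono zero_le_power2)
    show "norm (f (of_real (real a / real c) + \<i> * of_real y)) \<le> 4 * of_int N * C * real c ^ 2" if "y > 0" for y
      using fb[of "int a" y] a that by simp
    show "((\<lambda>y. F (of_real (real a / real c) + \<i> * of_real y)) \<longlongrightarrow> cusp_value F (real a / real c)) (at_right 0)"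
      using Flim[OF a zero_less_one] .
    show "((\<lambda>y. F (of_real (real a / real c) + \<i> * of_real y)) \<longlongrightarrow> 0) at_top"
    proof (rule Lim_null_comparison)
      show "eventually (\<lambda>y. norm (F (of_real (real a / real c) + \<i> * of_real y)) \<le> C / y) at_top"
        using eventually_gt_at_top[of 0]
      proof eventually_elim
        case (elim y)
        then show ?case using FC[of "of_real (real a / real c) + \<i> * of_real y"] by simp
      qed
      show "((\<lambda>y. C / y) \<longlongrightarrow> 0) at_top" by real_asymp
    qed
  qed
  show "norm (\<Sum>a | a < K \<and> coprime a c. F (of_real (real a / real c) + \<i> * of_real y) - cusp_value F (real a / real c))
      \<le> 2 * (real q * C * real c ^ 2 * y) * (1 + (1 + ln (real c)) * (3 + ln (real c)) * (2 * real c ^ 3 * real (card {d. d dvd c}) ^ 3) powr (1/4))"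
    if K: "K \<le> c + 1" and y: "y > 0" for K y
  proof -
    define Y where "Y = 1 / (real c ^ 2 * y)"
    have Y: "Y > 0" using c y by (simp add: Y_def)
    \<comment> \<open>The samples are \<open>N / c\<close> apart, the derivative is at most
      \<open>C / Y = C c^2 y\<close>, and \<open>N \<le> q\<close>; this makes \<open>L / c\<close>
      a bound for each increment of \<open>\<psi>\<close>.\<close>
    define L where "L = real q * C * real c ^ 2 * y"
    have L0: "L \<ge> 0" using C y by (simp add: L_def)
    have NL: "of_int N * (C / Y) \<le> L"
    proof -
      have "of_int N * (C / Y) = of_int N * (C * real c ^ 2 * y)" by (simp add: Y_def)
      also have "\<dots> \<le> real q * (C * real c ^ 2 * y)"
        using N C y by (intro mult_right_mono) auto
      finally show ?thesis by (simp add: L_def)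
    qed
    have psi_eq: "\<psi> y k = Fs (of_real (of_int N * of_int k / real c) + \<i> * of_real Y)" for k
      by (simp add: \<psi>_def Y_def)
    have hY: "norm (h z) \<le> C / Y" if "Im z = Y" for z
      using hC'[of z] that Y by simp
    have 1: "norm (\<Sum>a | a < K \<and> coprime (int a) (int c). \<psi> y (- w * modular_inverse (int c) (int a)))
      \<le> (of_int (int c) + 1) * norm ((\<Sum>k\<in>{0..<int c}. \<psi> y k) / of_int (int c))
        + 2 * L * (1 + ln (of_int (int c))) * (3 + ln (of_int (int c))) * (2 * of_int (int c) ^ 3 * real (ndiv (int c)) ^ 3) powr (1/4)"
    proof (rule sum_inverse_units_lipschitz[OF c'])
      show "int K \<le> int c + 1" using K by simp
      show "coprime (- w) (int c)" using w by simp
      show "\<psi> y (k mod int c) = \<psi> y k" for k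
      proof -
        have "real_of_int k = of_int (k mod int c) + of_int (k div int c) * real c"
          by (metis div_mult_mod_eq add.commute of_int_add of_int_mult of_int_of_nat_eq)
        then have "of_int N * of_int k / real c = of_int N * of_int (k mod int c) / real c + of_int (k div int c) * of_int N"
          using c by (simp add: field_simps)
        then have "\<psi> y k = Fs ((of_real (of_int N * of_int (k mod int c) / real c) + \<i> * of_real Y) + of_int (k div int c) * of_real (of_int N))"
          unfolding psi_eq by (simp only: of_real_add of_real_mult of_real_of_int_eq add_ac)
        also have "\<dots> = \<psi> y (k mod int c)"
          unfolding psi_eq by (rule periodic_int_shift[of Fs "of_int N"]) (use Y perF' in auto)
        finally show ?thesis by simp
      qed
      show "norm (\<psi> y (k + 1) - \<psi> y k) \<le> L / of_int (int c)" for k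
      proof -
        let ?u = "of_real (of_int N * of_int (k + 1) / real c) + \<i> * of_real Y :: complex"
        let ?v = "of_real (of_int N * of_int k / real c) + \<i> * of_real Y :: complex"
        have "norm (Fs ?u - Fs ?v) \<le> C / Y * norm (?u - ?v)"
          by (rule horizontal_lipschitz[of Y Fs h]) (use Fs hY Y in auto)
        also have "?u - ?v = of_real (of_int N / real c)" by (simp add: field_simps add_divide_distrib)
        also have "norm (complex_of_real (of_int N / real c)) = of_int N / real c"
          unfolding norm_of_real using N by simp
        also have "C / Y * (of_int N / real c) = of_int N * (C / Y) / real c" by simp
        also have "\<dots> \<le> L / real c" by (intro divide_right_mono NL) auto
        finally show ?thesis by (simp add: psi_eq)
      qed
    qed
    have "(\<Sum>k\<in>{0..<int c}. \<psi> y k) = (\<Sum>k<c. Fs (\<i> * of_real Y + of_real (of_int N * real k / real c)))"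
      by (subst sum_int_interval_eq_nat) (auto simp: psi_eq add.commute)
    then have "norm ((\<Sum>k\<in>{0..<int c}. \<psi> y k) / of_int (int c)) \<le> of_int N * (C / Y) / real c"
      using periodic_primitive_mean_bound[OF Fs Phi per', of "\<i> * of_real Y" "C / Y" c] N Y c hY by simp
    also have "\<dots> \<le> L / real c" by (intro divide_right_mono NL) auto
    finally have "(real c + 1) * norm ((\<Sum>k\<in>{0..<int c}. \<psi> y k) / of_int (int c)) \<le> (2 * real c) * (L / real c)"
      using c by (intro mult_mono) auto
    also have "\<dots> = 2 * L" using c by simp
    finally have 2: "(of_int (int c) + 1) * norm ((\<Sum>k\<in>{0..<int c}. \<psi> y k) / of_int (int c)) \<le> 2 * L" by simp
    have "(\<Sum>a | a < K \<and> coprime a c. F (of_real (real a / real c) + \<i> * of_real y) - cusp_value F (real a / real c))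
        = (\<Sum>a | a < K \<and> coprime a c. \<psi> y (j a))"
    proof (intro sum.cong refl)
      fix a assume "a \<in> {a. a < K \<and> coprime a c}"
      then have "coprime a c" by simp
      from Feq[OF this y] show "F (of_real (real a / real c) + \<i> * of_real y) - cusp_value F (real a / real c) = \<psi> y (j a)"
        by (simp only: add_diff_cancel_left')
    qed
    also have "\<dots> = (\<Sum>a | a < K \<and> coprime (int a) (int c). \<psi> y (- w * modular_inverse (int c) (int a)))"
      by (simp add: j_def)
    also note 1
    also have "(of_int (int c) + 1) * norm ((\<Sum>k\<in>{0..<int c}. \<psi> y k) / of_int (int c))
        + 2 * L * (1 + ln (of_int (int c))) * (3 + ln (of_int (int c))) * (2 * of_int (int c) ^ 3 * real (ndiv (int c)) ^ 3) powr (1/4)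
      \<le> 2 * L + 2 * L * (1 + ln (of_int (int c))) * (3 + ln (of_int (int c))) * (2 * of_int (int c) ^ 3 * real (ndiv (int c)) ^ 3) powr (1/4)"
      using 2 by linarith
    also have "\<dots> = 2 * L * (1 + (1 + ln (real c)) * (3 + ln (real c)) * (2 * real c ^ 3 * real (card {d. d dvd c}) ^ 3) powr (1/4))"
      unfolding ndiv_nat[OF c] by (simp add: algebra_simps)
    finally show ?thesis by (simp add: L_def)
  qed
qed

section \<open>From Riemann sums to the integrated series\<close>

text \<open>The integral over \<open>{0..x}\<close> of the Fourier series of \<open>F\<close> at
  height \<open>y\<close>, taken term by term. The series also makes sense at \<open>y = 0\<close>,
  where it carries the limit function.\<close>

definition fourier_primitive :: "(nat \<Rightarrow> complex) \<Rightarrow> real \<Rightarrow> real \<Rightarrow> complex" where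
  "fourier_primitive A x y = (\<Sum>n. A n / (2 * of_real pi * \<i> * of_nat (Suc n)) * of_real (exp (- 2 * pi * real (Suc n) * y))
      * ((e (of_nat (Suc n) * of_real x) - 1) / (2 * of_real pi * \<i> * of_nat (Suc n))))"

lemma norm_fourier_primitive_term_le:
  assumes "y \<ge> 0"
  shows "norm (A n / (2 * of_real pi * \<i> * of_nat (Suc n)) * of_real (exp (- 2 * pi * real (Suc n) * y))
      * ((e (of_nat (Suc n) * of_real x) - 1) / (2 * of_real pi * \<i> * of_nat (Suc n)))) \<le> norm (A n) * real (Suc n) powr (- 7/4)"
proof -
  define \<nu> where "\<nu> = real (Suc n)"
  have nu: "\<nu> \<ge> 1" by (simp add: \<nu>_def)
  have "norm (A n / (2 * of_real pi * \<i> * of_nat (Suc n))) \<le> norm (A n) / \<nu>"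
  proof -
    have "norm (A n / (2 * of_real pi * \<i> * of_nat (Suc n))) = norm (A n) / (2 * pi * \<nu>)"
      by (simp add: norm_divide norm_mult \<nu>_def del: of_nat_Suc)
    also have "\<dots> \<le> norm (A n) / (1 * \<nu>)"
      using nu pi_gt3 by (intro divide_left_mono mult_right_mono) auto
    finally show ?thesis by simp
  qed
  moreover have "norm ((e (of_nat (Suc n) * of_real x) - 1) / (2 * of_real pi * \<i> * of_nat (Suc n))) \<le> 1 / \<nu>"
  proof -
    have "norm ((e (of_nat (Suc n) * of_real x) - 1) / (2 * of_real pi * \<i> * of_nat (Suc n))) \<le> 1 / (2 * real (Suc n))"
      by (rule norm_primitive_term_le) simp
    also have "\<dots> \<le> 1 / \<nu>" unfolding \<nu>_def by (intro divide_left_mono) auto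
    finally show ?thesis .
  qed
  moreover have "norm (complex_of_real (exp (- 2 * pi * real (Suc n) * y))) \<le> 1"
    using assms by (simp add: mult_nonneg_nonneg)
  ultimately have "norm (A n / (2 * of_real pi * \<i> * of_nat (Suc n)) * of_real (exp (- 2 * pi * real (Suc n) * y))
      * ((e (of_nat (Suc n) * of_real x) - 1) / (2 * of_real pi * \<i> * of_nat (Suc n)))) \<le> norm (A n) / \<nu> * 1 * (1 / \<nu>)"
    unfolding norm_mult[of "_ * _"] norm_mult[of "A n / _"] using nu by (intro mult_mono) auto
  also have "\<dots> = norm (A n) * \<nu> powr (- 2)"
    using nu by (simp add: powr_minus power2_eq_square divide_inverse)
  also have "\<dots> \<le> norm (A n) * \<nu> powr (- 7/4)"
    using nu by (intro mult_left_mono powr_mono) auto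
  finally show ?thesis by (simp only: \<nu>_def)
qed

lemma fourier_primitive_tendsto:
  assumes S: "summable (\<lambda>n. norm (A n) * real (Suc n) powr (- 7/4))"
    and y: "y \<longlonglongrightarrow> 0" "\<And>M. y M \<ge> 0"
  shows "(\<lambda>M. fourier_primitive A x (y M)) \<longlonglongrightarrow> fourier_primitive A x 0"
proof -
  let ?t = "\<lambda>n y. A n / (2 * of_real pi * \<i> * of_nat (Suc n)) * of_real (exp (- 2 * pi * real (Suc n) * y))
      * ((e (of_nat (Suc n) * of_real x) - 1) / (2 * of_real pi * \<i> * of_nat (Suc n)))"
  have "(\<lambda>M. \<Sum>n. ?t n (y M)) \<longlonglongrightarrow> (\<Sum>n. ?t n 0)"
  proof (rule tannerys_theorem[THEN conjunct2, THEN conjunct2])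
    show "(\<lambda>M. ?t n (y M)) \<longlonglongrightarrow> ?t n 0" for n
      by (intro tendsto_intros y)
    show "eventually (\<lambda>(n, M). norm (?t n (y M)) \<le> norm (A n) * real (Suc n) powr (- 7/4)) (at_top \<times>\<^sub>F sequentially)"
      using norm_fourier_primitive_term_le[OF y(2)] by (intro always_eventually) auto
  qed (use S in auto)
  then show ?thesis by (simp only: fourier_primitive_def)
qed

text \<open>Summing over \<open>c\<close> inside the Fourier series lets
  \<open>sum_quad_err_le\<close> act on one frequency at a time. The part with exponent
  \<open>- 7/4\<close> converges without the exponential factor; the divisor part, with exponent
  \<open>- 1 + \<epsilon>\<close>, keeps it.\<close>

lemma average_primitive_error:
  assumes D: "\<And>n. n > 0 \<Longrightarrow> real (card {d. d dvd n}) \<le> D * real n powr \<epsilon>" "D \<ge> 0" "\<epsilon> > 0" "\<epsilon> \<le> 1"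
    and S1: "summable (\<lambda>n. norm (A n) * real (Suc n) powr (- 7/4))"
    and S2: "summable (\<lambda>n. norm (A n) * real (Suc n) powr (- 1 + \<epsilon>) * exp (- 2 * pi * real (Suc n) * y))"
    and F: "\<And>z. Im z > 0 \<Longrightarrow> (\<lambda>n. A n / (2 * of_real pi * \<i> * of_nat (Suc n)) * e (of_nat (Suc n) * z)) sums F z"
    and M: "M > 0" and x: "0 \<le> x" "x \<le> 1" and y: "y > 0"
  shows "norm (\<Sum>c=1..M. (\<Sum>a\<in>{a::nat. real a \<le> real c * x}. F (of_real (real a / real c) + \<i> * of_real y)) / of_nat c - fourier_primitive A x y)
      \<le> (1 + ln (real M + 1)) * (14 * real M powr (7/8) * (\<Sum>n. norm (A n) * real (Suc n) powr (- 7/4))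
          + (8 * D + 2) * real M powr \<epsilon> * (\<Sum>n. norm (A n) * real (Suc n) powr (- 1 + \<epsilon>) * exp (- 2 * pi * real (Suc n) * y)))"
proof -
  define l where "l = 1 + ln (real M + 1)"
  have l: "l \<ge> 0" by (simp add: l_def)
  define b where "b = (\<lambda>n. A n / (2 * of_real pi * \<i> * of_nat (Suc n)) * of_real (exp (- 2 * pi * real (Suc n) * y)))"
  define p where "p = (\<lambda>n. (e (of_nat (Suc n) * of_real x) - 1) / (2 * of_real pi * \<i> * of_nat (Suc n)))"
  have Fs: "(\<lambda>n. b n * e (of_nat (Suc n) * of_real r)) sums F (of_real r + \<i> * of_real y)" for r
  proof -
    have "e (of_nat (Suc n) * (of_real r + \<i> * of_real y)) = of_real (exp (- 2 * pi * real (Suc n) * y)) * e (of_nat (Suc n) * of_real r)" for n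
      by (simp add: e_def exp_of_real [symmetric] exp_add [symmetric] algebra_simps)
    with F[of "of_real r + \<i> * of_real y"] y show ?thesis by (simp add: b_def mult.assoc)
  qed
  have "summable (\<lambda>n. b n * p n)"
    unfolding b_def p_def
    by (rule summable_comparison_test'[OF S1]) (rule norm_fourier_primitive_term_le, use y in simp)
  then have I: "(\<lambda>n. b n * p n) sums fourier_primitive A x y"
    unfolding fourier_primitive_def b_def p_def by (rule summable_sums)
  define Ec where "Ec = (\<lambda>c. (\<Sum>a\<in>{a::nat. real a \<le> real c * x}. F (of_real (real a / real c) + \<i> * of_real y)) / of_nat c - fourier_primitive A x y)"
  have "(\<lambda>n. (\<Sum>a\<in>{a::nat. real a \<le> real c * x}. b n * e (of_nat (Suc n) * of_real (real a / real c))) / of_nat c - b n * p n) sums Ec c" for c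
    unfolding Ec_def by (intro sums_diff sums_divide sums_sum I Fs)
  moreover have "(\<Sum>a\<in>{a::nat. real a \<le> real c * x}. b n * e (of_nat (Suc n) * of_real (real a / real c))) / of_nat c - b n * p n = b n * quad_err c (Suc n) x" for n c
    unfolding quad_err_def p_def by (simp only: sum_distrib_left [symmetric] right_diff_distrib times_divide_eq_right)
  ultimately have "(\<lambda>n. b n * quad_err c (Suc n) x) sums Ec c" for c
    by (simp only:)
  then have "(\<lambda>n. \<Sum>c=1..M. b n * quad_err c (Suc n) x) sums (\<Sum>c=1..M. Ec c)"
    by (intro sums_sum)
  then have "norm (\<Sum>c=1..M. Ec c) = norm (\<Sum>n. \<Sum>c=1..M. b n * quad_err c (Suc n) x)"
    by (simp only: sums_iff)
  also have "\<dots> \<le> (\<Sum>n. l * (14 * real M powr (7/8) * (norm (A n) * real (Suc n) powr (- 7/4))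
          + (8 * D + 2) * real M powr \<epsilon> * (norm (A n) * real (Suc n) powr (- 1 + \<epsilon>) * exp (- 2 * pi * real (Suc n) * y))))"
  proof (rule norm_suminf_le)
    show "summable (\<lambda>n. l * (14 * real M powr (7/8) * (norm (A n) * real (Suc n) powr (- 7/4))
          + (8 * D + 2) * real M powr \<epsilon> * (norm (A n) * real (Suc n) powr (- 1 + \<epsilon>) * exp (- 2 * pi * real (Suc n) * y))))"
      by (intro summable_mult summable_add S1 S2)
    fix n
    define \<nu> where "\<nu> = real (Suc n)"
    define E where "E = exp (- 2 * pi * \<nu> * y)"
    have nu: "\<nu> \<ge> 1" by (simp add: \<nu>_def)
    have E: "0 \<le> E" "E \<le> 1" using nu y by (auto simp: E_def)
    have bn: "norm (b n) \<le> norm (A n) * \<nu> powr (- 1) * E"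
    proof -
      have "norm (b n) = norm (A n) / (2 * pi * \<nu>) * E"
        by (simp add: b_def norm_divide norm_mult \<nu>_def E_def del: of_nat_Suc)
      also have "\<dots> \<le> norm (A n) / (1 * \<nu>) * E"
        using nu pi_gt3 E by (intro mult_right_mono divide_left_mono) auto
      finally show ?thesis using nu by (simp add: powr_minus divide_inverse)
    qed
    have "norm (\<Sum>c=1..M. b n * quad_err c (Suc n) x) \<le> (\<Sum>c=1..M. norm (b n) * norm (quad_err c (Suc n) x))"
      by (rule sum_norm_le) (simp add: norm_mult)
    also have "\<dots> = norm (b n) * (\<Sum>c=1..M. norm (quad_err c (Suc n) x))"
      by (rule sum_distrib_left [symmetric])
    also have "\<dots> \<le> (norm (A n) * \<nu> powr (- 1) * E) * (l * (14 * \<nu> powr (- 3/4) * real M powr (7/8) + (8 * D + 2) * (\<nu> powr \<epsilon> * real M powr \<epsilon>)))"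
      unfolding l_def \<nu>_def
      by (intro mult_mono bn[unfolded \<nu>_def] sum_quad_err_le D M x) (use D E in \<open>auto intro!: sum_nonneg\<close>)
    also have "\<dots> = l * (14 * real M powr (7/8) * (norm (A n) * (\<nu> powr (- 1) * \<nu> powr (- 3/4))) * E
          + (8 * D + 2) * real M powr \<epsilon> * (norm (A n) * (\<nu> powr (- 1) * \<nu> powr \<epsilon>) * E))"
      by (simp add: algebra_simps)
    also have "\<nu> powr (- 1) * \<nu> powr (- 3/4) = \<nu> powr (- 7/4)"
      by (simp only: powr_add [symmetric]) simp
    also have "\<nu> powr (- 1) * \<nu> powr \<epsilon> = \<nu> powr (- 1 + \<epsilon>)"
      by (rule powr_add [symmetric])
    also have "l * (14 * real M powr (7/8) * (norm (A n) * \<nu> powr (- 7/4)) * E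
          + (8 * D + 2) * real M powr \<epsilon> * (norm (A n) * \<nu> powr (- 1 + \<epsilon>) * E))
       \<le> l * (14 * real M powr (7/8) * (norm (A n) * \<nu> powr (- 7/4)) * 1
          + (8 * D + 2) * real M powr \<epsilon> * (norm (A n) * \<nu> powr (- 1 + \<epsilon>) * E))"
      using l E by (intro mult_left_mono add_right_mono) auto
    finally show "norm (\<Sum>c=1..M. b n * quad_err c (Suc n) x) \<le> l * (14 * real M powr (7/8) * (norm (A n) * real (Suc n) powr (- 7/4))
          + (8 * D + 2) * real M powr \<epsilon> * (norm (A n) * real (Suc n) powr (- 1 + \<epsilon>) * exp (- 2 * pi * real (Suc n) * y)))"
      unfolding \<nu>_def E_def by (simp only: mult_1_right)
  qed
  also have "\<dots> = l * (14 * real M powr (7/8) * (\<Sum>n. norm (A n) * real (Suc n) powr (- 7/4))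
          + (8 * D + 2) * real M powr \<epsilon> * (\<Sum>n. norm (A n) * real (Suc n) powr (- 1 + \<epsilon>) * exp (- 2 * pi * real (Suc n) * y)))"
    by (simp only: suminf_mult suminf_add[symmetric] summable_mult summable_add S1 S2)
  finally show ?thesis by (simp only: Ec_def l_def)
qed

text \<open>After sorting by reduced denominators, each divisor \<open>d\<close> of \<open>c\<close>
  contributes at most \<open>T\<close>, the value at \<open>M\<close> of an estimate monotone in
  \<open>d\<close>. The number of divisors costs \<open>D * M powr \<epsilon>\<close>, and the
  factors \<open>1 / c\<close> sum to a logarithm.\<close>

lemma average_cusp_value_error:
  assumes q: "q \<ge> 1" "squarefree q" and f: "f \<in> S2 q"
    and C: "C \<ge> 0" "\<And>z. Im z > 0 \<Longrightarrow> norm (f z) * Im z \<le> C"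
    and f2: "\<And>z. Im z > 0 \<Longrightarrow> norm (f z) \<le> 4 * C / Im z ^ 2"
    and F: "\<And>z. Im z > 0 \<Longrightarrow> (F has_field_derivative f z) (at z)"
    and FC: "\<And>z. Im z > 0 \<Longrightarrow> norm (F z) \<le> C / Im z"
    and D: "\<And>n. n > 0 \<Longrightarrow> real (card {d. d dvd n}) \<le> D * real n powr \<epsilon>" "D \<ge> 0" "\<epsilon> > 0"
    and M: "M > 0" and x: "0 \<le> x" "x \<le> 1" and y: "y > 0"
  shows "norm (\<Sum>c=1..M. (\<Sum>a\<in>{a::nat. real a \<le> real c * x}. F (of_real (real a / real c) + \<i> * of_real y) - cusp_value F (real a / real c)) / of_nat c)
      \<le> (1 + ln (real M)) * (D * real M powr \<epsilon>) * (2 * (real q * C * real M ^ 2 * y) *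
          (1 + (1 + ln (real M)) * (3 + ln (real M)) * (2 * real M ^ 3 * (D * real M powr \<epsilon>) ^ 3) powr (1/4)))"
proof -
  define T where "T = 2 * (real q * C * real M ^ 2 * y) *
          (1 + (1 + ln (real M)) * (3 + ln (real M)) * (2 * real M ^ 3 * (D * real M powr \<epsilon>) ^ 3) powr (1/4))"
  let ?Q = "\<lambda>r. F (of_real r + \<i> * of_real y) - cusp_value F r"
  have tau: "real (card {d. d dvd c}) \<le> D * real M powr \<epsilon>" if "c > 0" "c \<le> M" for c
  proof -
    have "real (card {d. d dvd c}) \<le> D * real c powr \<epsilon>" by (rule D(1)[OF that(1)])
    also have "\<dots> \<le> D * real M powr \<epsilon>" using that D by (intro mult_left_mono powr_mono2) auto
    finally show ?thesis .
  qed
  have T0: "T \<ge> 0" unfolding T_def using C y M D by (intro mult_nonneg_nonneg add_nonneg_nonneg) auto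
  have red: "norm (\<Sum>a\<in>{a::nat. real a \<le> real d * x \<and> coprime a d}. ?Q (real a / real d)) \<le> T" if d: "d > 0" "d \<le> M" for d
  proof -
    obtain N where N: "{a::nat. real a \<le> real d * x} = {..<N}" "N \<le> d + 1"
      using nat_le_mult_set_eq[OF x d(1)] by blast
    then have "{a::nat. real a \<le> real d * x \<and> coprime a d} = {a. a < N \<and> coprime a d}" by auto
    then have "norm (\<Sum>a\<in>{a::nat. real a \<le> real d * x \<and> coprime a d}. ?Q (real a / real d))
       \<le> 2 * (real q * C * real d ^ 2 * y) * (1 + (1 + ln (real d)) * (3 + ln (real d)) * (2 * real d ^ 3 * real (card {k. k dvd d}) ^ 3) powr (1/4))"
      using sum_cusp_value_error[OF q f d(1) C f2 F FC N(2) y] by simp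
    also have "\<dots> \<le> T"
      unfolding T_def
    proof (intro mult_mono add_mono power_mono powr_mono2 order_refl)
      show "ln (real d) \<le> ln (real M)" "ln (real d) \<le> ln (real M)" using d by simp_all
    qed (use d C y tau[OF d] in \<open>auto intro!: mult_nonneg_nonneg add_nonneg_nonneg\<close>)
    finally show ?thesis .
  qed
  have "norm (\<Sum>c=1..M. (\<Sum>a\<in>{a::nat. real a \<le> real c * x}. ?Q (real a / real c)) / of_nat c)
      \<le> (\<Sum>c=1..M. D * real M powr \<epsilon> * T * (1 / real c))"
  proof (rule sum_norm_le)
    fix c assume "c \<in> {1..M}"
    then have c: "c > 0" "c \<le> M" by auto
    have "norm (\<Sum>a\<in>{a::nat. real a \<le> real c * x}. ?Q (real a / real c)) \<le> (\<Sum>d | d dvd c. T)"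
      unfolding sum_fractions_eq[OF c(1), of ?Q x]
    proof (intro sum_norm_le red)
      fix d assume "d \<in> {d. d dvd c}"
      then have d: "d dvd c" by simp
      show "d > 0" by (rule dvd_pos_nat[OF c(1) d])
      show "d \<le> M" using dvd_imp_le[OF d c(1)] c(2) by simp
    qed
    also have "\<dots> = real (card {d. d dvd c}) * T" by (rule sum_constant)
    also have "\<dots> \<le> D * real M powr \<epsilon> * T" by (intro mult_right_mono tau c T0)
    finally have "norm (\<Sum>a\<in>{a::nat. real a \<le> real c * x}. ?Q (real a / real c)) / real c \<le> D * real M powr \<epsilon> * T / real c"
      by (rule divide_right_mono) simp
    then show "norm ((\<Sum>a\<in>{a::nat. real a \<le> real c * x}. ?Q (real a / real c)) / of_nat c) \<le> D * real M powr \<epsilon> * T * (1 / real c)"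
      by (simp only: norm_divide norm_of_nat times_divide_eq_right mult_1_right)
  qed
  also have "\<dots> = D * real M powr \<epsilon> * T * harm M"
    by (simp only: harm_def sum_distrib_left inverse_eq_divide)
  also have "\<dots> \<le> D * real M powr \<epsilon> * T * (1 + ln (real M))"
    using M D T0 by (intro mult_left_mono harm_le_ln mult_nonneg_nonneg) auto
  finally show ?thesis unfolding T_def by (simp only: mult_ac)
qed

theorem theorem1p4:
  fixes q :: nat and f :: "complex \<Rightarrow> complex" and an :: "nat \<Rightarrow> complex" and x :: real
  assumes "q \<ge> 1" and "squarefree q"
    and "f \<in> S2 q"
    and "\<And>z. Im z > 0 \<Longrightarrow> (\<lambda>n. an (Suc n) * e (of_nat (Suc n) * z)) sums f z"
    and "0 \<le> x" and "x \<le> 1"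
  shows "(\<lambda>M. (1 / of_nat M) * (\<Sum>c=1..M. G f c x)) \<longlonglongrightarrow> gfun an x"
proof -
  note q = assms(1,2) and f = assms(3) and x = assms(5,6)
  define A where "A = (\<lambda>n. an (Suc n))"
  have fA: "(\<lambda>n. A n * e (of_nat (Suc n) * z)) sums f z" if "Im z > 0" for z
    using assms(4)[OF that] by (simp only: A_def)
  obtain F C where C: "C \<ge> 0" "\<And>z. Im z > 0 \<Longrightarrow> norm (f z) * Im z \<le> C"
    and f2: "\<And>z. Im z > 0 \<Longrightarrow> norm (f z) \<le> 4 * C / Im z ^ 2"
    and F: "\<And>z. Im z > 0 \<Longrightarrow> (F has_field_derivative f z) (at z)"
    and FC: "\<And>z. Im z > 0 \<Longrightarrow> norm (F z) \<le> C / Im z"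
    using S2_primitive[OF q(1) f] by metis
  have Fsums: "(\<lambda>n. A n / (2 * of_real pi * \<i> * of_nat (Suc n)) * e (of_nat (Suc n) * z)) sums F z" if "Im z > 0" for z
  proof (rule primitive_fourier_sums[OF fA F _ that])
    show "((\<lambda>y. F (\<i> * of_real y)) \<longlongrightarrow> 0) at_top"
    proof (rule Lim_null_comparison)
      show "eventually (\<lambda>y. norm (F (\<i> * of_real y)) \<le> C / y) at_top"
        using eventually_gt_at_top[of 0]
      proof eventually_elim
        case (elim y)
        then show ?case using FC[of "\<i> * of_real y"] by simp
      qed
      show "((\<lambda>y. C / y) \<longlongrightarrow> 0) at_top" by real_asymp
    qed
  qed
  \<comment> \<open>Up to logarithms and constants \<open>E1\<close> is
    \<open>M powr (- 1/8) + M powr (- 1/16 + 61/16 * \<epsilon>)\<close>, and \<open>E2\<close> is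
    at most \<open>M powr (- 1/8 + 7/4 * \<epsilon>)\<close>; any positive
    \<open>\<epsilon> < 1/61\<close> makes both tend to 0.\<close>
  define \<epsilon> :: real where "\<epsilon> = 1 / 100"
  obtain D where D: "D > 0" "\<And>n. n > 0 \<Longrightarrow> real (card {d. d dvd n}) \<le> D * real n powr \<epsilon>"
    using divisor_bound[of \<epsilon>] by (auto simp: \<epsilon>_def)
  have S0: "summable (\<lambda>n. norm (A n) ^ 2 * real (Suc n) powr (- 2 - \<epsilon>))"
    by (rule fourier_coeff_square_summable[OF fA C(2)]) (auto simp: \<epsilon>_def)
  have S1: "summable (\<lambda>n. norm (A n) * real (Suc n) powr (- 7/4))"
    by (rule fourier_coeff_summable[OF S0]) (simp add: \<epsilon>_def)
  define s0 where "s0 = (\<Sum>n. norm (A n) ^ 2 * real (Suc n) powr (- 2 - \<epsilon>)) + 1"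
  define s1 where "s1 = (\<Sum>n. norm (A n) * real (Suc n) powr (- 7/4))"
  have S2: "summable (\<lambda>n. norm (A n) * real (Suc n) powr (- 1 + \<epsilon>) * exp (- 2 * pi * real (Suc n) * y))"
    "(\<Sum>n. norm (A n) * real (Suc n) powr (- 1 + \<epsilon>) * exp (- 2 * pi * real (Suc n) * y)) \<le> s0 * y powr (- (1 + \<epsilon> + 2 * \<epsilon>) / 2)"
    if "y > 0" for y
    unfolding s0_def using that by (intro fourier_coeff_weighted_bound[OF S0]; simp add: \<epsilon>_def)+

  \<comment> \<open>At this height the Fourier series of \<open>F\<close> has effective length below \<open>M\<^sup>2\<close>, so it is controlled by the
    divisor function, while the dual height is at least \<open>M powr (-1/8)\<close>, within reach of the Kloosterman bound.\<close>
  define y where "y = (\<lambda>M::nat. real M powr (- 15/8))"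
  have y_pos: "y M > 0" if "M > 0" for M using that by (simp add: y_def)

  let ?S = "\<lambda>c::nat. {a::nat. real a \<le> real c * x}"
  define K where "K = (\<lambda>c::nat. (\<Sum>a\<in>?S c. cusp_value F (real a / real c)) / of_nat c)"
  \<comment> \<open>The same sum lifted to height \<open>y M\<close>. Its distance to the cusp sum
    \<open>K\<close> is measured by \<open>E2\<close>, and its distance to the integrated series by
    \<open>E1\<close>.\<close>
  define P where "P = (\<lambda>M c. (\<Sum>a\<in>?S c. F (of_real (real a / real c) + \<i> * of_real (y M))) / of_nat c)"
  define E1 where "E1 = (\<lambda>M::nat. 1 / real M * ((1 + ln (real M + 1)) * (14 * real M powr (7/8) * s1
          + (8 * D + 2) * real M powr \<epsilon> * (s0 * y M powr (- (1 + \<epsilon> + 2 * \<epsilon>) / 2)))))"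
  define E2 where "E2 = (\<lambda>M::nat. 1 / real M * ((1 + ln (real M)) * (D * real M powr \<epsilon>) * (2 * (real q * C * real M ^ 2 * y M) *
          (1 + (1 + ln (real M)) * (3 + ln (real M)) * (2 * real M ^ 3 * (D * real M powr \<epsilon>) ^ 3) powr (1/4)))))"

  have E1_lim: "E1 \<longlonglongrightarrow> 0"
  proof -
    \<comment> \<open>The constants \<open>s0\<close>, \<open>s1\<close> and \<open>D\<close> are
      symbolic; the identity separates them from explicit functions of \<open>M\<close>, whose
      limits are then computed.\<close>
    have ring: "a * (l * (14 * p * s1 + k * u * (s0 * v))) = 14 * s1 * (a * l * p) + k * s0 * (a * l * (u * v))"
      for a l p k u v :: real by (simp add: algebra_simps)
    have "(\<lambda>M::nat. 1 / real M * (1 + ln (real M + 1)) * real M powr (7/8)) \<longlonglongrightarrow> 0"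
      by real_asymp
    moreover have "(\<lambda>M::nat. 1 / real M * (1 + ln (real M + 1)) * (real M powr (1/100) * (real M powr (- 15/8)) powr (- (1 + 1/100 + 2 * (1/100)) / 2))) \<longlonglongrightarrow> 0"
      by real_asymp
    ultimately have "(\<lambda>M::nat. 14 * s1 * (1 / real M * (1 + ln (real M + 1)) * real M powr (7/8))
       + (8 * D + 2) * s0 * (1 / real M * (1 + ln (real M + 1)) * (real M powr (1/100) * (real M powr (- 15/8)) powr (- (1 + 1/100 + 2 * (1/100)) / 2)))) \<longlonglongrightarrow> 14 * s1 * 0 + (8 * D + 2) * s0 * 0"
      by (intro tendsto_add tendsto_mult_left)
    moreover have "E1 = (\<lambda>M::nat. 14 * s1 * (1 / real M * (1 + ln (real M + 1)) * real M powr (7/8))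
       + (8 * D + 2) * s0 * (1 / real M * (1 + ln (real M + 1)) * (real M powr (1/100) * (real M powr (- 15/8)) powr (- (1 + 1/100 + 2 * (1/100)) / 2))))"
      unfolding E1_def y_def \<epsilon>_def by (rule ext) (rule ring)
    ultimately show ?thesis by simp
  qed
  have E2_lim: "E2 \<longlonglongrightarrow> 0"
  proof -
    have ring: "a * (l * (D * u) * (2 * (real q * C * m * v) * (1 + l * k * (d * w))))
        = 2 * D * real q * C * (a * l * u * (m * v)) + 2 * D * real q * C * d * (a * l * u * (m * v) * (l * k * w))"
      for a l u m v k d w :: real by (simp add: algebra_simps)
    define d where "d = (2 * D ^ 3) powr (1/4)"
    have d: "(2 * real M ^ 3 * (D * real M powr \<epsilon>) ^ 3) powr (1/4) = d * (real M ^ 3 * (real M powr \<epsilon>) ^ 3) powr (1/4)" for M :: nat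
      unfolding d_def using D by (subst powr_mult [symmetric]) (auto simp: power_mult_distrib mult_ac)
    have "(\<lambda>M::nat. 1 / real M * (1 + ln (real M)) * real M powr (1/100) * (real M ^ 2 * real M powr (- 15/8))) \<longlonglongrightarrow> 0"
      by real_asymp
    moreover have "(\<lambda>M::nat. 1 / real M * (1 + ln (real M)) * real M powr (1/100) * (real M ^ 2 * real M powr (- 15/8))
        * ((1 + ln (real M)) * (3 + ln (real M)) * (real M ^ 3 * (real M powr (1/100)) ^ 3) powr (1/4))) \<longlonglongrightarrow> 0"
      by real_asymp
    ultimately have "(\<lambda>M::nat. 2 * D * real q * C * (1 / real M * (1 + ln (real M)) * real M powr (1/100) * (real M ^ 2 * real M powr (- 15/8)))
        + 2 * D * real q * C * d * (1 / real M * (1 + ln (real M)) * real M powr (1/100) * (real M ^ 2 * real M powr (- 15/8))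
        * ((1 + ln (real M)) * (3 + ln (real M)) * (real M ^ 3 * (real M powr (1/100)) ^ 3) powr (1/4)))) \<longlonglongrightarrow> 2 * D * real q * C * 0 + 2 * D * real q * C * d * 0"
      by (intro tendsto_add tendsto_mult_left)
    moreover have "E2 = (\<lambda>M::nat. 2 * D * real q * C * (1 / real M * (1 + ln (real M)) * real M powr (1/100) * (real M ^ 2 * real M powr (- 15/8)))
        + 2 * D * real q * C * d * (1 / real M * (1 + ln (real M)) * real M powr (1/100) * (real M ^ 2 * real M powr (- 15/8))
        * ((1 + ln (real M)) * (3 + ln (real M)) * (real M ^ 3 * (real M powr (1/100)) ^ 3) powr (1/4))))"
      unfolding E2_def d unfolding y_def \<epsilon>_def by (rule ext) (rule ring)
    ultimately show ?thesis by simp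
  qed
  have err: "norm (1 / of_nat M * (\<Sum>c=1..M. K c) - fourier_primitive A x (y M)) \<le> E1 M + E2 M" if M: "M > 0" for M
  proof -
    have PK: "P M c - K c = (\<Sum>a\<in>?S c. F (of_real (real a / real c) + \<i> * of_real (y M)) - cusp_value F (real a / real c)) / of_nat c" for c
      by (simp only: P_def K_def sum_subtractf diff_divide_distrib)
    have e1: "norm (\<Sum>c=1..M. P M c - fourier_primitive A x (y M)) \<le> (1 + ln (real M + 1)) * (14 * real M powr (7/8) * s1
          + (8 * D + 2) * real M powr \<epsilon> * (s0 * y M powr (- (1 + \<epsilon> + 2 * \<epsilon>) / 2)))"
    proof -
      have "norm (\<Sum>c=1..M. P M c - fourier_primitive A x (y M)) \<le> (1 + ln (real M + 1)) * (14 * real M powr (7/8) * s1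
          + (8 * D + 2) * real M powr \<epsilon> * (\<Sum>n. norm (A n) * real (Suc n) powr (- 1 + \<epsilon>) * exp (- 2 * pi * real (Suc n) * y M)))"
        unfolding P_def s1_def
        using D by (intro average_primitive_error[OF D(2) _ _ _ S1 S2(1)[OF y_pos[OF M]] Fsums M x y_pos[OF M]]) (auto simp: \<epsilon>_def)
      also have "\<dots> \<le> (1 + ln (real M + 1)) * (14 * real M powr (7/8) * s1
          + (8 * D + 2) * real M powr \<epsilon> * (s0 * y M powr (- (1 + \<epsilon> + 2 * \<epsilon>) / 2)))"
        using D by (intro mult_left_mono add_left_mono S2(2) y_pos M) auto
      finally show ?thesis .
    qed
    have e2: "norm (\<Sum>c=1..M. P M c - K c) \<le> (1 + ln (real M)) * (D * real M powr \<epsilon>) * (2 * (real q * C * real M ^ 2 * y M) *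
          (1 + (1 + ln (real M)) * (3 + ln (real M)) * (2 * real M ^ 3 * (D * real M powr \<epsilon>) ^ 3) powr (1/4)))"
      unfolding PK
      by (rule average_cusp_value_error[OF q f C f2 F FC D(2) _ _ M x y_pos[OF M]]) (use D in \<open>auto simp: \<epsilon>_def\<close>)
    have "(\<Sum>c=1..M. K c) - of_nat M * fourier_primitive A x (y M)
       = (\<Sum>c=1..M. P M c - fourier_primitive A x (y M)) - (\<Sum>c=1..M. P M c - K c)"
      by (simp add: sum_subtractf)
    then have "1 / of_nat M * (\<Sum>c=1..M. K c) - fourier_primitive A x (y M)
       = 1 / of_nat M * ((\<Sum>c=1..M. P M c - fourier_primitive A x (y M)) - (\<Sum>c=1..M. P M c - K c))"
      using M by (simp add: field_simps)
    also have "norm \<dots> = 1 / real M * norm ((\<Sum>c=1..M. P M c - fourier_primitive A x (y M)) - (\<Sum>c=1..M. P M c - K c))"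
      by (simp add: norm_mult norm_divide)
    also have "\<dots> \<le> 1 / real M * (norm (\<Sum>c=1..M. P M c - fourier_primitive A x (y M)) + norm (\<Sum>c=1..M. P M c - K c))"
      by (intro mult_left_mono norm_triangle_ineq4) simp
    also have "\<dots> \<le> E1 M + E2 M"
      unfolding E1_def E2_def distrib_left[symmetric] by (intro mult_left_mono add_mono e1 e2) simp
    finally show ?thesis .
  qed
  have "(\<lambda>M. 1 / of_nat M * (\<Sum>c=1..M. K c) - fourier_primitive A x (y M)) \<longlonglongrightarrow> 0"
  proof (rule Lim_null_comparison)
    show "eventually (\<lambda>M. norm (1 / of_nat M * (\<Sum>c=1..M. K c) - fourier_primitive A x (y M)) \<le> E1 M + E2 M) sequentially"
      using eventually_gt_at_top[of 0] by eventually_elim (rule err)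
    show "(\<lambda>M. E1 M + E2 M) \<longlonglongrightarrow> 0"
      using tendsto_add[OF E1_lim E2_lim] by simp
  qed
  moreover have "(\<lambda>M. fourier_primitive A x (y M)) \<longlonglongrightarrow> fourier_primitive A x 0"
  proof (rule fourier_primitive_tendsto[OF S1])
    show "y \<longlonglongrightarrow> 0" unfolding y_def by real_asymp
    show "y M \<ge> 0" for M by (simp add: y_def)
  qed
  ultimately have "(\<lambda>M. (1 / of_nat M * (\<Sum>c=1..M. K c) - fourier_primitive A x (y M)) + fourier_primitive A x (y M)) \<longlonglongrightarrow> 0 + fourier_primitive A x 0"
    by (rule tendsto_add)
  then have limK: "(\<lambda>M. 1 / of_nat M * (\<Sum>c=1..M. K c)) \<longlonglongrightarrow> fourier_primitive A x 0"
    by simp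

  \<comment> \<open>The sum in \<open>G\<close> also contains fractions that are not in lowest
    terms, so the numerator and denominator are first divided by their gcd.\<close>
  have modsym: "modsym f (real a / real c) = 2 * of_real pi * \<i> * of_real (Re (cusp_value F (real a / real c)))" if "c > 0" for a c :: nat
  proof -
    define g where "g = gcd a c"
    have g: "g > 0" using that by (simp add: g_def)
    have ac: "a = a div g * g" "c = c div g * g" by (simp_all add: g_def)
    have eq: "real a / real c = real (a div g) / real (c div g)"
      using g by (subst ac(1), subst ac(2)) simp
    have "coprime (a div g) (c div g)"
      unfolding g_def using that by (intro div_gcd_coprime) auto
    moreover have "c div g > 0"
      using that g by (simp add: g_def div_greater_zero_iff gcd_le2_nat)
    ultimately show ?thesis
      unfolding eq by (intro modsym_cusp_value[OF q f _ C f2 F FC])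
  qed
  have G: "G f c x = 2 * of_real pi * \<i> * of_real (Re (K c))" if "c > 0" for c
  proof -
    have "G f c x = 1 / of_nat c * (\<Sum>a\<in>?S c. 2 * of_real pi * \<i> * of_real (Re (cusp_value F (real a / real c))))"
      unfolding G_def by (simp only: modsym[OF that])
    also have "\<dots> = 2 * of_real pi * \<i> * of_real ((\<Sum>a\<in>?S c. Re (cusp_value F (real a / real c))) / real c)"
      by (simp add: sum_distrib_left [symmetric] field_simps)
    also have "(\<Sum>a\<in>?S c. Re (cusp_value F (real a / real c))) / real c = Re (K c)"
      by (simp add: K_def)
    finally show ?thesis .
  qed
  have "(\<lambda>M. 2 * of_real pi * \<i> * of_real (Re (1 / of_nat M * (\<Sum>c=1..M. K c)))) \<longlonglongrightarrow> 2 * of_real pi * \<i> * of_real (Re (fourier_primitive A x 0))"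
    by (intro tendsto_intros limK)
  moreover have "2 * of_real pi * \<i> * of_real (Re (1 / of_nat M * (\<Sum>c=1..M. K c))) = 1 / of_nat M * (\<Sum>c=1..M. G f c x)" for M
  proof -
    have "(\<Sum>c=1..M. G f c x) = (\<Sum>c=1..M. 2 * of_real pi * \<i> * of_real (Re (K c)))"
      by (intro sum.cong refl G) auto
    also have "\<dots> = 2 * of_real pi * \<i> * of_real (Re (\<Sum>c=1..M. K c))"
      by (simp add: sum_distrib_left)
    finally have s: "(\<Sum>c=1..M. G f c x) = 2 * of_real pi * \<i> * of_real (Re (\<Sum>c=1..M. K c))" .
    have r: "Re (1 / of_nat M * (\<Sum>c=1..M. K c)) = Re (\<Sum>c=1..M. K c) / real M"
      by (simp add: Re_divide_of_nat)
    show ?thesis unfolding s r by simp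
  qed
  \<comment> \<open>The two integrations produce
    \<open>1 / (2 pi i n)^2 = - 1 / (4 pi^2 n^2)\<close>, a real factor that passes through the real
    part; and \<open>2 pi i\<close> times \<open>- 1 / (4 pi^2)\<close> is
    \<open>1 / (2 pi i)\<close>.\<close>
  moreover have "2 * of_real pi * \<i> * of_real (Re (fourier_primitive A x 0)) = gfun an x"
  proof -
    define t where "t = (\<lambda>n. A n / (2 * of_real pi * \<i> * of_nat (Suc n)) * of_real (exp (- 2 * pi * real (Suc n) * 0))
      * ((e (of_nat (Suc n) * of_real x) - 1) / (2 * of_real pi * \<i> * of_nat (Suc n))))"
    define r where "r = (\<lambda>n. Re (A n * (e (of_nat (Suc n) * of_real x) - 1)) / (real (Suc n))^2)"
    have Ret: "Re (t n) = - (1 / (4 * pi ^ 2)) * r n" for n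
    proof -
      have "t n = A n * (e (of_nat (Suc n) * of_real x) - 1) * of_real (- 1 / (4 * pi ^ 2 * (real (Suc n))^2))"
        by (simp add: t_def power2_eq_square field_simps del: of_nat_Suc)
      then have "Re (t n) = Re (A n * (e (of_nat (Suc n) * of_real x) - 1)) * (- 1 / (4 * pi ^ 2 * (real (Suc n))^2))"
        by (simp only: times_complex.sel(1) Re_complex_of_real Im_complex_of_real mult_zero_right diff_0_right)
      then show ?thesis by (simp add: r_def field_simps del: of_nat_Suc)
    qed
    have "summable t"
      unfolding t_def by (rule summable_comparison_test'[OF S1]) (rule norm_fourier_primitive_term_le, simp)
    then have ts: "t sums fourier_primitive A x 0"
      unfolding fourier_primitive_def t_def by (rule summable_sums)
    then have "(\<lambda>n. Re (t n)) sums Re (fourier_primitive A x 0)" by (rule sums_Re)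
    then have "(\<lambda>n. (- 4 * pi ^ 2) * Re (t n)) sums ((- 4 * pi ^ 2) * Re (fourier_primitive A x 0))"
      by (rule sums_mult)
    then have "r sums ((- 4 * pi ^ 2) * Re (fourier_primitive A x 0))"
      by (simp add: Ret)
    then have "(\<lambda>n. complex_of_real (r n)) sums of_real ((- 4 * pi ^ 2) * Re (fourier_primitive A x 0))"
      by (rule sums_of_real)
    then have "gfun an x = (1 / (2 * of_real pi * \<i>)) * of_real ((- 4 * pi ^ 2) * Re (fourier_primitive A x 0))"
      unfolding gfun_def r_def A_def by (simp only: sums_iff)
    also have "\<dots> = 2 * of_real pi * \<i> * of_real (Re (fourier_primitive A x 0))"
      by (simp add: power2_eq_square field_simps)
    finally show ?thesis by simp
  qed
  ultimately show ?thesis by (simp only:)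
qed

end
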